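(* Let $k$ be a commutative ring with $2\in k^\times$, and let $G=\mathrm{Spec}\,A$ be an affine group scheme over $k$ with an involution $\theta$. Let $Y=\mathrm{Spec}\,B$ be an affine $k$-scheme, equipped with an action of $G$, and let $\eta$ be an involution of $B$. Assume: (i) the action of $G$ on $Y$ respects the involutions of $G$ and $Y$; (ii) the contraction algebra $\mathbf{A}$ of $(A,\theta)$ is flat over $k[t]$. Then $\mathbf{Y}$ is naturally equipped with an action of $\mathbf{G}$. Moreover, its differential action is given by $$\mathbf{x}(b)=\begin{cases}x(b)&(x\in\mathfrak k,\ b\in B^\eta)\\ \sqrt t\,x(b)&(x\in\mathfrak p,\ b\in B^\eta),\end{cases}\qquad \mathbf{x}\left(\tfrac1{\sqrt t}b\right)=\begin{cases}\tfrac1{\sqrt t}x(b)&(x\in\mathfrak k,\ b\in B^{-\eta})\\ x(b)&(x\in\mathfrak p,\ b\in B^{-\eta})\end{cases}$$ under the identification of $\boldsymbol{\mathfrak g}$ with the Lie algebra of $\mathbf{G}$ described in the context, where for $x\in\mathfrak g\subset\boldsymbol{\mathfrak g}$, $\mathbf{x}$ is the image of $x$ in the Lie algebra of $\mathbf{G}$.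
   Context: For a commutative $k$-algebra $C$ with an involution $\sigma$ (a $k$-algebra automorphism with square the identity), put $C^{\pm\sigma}=\{c\in C:\sigma(c)=\pm c\}$; its contraction algebra $\mathbf{C}$ is the $k[t]$-subalgebra of the Laurent polynomial ring $C[\sqrt t^{\pm1}]$ (variable $\sqrt t$, with $t=(\sqrt t)^2$) generated by $C^\sigma$ and $\frac1{\sqrt t}C^{-\sigma}$. The involution $\theta$ of the group scheme $G$ corresponds to an involution, also written $\theta$, of the commutative Hopf algebra $A$. Let $\mathbf{A}$ and $\mathbf{B}$ be the contraction algebras of $(A,\theta)$ and $(B,\eta)$, and put $\mathbf{G}=\mathrm{Spec}\,\mathbf{A}$, $\mathbf{Y}=\mathrm{Spec}\,\mathbf{B}$. Under (ii), $\mathbf{A}$ is a Hopf algebra over $k[t]$ with structure maps restricted from $A[\sqrt t^{\pm1}]$; the natural action of $\mathbf{G}$ on $\mathbf{Y}$ is the one whose coaction is restricted from the base change to $k[\sqrt t^{\pm1}]$ of the coaction of $A$ on $B$. Let $\mathfrak g=\mathrm{Der}_k(A,k)$ be the Lie algebra of $G$ ($k$ being an $A$-module via the counit), and let $\mathfrak k,\mathfrak p\subset\mathfrak g$ be the $+1$ and $-1$ eigenspaces of the involution induced by $\theta$. Let $\boldsymbol{\mathfrak g}=\mathfrak g\otimes_kk[t]$ be the Lie algebra over $k[t]$ whose bracket is $[x,y]_{\boldsymbol{\mathfrak g}}=[x,y]_{\mathfrak g}$ for $x\in\mathfrak k$, $y\in\mathfrak g$, and $[x,y]_{\boldsymbol{\mathfrak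 g}}=t[x,y]_{\mathfrak g}$ for $x,y\in\mathfrak p$. The identification of $\boldsymbol{\mathfrak g}$ with the Lie algebra $\mathrm{Der}_{k[t]}(\mathbf{A},k[t])$ of $\mathbf{G}$ is the $k[t]$-linear map $x\mapsto\mathbf{x}$ where, for $x\in\mathfrak k$ (resp. $x\in\mathfrak p$), $\mathbf{x}$ is the restriction to $\mathbf{A}$ of the derivation $x\otimes_kk[\sqrt t^{\pm1}]$ (resp. $\sqrt t\,(x\otimes_kk[\sqrt t^{\pm1}])$) from $A[\sqrt t^{\pm1}]$ to $k[\sqrt t^{\pm1}]$; this restriction takes values in $k[t]$, and the map is an isomorphism of Lie algebras when $A$ is finitely presented over $k$. For $x\in\mathfrak g$ and $b\in B$, $x(b)$ denotes the differential action of $\mathfrak g$ on $B$; $\mathbf{x}(-)$ denotes the differential action of $\mathbf{x}$ on $\mathbf{B}\subset B[\sqrt t^{\pm1}]$. *)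

theory Defs
  imports "HOL-Algebra.Module" "HOL-Algebra.Generated_Groups" "HOL-Algebra.Generated_Rings"
    "HOL-Algebra.Free_Abelian_Groups"
begin

section \<open>Tensor products over a commutative ring\<close>

text \<open>
  Modules and commutative algebras over a commutative ring are records as in HOL-Algebra.
  The tensor product of two modules is the free abelian group on pairs modulo the
  relations of bi-additivity and balancedness; an element of it is a coset.
\<close>

definition self_alg :: "('k, 'm) ring_scheme \<Rightarrow> ('k, 'k) module" where
  "self_alg R = \<lparr>carrier = carrier R, monoid.mult = monoid.mult R, monoid.one = \<one>\<^bsub>R\<^esub>,
     ring.zero = \<zero>\<^bsub>R\<^esub>, add = add R, smult = monoid.mult R\<rparr>"

definition tensor_free ::
  "('k, 'x, 'p) module_scheme \<Rightarrow> ('k, 'y, 'q) module_scheme \<Rightarrow> ('x \<times> 'y \<Rightarrow>\<^sub>0 int) monoid" where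
  "tensor_free M N = free_Abelian_group (carrier M \<times> carrier N)"

definition tensor_rel ::
  "('k, 'm) ring_scheme \<Rightarrow> ('k, 'x, 'p) module_scheme \<Rightarrow> ('k, 'y, 'q) module_scheme
     \<Rightarrow> ('x \<times> 'y \<Rightarrow>\<^sub>0 int) set" where
  "tensor_rel R M N = generate (tensor_free M N)
     ({frag_of (x \<oplus>\<^bsub>M\<^esub> x', y) - frag_of (x, y) - frag_of (x', y) | x x' y.
         x \<in> carrier M \<and> x' \<in> carrier M \<and> y \<in> carrier N} \<union>
      {frag_of (x, y \<oplus>\<^bsub>N\<^esub> y') - frag_of (x, y) - frag_of (x, y') | x y y'.
         x \<in> carrier M \<and> y \<in> carrier N \<and> y' \<in> carrier N} \<union>
      {frag_of (r \<odot>\<^bsub>M\<^esub> x, y) - frag_of (x, r \<odot>\<^bsub>N\<^esub> y) | r x y.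
         r \<in> carrier R \<and> x \<in> carrier M \<and> y \<in> carrier N})"

definition pure_tensor ::
  "('k, 'm) ring_scheme \<Rightarrow> ('k, 'x, 'p) module_scheme \<Rightarrow> ('k, 'y, 'q) module_scheme
     \<Rightarrow> 'x \<Rightarrow> 'y \<Rightarrow> ('x \<times> 'y \<Rightarrow>\<^sub>0 int) set" where
  "pure_tensor R M N x y = tensor_rel R M N #>\<^bsub>tensor_free M N\<^esub> frag_of (x, y)"

text \<open>
  The map out of the tensor product with values in \<open>T\<close> induced by \<open>h\<close>. It does not depend
  on the chosen representative when \<open>h\<close> is bi-additive and balanced, which is the case
  wherever it is used below.
\<close>

definition tensor_lift ::
  "('t, 'm) ring_scheme \<Rightarrow> ('x \<Rightarrow> 'y \<Rightarrow> 't) \<Rightarrow> ('x \<times> 'y \<Rightarrow>\<^sub>0 int) set \<Rightarrow> 't" where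
  "tensor_lift T h X = (let c = (SOME c. c \<in> X) in
     \<Oplus>\<^bsub>T\<^esub>p\<in>Poly_Mapping.keys c. [Poly_Mapping.lookup c p] \<cdot>\<^bsub>T\<^esub> h (fst p) (snd p))"

text \<open>The additive group of the tensor product (its multiplicative fields are not used).\<close>

definition tensor_group ::
  "('k, 'm) ring_scheme \<Rightarrow> ('k, 'x, 'p) module_scheme \<Rightarrow> ('k, 'y, 'q) module_scheme
     \<Rightarrow> ('x \<times> 'y \<Rightarrow>\<^sub>0 int) set ring" where
  "tensor_group R M N = (let Q = tensor_free M N Mod tensor_rel R M N in
     \<lparr>carrier = carrier Q, monoid.mult = undefined, monoid.one = undefined,
      ring.zero = \<one>\<^bsub>Q\<^esub>, add = monoid.mult Q\<rparr>)"

text \<open>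
  The fields \<open>mult\<close> and \<open>one\<close> are meaningful when \<open>M\<close> and \<open>N\<close> are algebras; when they are
  only modules, the remaining fields give the tensor product as a module.
\<close>

definition tensor ::
  "('k, 'm) ring_scheme \<Rightarrow> ('k, 'x, 'p) module_scheme \<Rightarrow> ('k, 'y, 'q) module_scheme
     \<Rightarrow> ('k, ('x \<times> 'y \<Rightarrow>\<^sub>0 int) set) module" where
  "tensor R M N = (let T = tensor_group R M N in
     \<lparr>carrier = carrier T,
      monoid.mult = (\<lambda>X Y. tensor_lift T (\<lambda>x y. tensor_lift T
                (\<lambda>x' y'. pure_tensor R M N (x \<otimes>\<^bsub>M\<^esub> x') (y \<otimes>\<^bsub>N\<^esub> y')) Y) X),
      monoid.one = pure_tensor R M N \<one>\<^bsub>M\<^esub> \<one>\<^bsub>N\<^esub>,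
      ring.zero = \<zero>\<^bsub>T\<^esub>,
      add = add T,
      smult = (\<lambda>r. tensor_lift T (\<lambda>x y. pure_tensor R M N (r \<odot>\<^bsub>M\<^esub> x) y))\<rparr>)"

definition tensor_map ::
  "('k, 'm) ring_scheme \<Rightarrow> ('k, 'x, 'p) module_scheme \<Rightarrow> ('k, 'y, 'q) module_scheme
     \<Rightarrow> ('z \<Rightarrow> 'x) \<Rightarrow> ('w \<Rightarrow> 'y) \<Rightarrow> ('z \<times> 'w \<Rightarrow>\<^sub>0 int) set \<Rightarrow> ('x \<times> 'y \<Rightarrow>\<^sub>0 int) set" where
  \<comment> \<open>\<open>f \<otimes> g\<close>; the modules given are the codomains of \<open>f\<close> and \<open>g\<close>\<close>
  "tensor_map R M N f g =
     tensor_lift (tensor R M N) (\<lambda>x y. pure_tensor R M N (f x) (g y))"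

definition tensor_assoc ::
  "('k, 'm) ring_scheme \<Rightarrow> ('k, 'x, 'p) module_scheme \<Rightarrow> ('k, 'y, 'q) module_scheme
     \<Rightarrow> ('k, 'z, 's) module_scheme
     \<Rightarrow> (('x \<times> 'y \<Rightarrow>\<^sub>0 int) set \<times> 'z \<Rightarrow>\<^sub>0 int) set \<Rightarrow> ('x \<times> ('y \<times> 'z \<Rightarrow>\<^sub>0 int) set \<Rightarrow>\<^sub>0 int) set" where
  \<comment> \<open>\<open>(x \<otimes> y) \<otimes> z \<mapsto> x \<otimes> (y \<otimes> z)\<close>\<close>
  "tensor_assoc R L M N = (let T = tensor R L (tensor R M N) in
     tensor_lift T (\<lambda>X z. tensor_lift T
       (\<lambda>x y. pure_tensor R L (tensor R M N) x (pure_tensor R M N y z)) X))"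

section \<open>Linear maps, algebra maps, flatness\<close>

definition lin_maps ::
  "('k, 'm) ring_scheme \<Rightarrow> ('k, 'x, 'p) module_scheme \<Rightarrow> ('k, 'y, 'q) module_scheme
     \<Rightarrow> ('x \<Rightarrow> 'y) set" where
  "lin_maps R M N = {f \<in> carrier M \<rightarrow> carrier N.
     (\<forall>x\<in>carrier M. \<forall>y\<in>carrier M. f (x \<oplus>\<^bsub>M\<^esub> y) = f x \<oplus>\<^bsub>N\<^esub> f y) \<and>
     (\<forall>r\<in>carrier R. \<forall>x\<in>carrier M. f (r \<odot>\<^bsub>M\<^esub> x) = r \<odot>\<^bsub>N\<^esub> f x)}"

definition alg_maps ::
  "('k, 'm) ring_scheme \<Rightarrow> ('k, 'x, 'p) module_scheme \<Rightarrow> ('k, 'y, 'q) module_scheme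
     \<Rightarrow> ('x \<Rightarrow> 'y) set" where
  "alg_maps R M N = ring_hom M N \<inter> lin_maps R M N"

text \<open>
  A formula of HOL cannot quantify over types, so the test modules \<open>N\<close> and \<open>N'\<close> range over all
  modules whose elements are of a type \<open>'u\<close> given by the argument \<open>U\<close>. By the
  ideal criterion this is flatness in the usual sense as soon as \<open>'u\<close> contains a copy of \<open>R\<close>.
\<close>

definition flat_module ::
  "'u itself \<Rightarrow> ('k, 'm) ring_scheme \<Rightarrow> ('k, 'x, 'p) module_scheme \<Rightarrow> bool" where
  "flat_module U R M \<longleftrightarrow> module R M \<and>
     (\<forall>(N :: ('k, 'u) module) (N' :: ('k, 'u) module) f.
        module R N \<and> module R N' \<and> f \<in> lin_maps R N N' \<and> inj_on f (carrier N) \<longrightarrow>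
        inj_on (tensor_map R N' M f (\<lambda>x. x)) (carrier (tensor R N M)))"

section \<open>Affine group schemes, actions, differential actions\<close>

definition hopf_algebra ::
  "('k, 'm) ring_scheme \<Rightarrow> ('k, 'a, 'p) module_scheme \<Rightarrow> ('a \<Rightarrow> ('a \<times> 'a \<Rightarrow>\<^sub>0 int) set)
     \<Rightarrow> ('a \<Rightarrow> 'k) \<Rightarrow> ('a \<Rightarrow> 'a) \<Rightarrow> bool" where
  "hopf_algebra R A \<Delta> \<epsilon> S \<longleftrightarrow>
     algebra R A \<and>
     \<Delta> \<in> alg_maps R A (tensor R A A) \<and> \<epsilon> \<in> alg_maps R A (self_alg R) \<and> S \<in> alg_maps R A A \<and>
     (\<forall>a\<in>carrier A.
        tensor_assoc R A A A (tensor_map R (tensor R A A) A \<Delta> (\<lambda>x. x) (\<Delta> a)) =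
        tensor_map R A (tensor R A A) (\<lambda>x. x) \<Delta> (\<Delta> a)) \<and>
     (\<forall>a\<in>carrier A. tensor_lift A (\<lambda>x y. \<epsilon> x \<odot>\<^bsub>A\<^esub> y) (\<Delta> a) = a) \<and>
     (\<forall>a\<in>carrier A. tensor_lift A (\<lambda>x y. \<epsilon> y \<odot>\<^bsub>A\<^esub> x) (\<Delta> a) = a) \<and>
     (\<forall>a\<in>carrier A. tensor_lift A (\<lambda>x y. S x \<otimes>\<^bsub>A\<^esub> y) (\<Delta> a) = \<epsilon> a \<odot>\<^bsub>A\<^esub> \<one>\<^bsub>A\<^esub>) \<and>
     (\<forall>a\<in>carrier A. tensor_lift A (\<lambda>x y. x \<otimes>\<^bsub>A\<^esub> S y) (\<Delta> a) = \<epsilon> a \<odot>\<^bsub>A\<^esub> \<one>\<^bsub>A\<^esub>)"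

definition alg_involution ::
  "('k, 'm) ring_scheme \<Rightarrow> ('k, 'a, 'p) module_scheme \<Rightarrow> ('a \<Rightarrow> 'a) \<Rightarrow> bool" where
  "alg_involution R C \<sigma> \<longleftrightarrow> \<sigma> \<in> alg_maps R C C \<and> (\<forall>c\<in>carrier C. \<sigma> (\<sigma> c) = c)"

definition hopf_involution ::
  "('k, 'm) ring_scheme \<Rightarrow> ('k, 'a, 'p) module_scheme \<Rightarrow> ('a \<Rightarrow> ('a \<times> 'a \<Rightarrow>\<^sub>0 int) set)
     \<Rightarrow> ('a \<Rightarrow> 'k) \<Rightarrow> ('a \<Rightarrow> 'a) \<Rightarrow> ('a \<Rightarrow> 'a) \<Rightarrow> bool" where
  "hopf_involution R A \<Delta> \<epsilon> S \<theta> \<longleftrightarrow> alg_involution R A \<theta> \<and>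
     (\<forall>a\<in>carrier A. \<Delta> (\<theta> a) = tensor_map R A A \<theta> \<theta> (\<Delta> a)) \<and>
     (\<forall>a\<in>carrier A. \<epsilon> (\<theta> a) = \<epsilon> a) \<and>
     (\<forall>a\<in>carrier A. S (\<theta> a) = \<theta> (S a))"

text \<open>
  An action of \<open>Spec A\<close> on \<open>Spec B\<close> is given by a right coaction \<open>\<rho> : B \<rightarrow> B \<otimes> A\<close>
  that is a map of algebras; a coaction \<open>B \<rightarrow> A \<otimes> B\<close> on the other side is turned into one of
  this kind by means of the antipode. With this choice \<open>x \<mapsto> (id \<otimes> x) \<circ> \<rho>\<close> is a Lie algebra action.
\<close>

definition coaction ::
  "('k, 'm) ring_scheme \<Rightarrow> ('k, 'a, 'p) module_scheme \<Rightarrow> ('a \<Rightarrow> ('a \<times> 'a \<Rightarrow>\<^sub>0 int) set)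
     \<Rightarrow> ('a \<Rightarrow> 'k) \<Rightarrow> ('k, 'b, 'q) module_scheme \<Rightarrow> ('b \<Rightarrow> ('b \<times> 'a \<Rightarrow>\<^sub>0 int) set) \<Rightarrow> bool" where
  "coaction R A \<Delta> \<epsilon> B \<rho> \<longleftrightarrow>
     algebra R B \<and> \<rho> \<in> alg_maps R B (tensor R B A) \<and>
     (\<forall>b\<in>carrier B.
        tensor_assoc R B A A (tensor_map R (tensor R B A) A \<rho> (\<lambda>x. x) (\<rho> b)) =
        tensor_map R B (tensor R A A) (\<lambda>x. x) \<Delta> (\<rho> b)) \<and>
     (\<forall>b\<in>carrier B. tensor_lift B (\<lambda>y a. \<epsilon> a \<odot>\<^bsub>B\<^esub> y) (\<rho> b) = b)"

text \<open>
  The module \<open>Der\<^sub>R(A, R)\<close>, where \<open>R\<close> is an \<open>A\<close>-module via \<open>\<epsilon>\<close>. Its elements are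
  extensional functions; the fields \<open>mult\<close> and \<open>one\<close> are not used.
\<close>

definition der ::
  "('k, 'm) ring_scheme \<Rightarrow> ('k, 'a, 'p) module_scheme \<Rightarrow> ('a \<Rightarrow> 'k) \<Rightarrow> ('k, 'a \<Rightarrow> 'k) module" where
  "der R A \<epsilon> = \<lparr>carrier = {x \<in> lin_maps R A (self_alg R) \<inter> extensional (carrier A).
       \<forall>a\<in>carrier A. \<forall>b\<in>carrier A.
         x (a \<otimes>\<^bsub>A\<^esub> b) = \<epsilon> a \<otimes>\<^bsub>R\<^esub> x b \<oplus>\<^bsub>R\<^esub> \<epsilon> b \<otimes>\<^bsub>R\<^esub> x a},
     monoid.mult = undefined, monoid.one = undefined,
     ring.zero = (\<lambda>a\<in>carrier A. \<zero>\<^bsub>R\<^esub>),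
     add = (\<lambda>x y. \<lambda>a\<in>carrier A. x a \<oplus>\<^bsub>R\<^esub> y a),
     smult = (\<lambda>r x. \<lambda>a\<in>carrier A. r \<otimes>\<^bsub>R\<^esub> x a)\<rparr>"

text \<open>The involution that \<open>\<theta>\<close> induces on derivations is \<open>x \<mapsto> x \<circ> \<theta>\<close>.\<close>

definition der_plus ::
  "('k, 'm) ring_scheme \<Rightarrow> ('k, 'a, 'p) module_scheme \<Rightarrow> ('a \<Rightarrow> 'k) \<Rightarrow> ('a \<Rightarrow> 'a) \<Rightarrow> ('a \<Rightarrow> 'k) set" where
  "der_plus R A \<epsilon> \<theta> = {x \<in> carrier (der R A \<epsilon>). \<forall>a\<in>carrier A. x (\<theta> a) = x a}"

definition der_minus ::
  "('k, 'm) ring_scheme \<Rightarrow> ('k, 'a, 'p) module_scheme \<Rightarrow> ('a \<Rightarrow> 'k) \<Rightarrow> ('a \<Rightarrow> 'a) \<Rightarrow> ('a \<Rightarrow> 'k) set" where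
  "der_minus R A \<epsilon> \<theta> = {x \<in> carrier (der R A \<epsilon>). \<forall>a\<in>carrier A. x (\<theta> a) = \<ominus>\<^bsub>R\<^esub> x a}"

definition diff_action ::
  "('k, 'b, 'q) module_scheme \<Rightarrow> ('b \<Rightarrow> ('b \<times> 'a \<Rightarrow>\<^sub>0 int) set) \<Rightarrow> ('a \<Rightarrow> 'k) \<Rightarrow> 'b \<Rightarrow> 'b" where
  \<comment> \<open>\<open>x(b) = (id \<otimes> x) (\<rho> b)\<close>\<close>
  "diff_action B \<rho> x b = tensor_lift B (\<lambda>y a. x a \<odot>\<^bsub>B\<^esub> y) (\<rho> b)"

section \<open>Laurent polynomials and contraction algebras\<close>

text \<open>
  \<open>laurent R C\<close> is \<open>C[s, s\<^sup>-\<^sup>1]\<close> as an algebra over \<open>R[s, s\<^sup>-\<^sup>1]\<close>, where \<open>s\<close> is the variable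
  \<open>\<surd>t\<close>; \<open>f i\<close> is the coefficient of \<open>s\<^sup>i\<close>.
\<close>

definition lmono :: "('c, 'm) ring_scheme \<Rightarrow> int \<Rightarrow> 'c \<Rightarrow> int \<Rightarrow> 'c" where
  "lmono C n c = (\<lambda>i. if i = n then c else \<zero>\<^bsub>C\<^esub>)"

definition laurent ::
  "('k, 'm) ring_scheme \<Rightarrow> ('k, 'c, 'p) module_scheme \<Rightarrow> (int \<Rightarrow> 'k, int \<Rightarrow> 'c) module" where
  "laurent R C = \<lparr>carrier = {f. (\<forall>i. f i \<in> carrier C) \<and> finite {i. f i \<noteq> \<zero>\<^bsub>C\<^esub>}},
     monoid.mult = (\<lambda>f g n. \<Oplus>\<^bsub>C\<^esub>i\<in>{i. f i \<noteq> \<zero>\<^bsub>C\<^esub>}. f i \<otimes>\<^bsub>C\<^esub> g (n - i)),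
     monoid.one = lmono C 0 \<one>\<^bsub>C\<^esub>,
     ring.zero = (\<lambda>n. \<zero>\<^bsub>C\<^esub>),
     add = (\<lambda>f g n. f n \<oplus>\<^bsub>C\<^esub> g n),
     smult = (\<lambda>p f n. \<Oplus>\<^bsub>C\<^esub>i\<in>{i. p i \<noteq> \<zero>\<^bsub>R\<^esub>}. p i \<odot>\<^bsub>C\<^esub> f (n - i))\<rparr>"

abbreviation laurent_base :: "('k, 'm) ring_scheme \<Rightarrow> (int \<Rightarrow> 'k, int \<Rightarrow> 'k) module" where
  "laurent_base R \<equiv> laurent R (self_alg R)"

text \<open>The ring \<open>R[t]\<close> as the subring of \<open>R[s, s\<^sup>-\<^sup>1]\<close> of polynomials in \<open>t = s\<^sup>2\<close>.\<close>

definition poly_t :: "('k, 'm) ring_scheme \<Rightarrow> (int \<Rightarrow> 'k, int \<Rightarrow> 'k) module" where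
  "poly_t R = (laurent_base R)\<lparr>carrier :=
     {p \<in> carrier (laurent_base R). \<forall>i. p i \<noteq> \<zero>\<^bsub>R\<^esub> \<longrightarrow> 0 \<le> i \<and> even i}\<rparr>"

definition eig_plus :: "('k, 'c, 'p) module_scheme \<Rightarrow> ('c \<Rightarrow> 'c) \<Rightarrow> 'c set" where
  "eig_plus C \<sigma> = {c \<in> carrier C. \<sigma> c = c}"

definition eig_minus :: "('k, 'c, 'p) module_scheme \<Rightarrow> ('c \<Rightarrow> 'c) \<Rightarrow> 'c set" where
  "eig_minus C \<sigma> = {c \<in> carrier C. \<sigma> c = \<ominus>\<^bsub>C\<^esub> c}"

text \<open>
  The \<open>R[t]\<close>-subalgebra generated by a set is the subring generated by that set together
  with the scalars from \<open>R[t]\<close>.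
\<close>

definition contraction ::
  "('k, 'm) ring_scheme \<Rightarrow> ('k, 'c, 'p) module_scheme \<Rightarrow> ('c \<Rightarrow> 'c)
     \<Rightarrow> (int \<Rightarrow> 'k, int \<Rightarrow> 'c) module" where
  "contraction R C \<sigma> = (laurent R C)\<lparr>carrier := generate_ring (laurent R C)
     ((\<lambda>p. p \<odot>\<^bsub>laurent R C\<^esub> \<one>\<^bsub>laurent R C\<^esub>) ` carrier (poly_t R) \<union>
      lmono C 0 ` eig_plus C \<sigma> \<union> lmono C (-1) ` eig_minus C \<sigma>)\<rparr>"

definition laurent_map :: "('c \<Rightarrow> 'd) \<Rightarrow> (int \<Rightarrow> 'c) \<Rightarrow> int \<Rightarrow> 'd" where
  \<comment> \<open>the base change of an \<open>R\<close>-linear map \<open>C \<rightarrow> D\<close> to \<open>R[s, s\<^sup>-\<^sup>1]\<close>\<close>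
  "laurent_map \<phi> f = (\<lambda>n. \<phi> (f n))"

abbreviation laurent_tensor ::
  "('k, 'm) ring_scheme \<Rightarrow> ('k, 'x, 'p) module_scheme \<Rightarrow> ('k, 'y, 'q) module_scheme
     \<Rightarrow> (int \<Rightarrow> 'k, ((int \<Rightarrow> 'x) \<times> (int \<Rightarrow> 'y) \<Rightarrow>\<^sub>0 int) set) module" where
  "laurent_tensor R M N \<equiv> tensor (laurent_base R) (laurent R M) (laurent R N)"

text \<open>
  The base change of an \<open>R\<close>-linear map \<open>\<phi> : C \<rightarrow> M \<otimes>\<^sub>R N\<close> to \<open>R[s, s\<^sup>-\<^sup>1]\<close>, with values in the tensor
  product of \<open>M[s, s\<^sup>-\<^sup>1]\<close> and \<open>N[s, s\<^sup>-\<^sup>1]\<close> over \<open>R[s, s\<^sup>-\<^sup>1]\<close>.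
\<close>

definition laurent_comap ::
  "('k, 'm) ring_scheme \<Rightarrow> ('k, 'c, 'r) module_scheme \<Rightarrow> ('k, 'x, 'p) module_scheme
     \<Rightarrow> ('k, 'y, 'q) module_scheme \<Rightarrow> ('c \<Rightarrow> ('x \<times> 'y \<Rightarrow>\<^sub>0 int) set)
     \<Rightarrow> (int \<Rightarrow> 'c) \<Rightarrow> ((int \<Rightarrow> 'x) \<times> (int \<Rightarrow> 'y) \<Rightarrow>\<^sub>0 int) set" where
  "laurent_comap R C M N \<phi> f = (let T = laurent_tensor R M N in
     \<Oplus>\<^bsub>T\<^esub>n\<in>{n. f n \<noteq> \<zero>\<^bsub>C\<^esub>}. lmono R n \<one>\<^bsub>R\<^esub> \<odot>\<^bsub>T\<^esub>
       tensor_lift T (\<lambda>x y. pure_tensor (laurent_base R) (laurent R M) (laurent R N)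
                              (lmono M 0 x) (lmono N 0 y)) (\<phi> (f n)))"

abbreviation contraction_tensor ::
  "('k, 'm) ring_scheme \<Rightarrow> ('k, 'x, 'p) module_scheme \<Rightarrow> ('x \<Rightarrow> 'x)
     \<Rightarrow> ('k, 'y, 'q) module_scheme \<Rightarrow> ('y \<Rightarrow> 'y)
     \<Rightarrow> (int \<Rightarrow> 'k, ((int \<Rightarrow> 'x) \<times> (int \<Rightarrow> 'y) \<Rightarrow>\<^sub>0 int) set) module" where
  "contraction_tensor R M \<mu> N \<nu> \<equiv> tensor (poly_t R) (contraction R M \<mu>) (contraction R N \<nu>)"

text \<open>
  The canonical map from the tensor product over \<open>R[t]\<close> of two contraction algebras to the
  tensor product over \<open>R[s, s\<^sup>-\<^sup>1]\<close> of the ambient Laurent polynomial algebras.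
\<close>

definition contraction_tensor_incl ::
  "('k, 'm) ring_scheme \<Rightarrow> ('k, 'x, 'p) module_scheme \<Rightarrow> ('k, 'y, 'q) module_scheme
     \<Rightarrow> ((int \<Rightarrow> 'x) \<times> (int \<Rightarrow> 'y) \<Rightarrow>\<^sub>0 int) set \<Rightarrow> ((int \<Rightarrow> 'x) \<times> (int \<Rightarrow> 'y) \<Rightarrow>\<^sub>0 int) set" where
  "contraction_tensor_incl R M N =
     tensor_map (laurent_base R) (laurent R M) (laurent R N) (\<lambda>x. x) (\<lambda>y. y)"

text \<open>
  \<open>comap_restricts\<close>: the base change of \<open>\<phi>\<close> to \<open>R[s, s\<^sup>-\<^sup>1]\<close> restricts, in a unique way, to a map
  from the contraction algebra of \<open>(C, \<gamma>)\<close> to the tensor product over \<open>R[t]\<close> of those of \<open>(M, \<mu>)\<close> and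
  \<open>(N, \<nu>)\<close>. That map is \<open>contraction_comap\<close>.
\<close>

definition comap_restricts ::
  "('k, 'm) ring_scheme \<Rightarrow> ('k, 'c, 'r) module_scheme \<Rightarrow> ('c \<Rightarrow> 'c)
     \<Rightarrow> ('k, 'x, 'p) module_scheme \<Rightarrow> ('x \<Rightarrow> 'x) \<Rightarrow> ('k, 'y, 'q) module_scheme \<Rightarrow> ('y \<Rightarrow> 'y)
     \<Rightarrow> ('c \<Rightarrow> ('x \<times> 'y \<Rightarrow>\<^sub>0 int) set) \<Rightarrow> bool" where
  "comap_restricts R C \<gamma> M \<mu> N \<nu> \<phi> \<longleftrightarrow>
     (\<forall>f\<in>carrier (contraction R C \<gamma>). \<exists>!X. X \<in> carrier (contraction_tensor R M \<mu> N \<nu>) \<and>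
        contraction_tensor_incl R M N X = laurent_comap R C M N \<phi> f)"

definition contraction_comap ::
  "('k, 'm) ring_scheme \<Rightarrow> ('k, 'c, 'r) module_scheme
     \<Rightarrow> ('k, 'x, 'p) module_scheme \<Rightarrow> ('x \<Rightarrow> 'x) \<Rightarrow> ('k, 'y, 'q) module_scheme \<Rightarrow> ('y \<Rightarrow> 'y)
     \<Rightarrow> ('c \<Rightarrow> ('x \<times> 'y \<Rightarrow>\<^sub>0 int) set)
     \<Rightarrow> (int \<Rightarrow> 'c) \<Rightarrow> ((int \<Rightarrow> 'x) \<times> (int \<Rightarrow> 'y) \<Rightarrow>\<^sub>0 int) set" where
  "contraction_comap R C M \<mu> N \<nu> \<phi> f = (THE X. X \<in> carrier (contraction_tensor R M \<mu> N \<nu>) \<and>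
     contraction_tensor_incl R M N X = laurent_comap R C M N \<phi> f)"

section \<open>The Lie algebra of the contraction\<close>

text \<open>\<open>R[t]\<close> as an algebra over \<open>R\<close>.\<close>

definition poly_t_alg :: "('k, 'm) ring_scheme \<Rightarrow> ('k, int \<Rightarrow> 'k) module" where
  "poly_t_alg R = (let P = poly_t R in
     \<lparr>carrier = carrier P, monoid.mult = monoid.mult P, monoid.one = \<one>\<^bsub>P\<^esub>, ring.zero = \<zero>\<^bsub>P\<^esub>, add = add P,
      smult = (\<lambda>r p n. r \<otimes>\<^bsub>R\<^esub> p n)\<rparr>)"

definition lie_poly ::
  "('k, 'm) ring_scheme \<Rightarrow> ('k, 'a, 'p) module_scheme \<Rightarrow> ('a \<Rightarrow> 'k)
     \<Rightarrow> ('k, (('a \<Rightarrow> 'k) \<times> (int \<Rightarrow> 'k) \<Rightarrow>\<^sub>0 int) set) module" where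
  \<comment> \<open>\<open>\<gg> \<otimes>\<^sub>R R[t]\<close>\<close>
  "lie_poly R A \<epsilon> = tensor R (der R A \<epsilon>) (poly_t_alg R)"

definition lie_const ::
  "('k, 'm) ring_scheme \<Rightarrow> ('k, 'a, 'p) module_scheme \<Rightarrow> ('a \<Rightarrow> 'k) \<Rightarrow> ('a \<Rightarrow> 'k)
     \<Rightarrow> (('a \<Rightarrow> 'k) \<times> (int \<Rightarrow> 'k) \<Rightarrow>\<^sub>0 int) set" where
  \<comment> \<open>the inclusion \<open>x \<mapsto> x \<otimes> 1\<close> of \<open>\<gg>\<close>\<close>
  "lie_const R A \<epsilon> x = pure_tensor R (der R A \<epsilon>) (poly_t_alg R) x \<one>\<^bsub>poly_t_alg R\<^esub>"

definition half :: "('k, 'm) ring_scheme \<Rightarrow> 'k" where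
  "half R = inv\<^bsub>R\<^esub> (\<one>\<^bsub>R\<^esub> \<oplus>\<^bsub>R\<^esub> \<one>\<^bsub>R\<^esub>)"

text \<open>
  For \<open>x = x\<^sub>+ + x\<^sub>-\<close> with \<open>x\<^sub>+ = (x + x \<circ> \<theta>) / 2\<close> and \<open>x\<^sub>- = (x - x \<circ> \<theta>) / 2\<close>, the restriction to the
  contraction of \<open>A\<close> of \<open>x\<^sub>+ \<otimes> R[s, s\<^sup>-\<^sup>1] + s (x\<^sub>- \<otimes> R[s, s\<^sup>-\<^sup>1])\<close>.
\<close>

definition der_contraction ::
  "('k, 'm) ring_scheme \<Rightarrow> ('k, 'a, 'p) module_scheme \<Rightarrow> ('a \<Rightarrow> 'a) \<Rightarrow> ('a \<Rightarrow> 'k)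
     \<Rightarrow> (int \<Rightarrow> 'a) \<Rightarrow> int \<Rightarrow> 'k" where
  "der_contraction R A \<theta> x = (\<lambda>f\<in>carrier (contraction R A \<theta>).
     laurent_map (\<lambda>a. half R \<otimes>\<^bsub>R\<^esub> (x a \<oplus>\<^bsub>R\<^esub> x (\<theta> a))) f \<oplus>\<^bsub>laurent_base R\<^esub>
     lmono R 1 \<one>\<^bsub>R\<^esub> \<otimes>\<^bsub>laurent_base R\<^esub>
       laurent_map (\<lambda>a. half R \<otimes>\<^bsub>R\<^esub> (x a \<ominus>\<^bsub>R\<^esub> x (\<theta> a))) f)"

definition lie_ident ::
  "('k, 'm) ring_scheme \<Rightarrow> ('k, 'a, 'p) module_scheme \<Rightarrow> ('a \<Rightarrow> 'k) \<Rightarrow> ('a \<Rightarrow> 'a)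
     \<Rightarrow> (('a \<Rightarrow> 'k) \<times> (int \<Rightarrow> 'k) \<Rightarrow>\<^sub>0 int) set \<Rightarrow> (int \<Rightarrow> 'a) \<Rightarrow> int \<Rightarrow> 'k" where
  \<comment> \<open>the \<open>R[t]\<close>-linear map \<open>x \<otimes> p \<mapsto> p \<cdot> \<^bold>x\<close>\<close>
  "lie_ident R A \<epsilon> \<theta> = (let D = der (poly_t R) (contraction R A \<theta>) (laurent_map \<epsilon>) in
     tensor_lift D (\<lambda>x p. p \<odot>\<^bsub>D\<^esub> der_contraction R A \<theta> x))"

end

theory Submission
  imports Defs
begin

text \<open>
  Write \<open>s = \<surd>t\<close>. The base change of \<open>\<rho>\<close> to \<open>R[s, 1/s]\<close> is a map of algebras, so it suffices to follow
  the generators of the contraction of \<open>B\<close>. Since \<open>\<rho>\<close> respects the involutions and 2 is invertible, \<open>\<rho>(b)\<close> is a sum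
  of tensors \<open>b\<^sub>+ \<otimes> a\<^sub>+\<close> and \<open>b\<^sub>- \<otimes> a\<^sub>- = t (s\<^sup>-\<^sup>1 b\<^sub>-) \<otimes> (s\<^sup>-\<^sup>1 a\<^sub>-)\<close> for \<open>b\<close> in the +1 eigenspace, and
  \<open>s\<^sup>-\<^sup>1 \<rho>(b)\<close> is a sum of tensors \<open>(s\<^sup>-\<^sup>1 b\<^sub>-) \<otimes> a\<^sub>+\<close> and \<open>b\<^sub>+ \<otimes> (s\<^sup>-\<^sup>1 a\<^sub>-)\<close> for \<open>b\<close> in the -1 eigenspace.

  The restriction is unique, and the axioms of a coaction are inherited, because the tensor products over
  \<open>R[t]\<close> of contraction algebras embed into those of the Laurent polynomial algebras over \<open>R[s, 1/s]\<close>. If \<open>N\<close> is an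
  \<open>R[t]\<close>-submodule of an \<open>R[s, 1/s]\<close>-module \<open>M\<close>, then \<open>N \<otimes> \<^bold>A \<rightarrow> M \<otimes> \<^bold>A\<close> is injective by flatness,
  and \<open>M \<otimes> \<^bold>A\<close> is isomorphic to \<open>M \<otimes> A[s, 1/s]\<close> because \<open>A[s, 1/s]\<close> is the base change of \<open>\<^bold>A\<close>.
\<close>

section \<open>Additive and semilinear maps\<close>

text \<open>Two obstacles shape the development. Flatness quantifies over test modules in one fixed
  type, while the modules to be tested are Laurent modules and iterated tensor products with deeply
  nested types; they are coded injectively into \<open>(int \<Rightarrow> 'w) set\<close> and
  replaced by isomorphic copies there. Moreover an element of a tensor product is a coset, and a map
  out of it evaluates an arbitrary representative; so identities are phrased as equalities of
  additive maps, which can be tested on pure tensors and, over Laurent polynomials, on monomials.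

  That C[s,1/s] is the base change of its contraction rests on 2 being a unit: a coefficient splits
  as a = a_+ + a_-, and s^n a = s^n a_+ + s^(n+1) (s^(-1) a_-), where a_+ and s^(-1) a_- lie in the
  contraction. Only the left inverse of the comparison map that this formula suggests is
  constructed, since injectivity is all that is wanted from it.\<close>

definition add_maps :: "('x, 'p) ring_scheme \<Rightarrow> ('y, 'q) ring_scheme \<Rightarrow> ('x \<Rightarrow> 'y) set" where
  "add_maps M N = {f \<in> carrier M \<rightarrow> carrier N.
     \<forall>x\<in>carrier M. \<forall>y\<in>carrier M. f (x \<oplus>\<^bsub>M\<^esub> y) = f x \<oplus>\<^bsub>N\<^esub> f y}"

text \<open>Three base rings occur: R, R[t] and R[s,1/s]. The comparison maps between them are
  linear only along \<open>lmono R 0\<close> or along the inclusion of R[t] in R[s,1/s]; carrying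
  the map of scalars as a parameter treats these and ordinary linear maps alike.\<close>

definition semilin ::
  "('k \<Rightarrow> 'l) \<Rightarrow> ('k, 'm) ring_scheme \<Rightarrow> ('k, 'x, 'p) module_scheme \<Rightarrow> ('l, 'y, 'q) module_scheme
     \<Rightarrow> ('x \<Rightarrow> 'y) set" where
  "semilin \<phi> R M N = {f \<in> add_maps M N.
     \<forall>r\<in>carrier R. \<forall>x\<in>carrier M. f (r \<odot>\<^bsub>M\<^esub> x) = \<phi> r \<odot>\<^bsub>N\<^esub> f x}"

lemma lin_maps_semilin: "lin_maps R M N = semilin (\<lambda>r. r) R M N"
  by (auto simp: lin_maps_def semilin_def add_maps_def)

lemma add_mapsI:
  assumes "\<And>x. x \<in> carrier M \<Longrightarrow> f x \<in> carrier N"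
    and "\<And>x y. x \<in> carrier M \<Longrightarrow> y \<in> carrier M \<Longrightarrow> f (x \<oplus>\<^bsub>M\<^esub> y) = f x \<oplus>\<^bsub>N\<^esub> f y"
  shows "f \<in> add_maps M N"
  using assms by (auto simp: add_maps_def)

lemma add_maps_closed: "f \<in> add_maps M N \<Longrightarrow> x \<in> carrier M \<Longrightarrow> f x \<in> carrier N"
  by (auto simp: add_maps_def)

lemma add_maps_add:
  "f \<in> add_maps M N \<Longrightarrow> x \<in> carrier M \<Longrightarrow> y \<in> carrier M \<Longrightarrow> f (x \<oplus>\<^bsub>M\<^esub> y) = f x \<oplus>\<^bsub>N\<^esub> f y"
  by (auto simp: add_maps_def)

lemma add_maps_zero:
  assumes "f \<in> add_maps M N" "abelian_group M" "abelian_group N"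
  shows "f \<zero>\<^bsub>M\<^esub> = \<zero>\<^bsub>N\<^esub>"
proof -
  interpret M: abelian_group M by fact
  interpret N: abelian_group N by fact
  have "f \<zero>\<^bsub>M\<^esub> \<oplus>\<^bsub>N\<^esub> f \<zero>\<^bsub>M\<^esub> = f \<zero>\<^bsub>M\<^esub>"
    using add_maps_add[OF assms(1), of "\<zero>\<^bsub>M\<^esub>" "\<zero>\<^bsub>M\<^esub>"] by simp
  then show ?thesis using add_maps_closed[OF assms(1)] by simp
qed

lemma add_maps_minus:
  assumes f: "f \<in> add_maps M N" "abelian_group M" "abelian_group N" and x: "x \<in> carrier M"
  shows "f (\<ominus>\<^bsub>M\<^esub> x) = \<ominus>\<^bsub>N\<^esub> f x"
proof -
  interpret M: abelian_group M by fact
  interpret N: abelian_group N by fact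
  have "f (\<ominus>\<^bsub>M\<^esub> x) \<oplus>\<^bsub>N\<^esub> f x = \<zero>\<^bsub>N\<^esub>"
    using add_maps_add[OF f(1), of "\<ominus>\<^bsub>M\<^esub> x" x] x add_maps_zero[OF f] by (simp add: M.l_neg)
  then show ?thesis using add_maps_closed[OF f(1)] x by (simp add: N.minus_equality)
qed

lemma add_maps_comp:
  "f \<in> add_maps M N \<Longrightarrow> g \<in> add_maps N P \<Longrightarrow> (\<lambda>x. g (f x)) \<in> add_maps M P"
  by (auto simp: add_maps_def Pi_def)

lemma add_maps_sum:
  assumes "f \<in> add_maps M N" "g \<in> add_maps M N" "abelian_group N"
  shows "(\<lambda>x. f x \<oplus>\<^bsub>N\<^esub> g x) \<in> add_maps M N"
proof -
  interpret N: abelian_group N by fact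
  show ?thesis
    using assms(1,2) by (intro add_mapsI) (simp_all add: add_maps_add add_maps_closed N.a_ac)
qed

lemma add_maps_id: "(\<lambda>x. x) \<in> add_maps M M"
  by (auto simp: add_maps_def)

lemma semilinI:
  assumes "f \<in> add_maps M N"
    and "\<And>r x. r \<in> carrier R \<Longrightarrow> x \<in> carrier M \<Longrightarrow> f (r \<odot>\<^bsub>M\<^esub> x) = \<phi> r \<odot>\<^bsub>N\<^esub> f x"
  shows "f \<in> semilin \<phi> R M N"
  using assms by (auto simp: semilin_def)

lemma semilin_add_maps: "f \<in> semilin \<phi> R M N \<Longrightarrow> f \<in> add_maps M N"
  by (auto simp: semilin_def)

lemmas semilin_closed = add_maps_closed[OF semilin_add_maps]
lemmas semilin_add = add_maps_add[OF semilin_add_maps]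

lemma semilin_smult:
  "f \<in> semilin \<phi> R M N \<Longrightarrow> r \<in> carrier R \<Longrightarrow> x \<in> carrier M \<Longrightarrow> f (r \<odot>\<^bsub>M\<^esub> x) = \<phi> r \<odot>\<^bsub>N\<^esub> f x"
  by (auto simp: semilin_def)

lemma semilin_id: "(\<lambda>x. x) \<in> semilin (\<lambda>r. r) R M M"
  by (auto simp: semilin_def add_maps_def)

lemma semilin_comp:
  assumes "f \<in> semilin \<phi> R M N" "g \<in> semilin \<psi> R' N L" "\<phi> \<in> carrier R \<rightarrow> carrier R'"
  shows "(\<lambda>x. g (f x)) \<in> semilin (\<lambda>r. \<psi> (\<phi> r)) R M L"
  using assms by (auto simp: semilin_def add_maps_def Pi_def)

section \<open>Tensor products\<close>

text \<open>The target is a mere additive group, so that a map may lead to a module over another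
  base ring; linearity of the induced map, where it matters, is a separate statement.\<close>

definition balanced ::
  "('k, 'm) ring_scheme \<Rightarrow> ('k, 'x, 'p) module_scheme \<Rightarrow> ('k, 'y, 'q) module_scheme
     \<Rightarrow> ('t, 'u) ring_scheme \<Rightarrow> ('x \<Rightarrow> 'y \<Rightarrow> 't) \<Rightarrow> bool" where
  "balanced R M N H h \<longleftrightarrow>
     (\<forall>y\<in>carrier N. (\<lambda>x. h x y) \<in> add_maps M H) \<and> (\<forall>x\<in>carrier M. h x \<in> add_maps N H) \<and>
     (\<forall>r\<in>carrier R. \<forall>x\<in>carrier M. \<forall>y\<in>carrier N. h (r \<odot>\<^bsub>M\<^esub> x) y = h x (r \<odot>\<^bsub>N\<^esub> y))"

lemma balancedI:
  assumes "\<And>y. y \<in> carrier N \<Longrightarrow> (\<lambda>x. h x y) \<in> add_maps M H"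
    and "\<And>x. x \<in> carrier M \<Longrightarrow> h x \<in> add_maps N H"
    and "\<And>r x y. r \<in> carrier R \<Longrightarrow> x \<in> carrier M \<Longrightarrow> y \<in> carrier N \<Longrightarrow>
           h (r \<odot>\<^bsub>M\<^esub> x) y = h x (r \<odot>\<^bsub>N\<^esub> y)"
  shows "balanced R M N H h"
  using assms by (auto simp: balanced_def)

text \<open>Product and scalar multiplication of \<open>tensor\<close> are defined by lifts into the
  bare group \<open>tensor_group\<close>. A lift reads only carrier, zero and addition of its
  target, so the target may be replaced by the full record.\<close>

lemma tensor_lift_cong_record:
  assumes "carrier T = carrier T'" "\<zero>\<^bsub>T\<^esub> = \<zero>\<^bsub>T'\<^esub>" "add T = add T'"
  shows "tensor_lift T = tensor_lift T'"
  using assms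
  by (intro ext) (simp add: tensor_lift_def finsum_def finprod_def add_pow_def int_pow_def nat_pow_def m_inv_def
      Let_def cong: if_cong)

locale tensor_pair = M: module R M + N: module R N
  for R :: "('k, 'm) ring_scheme" and M :: "('k, 'x, 'p) module_scheme" and N :: "('k, 'y, 'q) module_scheme"
begin

abbreviation "F \<equiv> tensor_free M N"
abbreviation "K \<equiv> tensor_rel R M N"
abbreviation "T \<equiv> tensor R M N"
abbreviation "pr \<equiv> pure_tensor R M N"

lemma group_F: "group F" and comm_group_F: "comm_group F"
  and carrier_F: "carrier F = {c. Poly_Mapping.keys c \<subseteq> carrier M \<times> carrier N}"
  and mult_F: "mult F = (+)" and one_F: "\<one>\<^bsub>F\<^esub> = 0"
  unfolding tensor_free_def
      apply (rule group_free_Abelian_group)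
     apply (rule abelian_free_Abelian_group)
  by (simp_all add: free_Abelian_group_def)

lemma carrier_F_frag: "x \<in> carrier M \<Longrightarrow> y \<in> carrier N \<Longrightarrow> frag_of (x, y) \<in> carrier F"
  by (simp add: carrier_F keys_frag_of)

lemma carrier_F_diff: "c \<in> carrier F \<Longrightarrow> d \<in> carrier F \<Longrightarrow> c - d \<in> carrier F"
  using keys_diff[of c d] by (auto simp: carrier_F)

abbreviation "gens \<equiv> {frag_of (x \<oplus>\<^bsub>M\<^esub> x', y) - frag_of (x, y) - frag_of (x', y) | x x' y.
         x \<in> carrier M \<and> x' \<in> carrier M \<and> y \<in> carrier N} \<union>
      {frag_of (x, y \<oplus>\<^bsub>N\<^esub> y') - frag_of (x, y) - frag_of (x, y') | x y y'.
         x \<in> carrier M \<and> y \<in> carrier N \<and> y' \<in> carrier N} \<union>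
      {frag_of (r \<odot>\<^bsub>M\<^esub> x, y) - frag_of (x, r \<odot>\<^bsub>N\<^esub> y) | r x y.
         r \<in> carrier R \<and> x \<in> carrier M \<and> y \<in> carrier N}"

lemma gens: "gens \<subseteq> carrier F"
  by (auto intro!: carrier_F_diff carrier_F_frag)

lemma subgroup_K: "subgroup K F"
  unfolding tensor_rel_def by (rule group.generate_is_subgroup[OF group_F gens])

lemma normal_K: "K \<lhd> F"
  by (rule comm_group.subgroup_imp_normal[OF comm_group_F subgroup_K])

lemma comm_group_Q: "comm_group (F Mod K)"
  by (rule comm_group.abelian_FactGroup[OF comm_group_F subgroup_K])

lemma carrier_T: "carrier T = (\<lambda>c. K #>\<^bsub>F\<^esub> c) ` carrier F"
  by (simp add: tensor_def tensor_group_def Let_def carrier_FactGroup)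

lemma add_T: "c \<in> carrier F \<Longrightarrow> d \<in> carrier F \<Longrightarrow> (K #>\<^bsub>F\<^esub> c) \<oplus>\<^bsub>T\<^esub> (K #>\<^bsub>F\<^esub> d) = K #>\<^bsub>F\<^esub> (c + d)"
  using normal.rcos_sum[OF normal_K, of c d]
  by (simp add: tensor_def tensor_group_def Let_def mult_F)

lemma zero_T: "\<zero>\<^bsub>T\<^esub> = K #>\<^bsub>F\<^esub> 0"
  by (simp add: tensor_def tensor_group_def Let_def one_F[symmetric]
      group.coset_mult_one[OF group_F] subgroup.subset[OF subgroup_K])

lemma abelian_group_T: "abelian_group T"
  using comm_groupE[OF comm_group_Q]
  by (intro abelian_groupI) (simp_all add: tensor_def tensor_group_def Let_def)

sublocale T: abelian_group T by (rule abelian_group_T)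

text \<open>The homomorphism on the free abelian group that \<open>h\<close> induces.
  \<open>tensor_lift\<close> is its value at a chosen representative; once the relations are known
  to be killed, the choice is irrelevant.\<close>

definition ev :: "('t, 'u) ring_scheme \<Rightarrow> ('x \<Rightarrow> 'y \<Rightarrow> 't) \<Rightarrow> ('x \<times> 'y \<Rightarrow>\<^sub>0 int) \<Rightarrow> 't" where
  "ev H h c = (\<Oplus>\<^bsub>H\<^esub>p\<in>Poly_Mapping.keys c. [Poly_Mapping.lookup c p] \<cdot>\<^bsub>H\<^esub> h (fst p) (snd p))"

lemma balanced_closed:
  "balanced R M N H h \<Longrightarrow> x \<in> carrier M \<Longrightarrow> y \<in> carrier N \<Longrightarrow> h x y \<in> carrier H"
  by (auto simp: balanced_def dest: add_maps_closed)

context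
  fixes H :: "('t, 'u) ring_scheme" and h
  assumes H: "abelian_group H" and h: "balanced R M N H h"
begin

interpretation H: abelian_group H by (rule H)

text \<open>Coefficients can cancel in a sum of two formal sums, so the supports differ; additivity
  is proved by summing all three over one common finite set.\<close>

lemma ev_superset:
  assumes "c \<in> carrier F" "finite S" "Poly_Mapping.keys c \<subseteq> S" "S \<subseteq> carrier M \<times> carrier N"
  shows "ev H h c = (\<Oplus>\<^bsub>H\<^esub>p\<in>S. [Poly_Mapping.lookup c p] \<cdot>\<^bsub>H\<^esub> h (fst p) (snd p))"
  unfolding ev_def
proof (rule H.add.finprod_mono_neutral_cong_left)
  show "(\<lambda>p. [Poly_Mapping.lookup c p] \<cdot>\<^bsub>H\<^esub> h (fst p) (snd p)) \<in> S \<rightarrow> carrier H"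
    using assms(4) by (auto intro!: H.add.int_pow_closed balanced_closed[OF h])
  show "\<And>i. i \<in> S - Poly_Mapping.keys c \<Longrightarrow> [Poly_Mapping.lookup c i] \<cdot>\<^bsub>H\<^esub> h (fst i) (snd i) = \<zero>\<^bsub>H\<^esub>"
    by (simp add: in_keys_iff add_pow_def int_pow_0)
qed (use assms in auto)

lemma ev_add:
  assumes "c \<in> carrier F" "d \<in> carrier F"
  shows "ev H h (c + d) = ev H h c \<oplus>\<^bsub>H\<^esub> ev H h d"
proof -
  let ?S = "Poly_Mapping.keys c \<union> Poly_Mapping.keys d"
  have S: "?S \<subseteq> carrier M \<times> carrier N" using assms by (auto simp: carrier_F)
  have cd: "c + d \<in> carrier F" using S keys_add[of c d] by (auto simp: carrier_F)
  have cl: "h (fst p) (snd p) \<in> carrier H" if "p \<in> ?S" for p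
    using that S by (auto intro!: balanced_closed[OF h])
  have "ev H h (c + d) = (\<Oplus>\<^bsub>H\<^esub>p\<in>?S. [Poly_Mapping.lookup (c + d) p] \<cdot>\<^bsub>H\<^esub> h (fst p) (snd p))"
    by (rule ev_superset[OF cd _ _ S]) (use keys_add[of c d] in auto)
  also have "\<dots> = (\<Oplus>\<^bsub>H\<^esub>p\<in>?S. [Poly_Mapping.lookup c p] \<cdot>\<^bsub>H\<^esub> h (fst p) (snd p)
      \<oplus>\<^bsub>H\<^esub> [Poly_Mapping.lookup d p] \<cdot>\<^bsub>H\<^esub> h (fst p) (snd p))"
    by (rule H.finsum_cong) (use cl in \<open>auto simp: lookup_add H.add.int_pow_mult simp_implies_def\<close>)
  also have "\<dots> = (\<Oplus>\<^bsub>H\<^esub>p\<in>?S. [Poly_Mapping.lookup c p] \<cdot>\<^bsub>H\<^esub> h (fst p) (snd p)) \<oplus>\<^bsub>H\<^esub>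
      (\<Oplus>\<^bsub>H\<^esub>p\<in>?S. [Poly_Mapping.lookup d p] \<cdot>\<^bsub>H\<^esub> h (fst p) (snd p))"
    by (rule H.finsum_addf) (use cl in \<open>auto intro!: H.add.int_pow_closed\<close>)
  also have "\<dots> = ev H h c \<oplus>\<^bsub>H\<^esub> ev H h d"
    using ev_superset[OF assms(1) _ _ S] ev_superset[OF assms(2) _ _ S] by auto
  finally show ?thesis .
qed

lemma ev_closed: "c \<in> carrier F \<Longrightarrow> ev H h c \<in> carrier H"
  unfolding ev_def carrier_F
  by (intro H.finsum_closed) (auto intro!: H.add.int_pow_closed balanced_closed[OF h])

lemma ev_frag: "x \<in> carrier M \<Longrightarrow> y \<in> carrier N \<Longrightarrow> ev H h (frag_of (x, y)) = h x y"
  using balanced_closed[OF h, of x y] by (simp add: ev_def keys_frag_of)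

lemma ev_hom: "ev H h \<in> hom F (add_monoid H)"
  using ev_add ev_closed by (auto simp: hom_def mult_F)

lemma ev_diff:
  assumes "c \<in> carrier F" "d \<in> carrier F"
  shows "ev H h (c - d) = ev H h c \<ominus>\<^bsub>H\<^esub> ev H h d"
proof -
  have "ev H h c = ev H h (c - d) \<oplus>\<^bsub>H\<^esub> ev H h d"
    using ev_add[OF carrier_F_diff[OF assms] assms(2)] by simp
  then show ?thesis
    using ev_closed assms carrier_F_diff[OF assms] by (simp add: H.minus_eq H.a_assoc H.r_neg)
qed

lemma ev_gens: assumes "c \<in> gens" shows "ev H h c = \<zero>\<^bsub>H\<^esub>"
proof -
  note [simp] = ev_diff ev_frag carrier_F_diff carrier_F_frag balanced_closed[OF h]
  have 1: "h (x \<oplus>\<^bsub>M\<^esub> x') y = h x y \<oplus>\<^bsub>H\<^esub> h x' y" if "x \<in> carrier M" "x' \<in> carrier M" "y \<in> carrier N" for x x' y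
    using h that by (auto simp: balanced_def add_maps_def)
  have 2: "h x (y \<oplus>\<^bsub>N\<^esub> y') = h x y \<oplus>\<^bsub>H\<^esub> h x y'" if "x \<in> carrier M" "y \<in> carrier N" "y' \<in> carrier N" for x y y'
    using h that by (auto simp: balanced_def add_maps_def)
  have 3: "h (r \<odot>\<^bsub>M\<^esub> x) y = h x (r \<odot>\<^bsub>N\<^esub> y)" if "r \<in> carrier R" "x \<in> carrier M" "y \<in> carrier N" for r x y
    using h that by (auto simp: balanced_def)
  have 4: "a \<oplus>\<^bsub>H\<^esub> b \<ominus>\<^bsub>H\<^esub> a \<ominus>\<^bsub>H\<^esub> b = \<zero>\<^bsub>H\<^esub>" if "a \<in> carrier H" "b \<in> carrier H" for a b
    using that H.r_neg[of "a \<oplus>\<^bsub>H\<^esub> b"] by (simp add: H.minus_eq H.a_assoc H.minus_add)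
  have 5: "a \<ominus>\<^bsub>H\<^esub> a = \<zero>\<^bsub>H\<^esub>" if "a \<in> carrier H" for a
    using that by (simp add: H.minus_eq H.r_neg)
  show ?thesis using assms by (auto simp: 1 2 3 4 5)
qed

text \<open>The kernel of \<open>ev\<close> is a subgroup containing the generating relations, hence
  all of \<open>K\<close>.\<close>

lemma ev_K: assumes "c \<in> K" shows "ev H h c = \<zero>\<^bsub>H\<^esub>"
proof -
  interpret ev: group_hom F "add_monoid H" "ev H h"
    using group_F H.a_group ev_hom by (simp add: group_hom_def group_hom_axioms_def)
  have "gens \<subseteq> kernel F (add_monoid H) (ev H h)"
  proof
    fix c assume "c \<in> gens"
    then have "c \<in> carrier F" "ev H h c = \<zero>\<^bsub>H\<^esub>" by (fact subsetD[OF gens], fact ev_gens)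
    then show "c \<in> kernel F (add_monoid H) (ev H h)" by (simp add: kernel_def)
  qed
  then have "K \<subseteq> kernel F (add_monoid H) (ev H h)"
    unfolding tensor_rel_def
    by (rule group.generate_subgroup_incl[OF group_F _ ev.subgroup_kernel])
  then show ?thesis using assms by (auto simp: kernel_def)
qed

text \<open>The representative picked by \<open>SOME\<close> differs from \<open>c\<close> by an
  element of \<open>K\<close>, on which \<open>ev\<close> vanishes.\<close>

lemma tensor_lift_class:
  assumes c: "c \<in> carrier F" shows "tensor_lift H h (K #>\<^bsub>F\<^esub> c) = ev H h c"
proof -
  have "c \<in> K #>\<^bsub>F\<^esub> c" by (rule group.rcos_self[OF group_F c subgroup_K])
  then have "(SOME d. d \<in> K #>\<^bsub>F\<^esub> c) \<in> K #>\<^bsub>F\<^esub> c" by (rule someI)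
  then obtain k where k: "k \<in> K" "(SOME d. d \<in> K #>\<^bsub>F\<^esub> c) = k + c"
    by (auto simp: r_coset_def mult_F)
  have "k \<in> carrier F" using k(1) subgroup.subset[OF subgroup_K] by auto
  then have "ev H h (k + c) = ev H h c"
    using ev_add[of k c] ev_K[OF k(1)] ev_closed[OF c] c by simp
  then show ?thesis by (simp add: tensor_lift_def k(2) ev_def)
qed

lemma tensor_lift_add_maps: "tensor_lift H h \<in> add_maps T H"
proof (rule add_mapsI)
  fix X Y assume "X \<in> carrier T" "Y \<in> carrier T"
  then obtain c d where c: "c \<in> carrier F" "X = K #>\<^bsub>F\<^esub> c" and d: "d \<in> carrier F" "Y = K #>\<^bsub>F\<^esub> d"
    by (auto simp: carrier_T)
  have "c + d \<in> carrier F" using c d keys_add[of c d] by (auto simp: carrier_F)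
  then show "tensor_lift H h (X \<oplus>\<^bsub>T\<^esub> Y) = tensor_lift H h X \<oplus>\<^bsub>H\<^esub> tensor_lift H h Y"
    using c d by (simp add: add_T tensor_lift_class ev_add)
qed (auto simp: carrier_T tensor_lift_class ev_closed)

lemma tensor_lift_pure: "x \<in> carrier M \<Longrightarrow> y \<in> carrier N \<Longrightarrow> tensor_lift H h (pr x y) = h x y"
  by (simp add: pure_tensor_def tensor_lift_class carrier_F_frag ev_frag)

end

lemma pure_closed: "x \<in> carrier M \<Longrightarrow> y \<in> carrier N \<Longrightarrow> pr x y \<in> carrier T"
  by (simp add: pure_tensor_def carrier_T carrier_F_frag)

lemma class_eqI:
  assumes "c \<in> carrier F" "d \<in> carrier F" "c - d \<in> K" shows "K #>\<^bsub>F\<^esub> c = K #>\<^bsub>F\<^esub> d"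
proof -
  have "c = (c - d) + d" by simp
  then have "c \<in> K #>\<^bsub>F\<^esub> d" using assms(3) by (force simp: r_coset_def mult_F)
  then show ?thesis
    using group.repr_independence[OF group_F _ assms(2) subgroup_K] by simp
qed

lemma gens_K: "c \<in> gens \<Longrightarrow> c \<in> K"
  unfolding tensor_rel_def by (rule generate.incl)

lemma carrier_F_add: "c \<in> carrier F \<Longrightarrow> d \<in> carrier F \<Longrightarrow> c + d \<in> carrier F"
  using keys_add[of c d] by (auto simp: carrier_F)

lemma pure_add_left:
  assumes "x \<in> carrier M" "x' \<in> carrier M" "y \<in> carrier N"
  shows "pr (x \<oplus>\<^bsub>M\<^esub> x') y = pr x y \<oplus>\<^bsub>T\<^esub> pr x' y"
proof -
  have "frag_of (x \<oplus>\<^bsub>M\<^esub> x', y) - (frag_of (x, y) + frag_of (x', y)) \<in> K"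
    by (rule gens_K) (use assms in \<open>auto simp: diff_diff_add[symmetric]\<close>)
  then show ?thesis
    using assms by (simp add: pure_tensor_def add_T carrier_F_frag carrier_F_add class_eqI)
qed

lemma pure_add_right:
  assumes "x \<in> carrier M" "y \<in> carrier N" "y' \<in> carrier N"
  shows "pr x (y \<oplus>\<^bsub>N\<^esub> y') = pr x y \<oplus>\<^bsub>T\<^esub> pr x y'"
proof -
  have "frag_of (x, y \<oplus>\<^bsub>N\<^esub> y') - (frag_of (x, y) + frag_of (x, y')) \<in> K"
    by (rule gens_K) (use assms in \<open>auto simp: diff_diff_add[symmetric]\<close>)
  then show ?thesis
    using assms by (simp add: pure_tensor_def add_T carrier_F_frag carrier_F_add class_eqI)
qed

lemma pure_balanced:
  assumes "r \<in> carrier R" "x \<in> carrier M" "y \<in> carrier N"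
  shows "pr (r \<odot>\<^bsub>M\<^esub> x) y = pr x (r \<odot>\<^bsub>N\<^esub> y)"
  unfolding pure_tensor_def
  by (intro class_eqI gens_K) (use assms in \<open>auto intro!: carrier_F_frag\<close>)

lemma balanced_pure: "balanced R M N T pr"
  by (intro balancedI add_mapsI)
    (auto simp: pure_closed pure_add_left pure_add_right pure_balanced)

lemma pure_zero_left: "y \<in> carrier N \<Longrightarrow> pr \<zero>\<^bsub>M\<^esub> y = \<zero>\<^bsub>T\<^esub>"
  using pure_add_left[of "\<zero>\<^bsub>M\<^esub>" "\<zero>\<^bsub>M\<^esub>" y] pure_closed[of "\<zero>\<^bsub>M\<^esub>" y] by simp

lemma pure_zero_right: "x \<in> carrier M \<Longrightarrow> pr x \<zero>\<^bsub>N\<^esub> = \<zero>\<^bsub>T\<^esub>"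
  using pure_add_right[of x "\<zero>\<^bsub>N\<^esub>" "\<zero>\<^bsub>N\<^esub>"] pure_closed[of x "\<zero>\<^bsub>N\<^esub>"] by simp

lemma pure_minus_left: "x \<in> carrier M \<Longrightarrow> y \<in> carrier N \<Longrightarrow> pr (\<ominus>\<^bsub>M\<^esub> x) y = \<ominus>\<^bsub>T\<^esub> pr x y"
  using pure_add_left[of "\<ominus>\<^bsub>M\<^esub> x" x y]
  by (intro T.minus_equality[symmetric]) (auto simp: pure_closed M.l_neg pure_zero_left)

lemma pure_minus_right: "x \<in> carrier M \<Longrightarrow> y \<in> carrier N \<Longrightarrow> pr x (\<ominus>\<^bsub>N\<^esub> y) = \<ominus>\<^bsub>T\<^esub> pr x y"
  using pure_add_right[of x "\<ominus>\<^bsub>N\<^esub> y" y]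
  by (intro T.minus_equality[symmetric]) (auto simp: pure_closed N.l_neg pure_zero_right)

text \<open>There is no case for negatives because the negative of a pure tensor is pure: the sign
  is absorbed in the first factor.\<close>

lemma T_induct [consumes 1, case_names pure add]:
  assumes X: "X \<in> carrier T"
    and pure: "\<And>x y. x \<in> carrier M \<Longrightarrow> y \<in> carrier N \<Longrightarrow> P (pr x y)"
    and add: "\<And>X Y. X \<in> carrier T \<Longrightarrow> Y \<in> carrier T \<Longrightarrow> P X \<Longrightarrow> P Y \<Longrightarrow> P (X \<oplus>\<^bsub>T\<^esub> Y)"
  shows "P X"
proof -
  obtain c where c: "c \<in> carrier F" "X = K #>\<^bsub>F\<^esub> c" using X by (auto simp: carrier_T)
  have "Poly_Mapping.keys c \<subseteq> carrier M \<times> carrier N" using c(1) by (simp add: carrier_F)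
  \<comment> \<open>Formal sums are built by differences, so the induction carries the claim for
    \<open>c\<close> and for \<open>- c\<close> together.\<close>
  then have "c \<in> carrier F \<and> P (K #>\<^bsub>F\<^esub> c) \<and> P (K #>\<^bsub>F\<^esub> (- c))"
  proof (induction c rule: frag_induction)
    case zero
    have "pr \<zero>\<^bsub>M\<^esub> \<zero>\<^bsub>N\<^esub> = K #>\<^bsub>F\<^esub> 0"
      by (simp add: pure_zero_left zero_T)
    then show ?case using pure[of "\<zero>\<^bsub>M\<^esub>" "\<zero>\<^bsub>N\<^esub>"] by (simp add: carrier_F)
  next
    case (one p)
    obtain x y where p: "p = (x, y)" "x \<in> carrier M" "y \<in> carrier N" using one by auto
    have m: "- frag_of (x, y) \<in> carrier F" using p by (simp add: carrier_F keys_frag_of)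
    have "pr (\<ominus>\<^bsub>M\<^esub> x) y = K #>\<^bsub>F\<^esub> (- frag_of (x, y))"
    proof -
      have "(K #>\<^bsub>F\<^esub> (- frag_of (x, y))) \<oplus>\<^bsub>T\<^esub> pr x y = \<zero>\<^bsub>T\<^esub>"
        using p m by (simp add: pure_tensor_def add_T carrier_F_frag zero_T)
      then show ?thesis
        using p m T.minus_equality[of "K #>\<^bsub>F\<^esub> (- frag_of (x, y))" "pr x y"]
        by (simp add: pure_minus_left pure_closed) (simp add: carrier_T)
    qed
    then show ?case using p pure[of x y] pure[of "\<ominus>\<^bsub>M\<^esub> x" y]
      by (simp add: pure_tensor_def carrier_F_frag)
  next
    case (diff a b)
    have m: "- a \<in> carrier F" "- b \<in> carrier F" using diff by (simp_all add: carrier_F)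
    have "P ((K #>\<^bsub>F\<^esub> a) \<oplus>\<^bsub>T\<^esub> (K #>\<^bsub>F\<^esub> (- b)))" "P ((K #>\<^bsub>F\<^esub> (- a)) \<oplus>\<^bsub>T\<^esub> (K #>\<^bsub>F\<^esub> b))"
      using diff m by (auto simp: carrier_T intro!: add)
    then show ?case using diff m by (simp add: add_T carrier_F_diff)
  qed
  then show ?thesis using c by simp
qed

text \<open>This principle replaces any handling of cosets from here on: composites and sums of
  additive maps are additive, and their values on pure tensors are known.\<close>

lemma add_maps_eqI:
  assumes f: "f \<in> add_maps T H" and g: "g \<in> add_maps T H"
    and eq: "\<And>x y. x \<in> carrier M \<Longrightarrow> y \<in> carrier N \<Longrightarrow> f (pr x y) = g (pr x y)"
    and X: "X \<in> carrier T"
  shows "f X = g X"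
  using X by (induction X rule: T_induct) (simp_all add: eq add_maps_add[OF f] add_maps_add[OF g])

lemma smult_T: "smult T r = tensor_lift T (\<lambda>x y. pr (r \<odot>\<^bsub>M\<^esub> x) y)"
proof -
  have "tensor_lift (tensor_group R M N) = tensor_lift T"
    by (rule tensor_lift_cong_record) (simp_all add: tensor_def Let_def)
  then show ?thesis unfolding \<open>_ = tensor_lift T\<close>[symmetric] by (simp add: tensor_def Let_def)
qed

lemma balanced_smult: "r \<in> carrier R \<Longrightarrow> balanced R M N T (\<lambda>x y. pr (r \<odot>\<^bsub>M\<^esub> x) y)"
  by (intro balancedI add_mapsI)
    (simp_all add: pure_closed M.smult_r_distr pure_add_left pure_add_right pure_balanced[symmetric]
      M.smult_assoc1[symmetric] M.m_comm)

lemma smult_add_maps: "r \<in> carrier R \<Longrightarrow> smult T r \<in> add_maps T T"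
  unfolding smult_T by (intro tensor_lift_add_maps abelian_group_T balanced_smult)

lemma smult_pure:
  "r \<in> carrier R \<Longrightarrow> x \<in> carrier M \<Longrightarrow> y \<in> carrier N \<Longrightarrow> r \<odot>\<^bsub>T\<^esub> pr x y = pr (r \<odot>\<^bsub>M\<^esub> x) y"
  unfolding smult_T by (intro tensor_lift_pure abelian_group_T balanced_smult)

lemma smult_pure_right:
  "r \<in> carrier R \<Longrightarrow> x \<in> carrier M \<Longrightarrow> y \<in> carrier N \<Longrightarrow> r \<odot>\<^bsub>T\<^esub> pr x y = pr x (r \<odot>\<^bsub>N\<^esub> y)"
  by (simp add: smult_pure pure_balanced)

lemma module_T: "module R T"
proof (rule moduleI)
  show "abelian_group T" by (rule abelian_group_T)
  show "cring R" using M.module_axioms by (simp add: module_def)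
  note sa = smult_add_maps
  show "r \<odot>\<^bsub>T\<^esub> X \<in> carrier T" if "r \<in> carrier R" "X \<in> carrier T" for r X
    using that by (rule add_maps_closed[OF sa])
  show "r \<odot>\<^bsub>T\<^esub> (X \<oplus>\<^bsub>T\<^esub> Y) = r \<odot>\<^bsub>T\<^esub> X \<oplus>\<^bsub>T\<^esub> r \<odot>\<^bsub>T\<^esub> Y"
    if "r \<in> carrier R" "X \<in> carrier T" "Y \<in> carrier T" for r X Y
    using that by (rule add_maps_add[OF sa])
  show "(r \<oplus>\<^bsub>R\<^esub> s) \<odot>\<^bsub>T\<^esub> X = r \<odot>\<^bsub>T\<^esub> X \<oplus>\<^bsub>T\<^esub> s \<odot>\<^bsub>T\<^esub> X"
    if "r \<in> carrier R" "s \<in> carrier R" "X \<in> carrier T" for r s X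
    by (rule add_maps_eqI[OF sa add_maps_sum[OF sa sa abelian_group_T] _ that(3)])
      (use that in \<open>simp_all add: smult_pure M.smult_l_distr pure_add_left\<close>)
  show "(r \<otimes>\<^bsub>R\<^esub> s) \<odot>\<^bsub>T\<^esub> X = r \<odot>\<^bsub>T\<^esub> (s \<odot>\<^bsub>T\<^esub> X)"
    if "r \<in> carrier R" "s \<in> carrier R" "X \<in> carrier T" for r s X
    by (rule add_maps_eqI[OF sa add_maps_comp[OF sa sa] _ that(3)])
      (use that in \<open>simp_all add: smult_pure M.smult_assoc1\<close>)
  show "\<one>\<^bsub>R\<^esub> \<odot>\<^bsub>T\<^esub> X = X" if "X \<in> carrier T" for X
    by (rule add_maps_eqI[OF sa add_maps_id _ that]) (simp_all add: smult_pure)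
qed

sublocale T: module R T by (rule module_T)

end

lemma tensor_map_balanced:
  assumes "tensor_pair R M N" "tensor_pair R' M' N'"
    and f: "f \<in> semilin \<phi> R M M'" and g: "g \<in> semilin \<phi> R N N'"
    and phi: "\<phi> \<in> carrier R \<rightarrow> carrier R'"
  shows "balanced R M N (tensor R' M' N') (\<lambda>x y. pure_tensor R' M' N' (f x) (g y))"
proof -
  interpret D: tensor_pair R M N by fact
  interpret E: tensor_pair R' M' N' by fact
  show ?thesis
    using funcset_mem[OF phi]
    by (intro balancedI add_mapsI)
      (simp_all add: semilin_closed[OF f] semilin_closed[OF g] semilin_add[OF f] semilin_add[OF g]
        E.pure_closed E.pure_add_left E.pure_add_right semilin_smult[OF f] semilin_smult[OF g] E.pure_balanced)
qed

lemma tensor_map_pure: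
  assumes "tensor_pair R M N" "tensor_pair R' M' N'" "f \<in> semilin \<phi> R M M'" "g \<in> semilin \<phi> R N N'"
    and "\<phi> \<in> carrier R \<rightarrow> carrier R'" and "x \<in> carrier M" "y \<in> carrier N"
  shows "tensor_map R' M' N' f g (pure_tensor R M N x y) = pure_tensor R' M' N' (f x) (g y)"
  unfolding tensor_map_def
  by (rule tensor_pair.tensor_lift_pure[OF assms(1) tensor_pair.abelian_group_T[OF assms(2)]
        tensor_map_balanced[OF assms(1-5)] assms(6,7)])

lemma tensor_map_semilin:
  assumes "tensor_pair R M N" "tensor_pair R' M' N'"
    and f: "f \<in> semilin \<phi> R M M'" and g: "g \<in> semilin \<phi> R N N'"
    and phi: "\<phi> \<in> carrier R \<rightarrow> carrier R'"
  shows "tensor_map R' M' N' f g \<in> semilin \<phi> R (tensor R M N) (tensor R' M' N')"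
proof -
  interpret D: tensor_pair R M N by fact
  interpret E: tensor_pair R' M' N' by fact
  have a: "tensor_map R' M' N' f g \<in> add_maps D.T E.T"
    unfolding tensor_map_def
    by (intro D.tensor_lift_add_maps E.abelian_group_T tensor_map_balanced[OF assms])
  show ?thesis
  proof (rule semilinI[OF a])
    fix r X assume r: "r \<in> carrier R" and X: "X \<in> carrier D.T"
    show "tensor_map R' M' N' f g (r \<odot>\<^bsub>D.T\<^esub> X) = \<phi> r \<odot>\<^bsub>E.T\<^esub> tensor_map R' M' N' f g X"
    proof (rule D.add_maps_eqI[OF _ _ _ X])
      show "(\<lambda>X. tensor_map R' M' N' f g (r \<odot>\<^bsub>D.T\<^esub> X)) \<in> add_maps D.T E.T"
        by (rule add_maps_comp[OF D.smult_add_maps[OF r] a])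
      show "(\<lambda>X. \<phi> r \<odot>\<^bsub>E.T\<^esub> tensor_map R' M' N' f g X) \<in> add_maps D.T E.T"
        by (rule add_maps_comp[OF a E.smult_add_maps[OF funcset_mem[OF phi r]]])
      fix x y assume "x \<in> carrier M" "y \<in> carrier N"
      then show "tensor_map R' M' N' f g (r \<odot>\<^bsub>D.T\<^esub> D.pr x y) = \<phi> r \<odot>\<^bsub>E.T\<^esub> tensor_map R' M' N' f g (D.pr x y)"
        using r by (simp add: D.smult_pure tensor_map_pure[OF assms] E.smult_pure funcset_mem[OF phi]
            semilin_closed[OF f] semilin_closed[OF g] semilin_smult[OF f])
    qed
  qed
qed

lemma tensor_map_comp:
  assumes "tensor_pair R M N" "tensor_pair R' M' N'" "tensor_pair R'' M'' N''"
    and phi: "\<phi> \<in> carrier R \<rightarrow> carrier R'" and psi: "\<psi> \<in> carrier R' \<rightarrow> carrier R''"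
    and f: "f \<in> semilin \<phi> R M M'" and g: "g \<in> semilin \<phi> R N N'"
    and f': "f' \<in> semilin \<psi> R' M' M''" and g': "g' \<in> semilin \<psi> R' N' N''"
    and X: "X \<in> carrier (tensor R M N)"
  shows "tensor_map R'' M'' N'' f' g' (tensor_map R' M' N' f g X) =
    tensor_map R'' M'' N'' (\<lambda>x. f' (f x)) (\<lambda>y. g' (g y)) X"
proof -
  interpret D: tensor_pair R M N by fact
  have phipsi: "(\<lambda>r. \<psi> (\<phi> r)) \<in> carrier R \<rightarrow> carrier R''" using phi psi by auto
  have ff: "(\<lambda>x. f' (f x)) \<in> semilin (\<lambda>r. \<psi> (\<phi> r)) R M M''" by (rule semilin_comp[OF f f' phi])
  have gg: "(\<lambda>y. g' (g y)) \<in> semilin (\<lambda>r. \<psi> (\<phi> r)) R N N''" by (rule semilin_comp[OF g g' phi])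
  have a: "tensor_map R' M' N' f g \<in> add_maps D.T (tensor R' M' N')"
    by (rule semilin_add_maps[OF tensor_map_semilin[OF assms(1,2) f g phi]])
  have b: "tensor_map R'' M'' N'' f' g' \<in> add_maps (tensor R' M' N') (tensor R'' M'' N'')"
    by (rule semilin_add_maps[OF tensor_map_semilin[OF assms(2,3) f' g' psi]])
  have c: "tensor_map R'' M'' N'' (\<lambda>x. f' (f x)) (\<lambda>y. g' (g y)) \<in> add_maps D.T (tensor R'' M'' N'')"
    by (rule semilin_add_maps[OF tensor_map_semilin[OF assms(1,3) ff gg phipsi]])
  show ?thesis
    by (rule D.add_maps_eqI[OF add_maps_comp[OF a b] c _ X])
      (simp add: tensor_map_pure[OF assms(1,2) f g phi] tensor_map_pure[OF assms(2,3) f' g' psi]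
        tensor_map_pure[OF assms(1,3) ff gg phipsi] semilin_closed[OF f] semilin_closed[OF g])
qed

lemma funcset_id': "(\<lambda>x. x) \<in> A \<rightarrow> A"
  by simp

lemma tensor_map_id:
  assumes "tensor_pair R M N" "X \<in> carrier (tensor R M N)"
  shows "tensor_map R M N (\<lambda>x. x) (\<lambda>y. y) X = X"
proof -
  interpret D: tensor_pair R M N by fact
  have "tensor_map R M N (\<lambda>x. x) (\<lambda>y. y) \<in> add_maps D.T D.T"
    by (rule semilin_add_maps[OF tensor_map_semilin[OF assms(1,1) semilin_id semilin_id funcset_id']])
  then show ?thesis
    by (rule D.add_maps_eqI[OF _ add_maps_id _ assms(2)])
      (simp add: tensor_map_pure[OF assms(1,1) semilin_id semilin_id funcset_id'])
qed

lemma tensor_map_cong: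
  assumes "tensor_pair R M N" "tensor_pair R' M' N'"
    and f: "f \<in> semilin \<phi> R M M'" and g: "g \<in> semilin \<phi> R N N'"
    and phi: "\<phi> \<in> carrier R \<rightarrow> carrier R'"
    and f': "f' \<in> semilin \<phi> R M M'" and g': "g' \<in> semilin \<phi> R N N'"
    and "\<And>x. x \<in> carrier M \<Longrightarrow> f x = f' x" "\<And>y. y \<in> carrier N \<Longrightarrow> g y = g' y"
    and "X \<in> carrier (tensor R M N)"
  shows "tensor_map R' M' N' f g X = tensor_map R' M' N' f' g' X"
  by (rule tensor_pair.add_maps_eqI[OF assms(1) semilin_add_maps[OF tensor_map_semilin[OF assms(1,2) f g phi]]
        semilin_add_maps[OF tensor_map_semilin[OF assms(1,2) f' g' phi]] _ assms(10)])
    (simp add: tensor_map_pure[OF assms(1,2) f g phi] tensor_map_pure[OF assms(1,2) f' g' phi] assms(8,9))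

section \<open>Triple tensor products\<close>

definition balanced3 ::
  "('k, 'm) ring_scheme \<Rightarrow> ('k, 'x, 'p) module_scheme \<Rightarrow> ('k, 'y, 'q) module_scheme
     \<Rightarrow> ('k, 'z, 's) module_scheme \<Rightarrow> ('t, 'u) ring_scheme \<Rightarrow> ('x \<Rightarrow> 'y \<Rightarrow> 'z \<Rightarrow> 't) \<Rightarrow> bool" where
  "balanced3 R L M N H h \<longleftrightarrow> (\<forall>z\<in>carrier N. balanced R L M H (\<lambda>x y. h x y z)) \<and>
     (\<forall>x\<in>carrier L. balanced R M N H (h x))"

locale tensor_triple = LM: tensor_pair R L M + MN: tensor_pair R M N
  for R :: "('k, 'm) ring_scheme" and L :: "('k, 'x, 'p) module_scheme" and M :: "('k, 'y, 'q) module_scheme"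
    and N :: "('k, 'z, 's) module_scheme"
begin

sublocale LM_N: tensor_pair R "tensor R L M" N
  by (simp add: tensor_pair_def LM.module_T MN.N.module_axioms)

sublocale L_MN: tensor_pair R L "tensor R M N"
  by (simp add: tensor_pair_def MN.module_T LM.M.module_axioms)

lemma add_maps_eqI_left:
  assumes f: "f \<in> add_maps LM_N.T H" and g: "g \<in> add_maps LM_N.T H"
    and eq: "\<And>x y z. x \<in> carrier L \<Longrightarrow> y \<in> carrier M \<Longrightarrow> z \<in> carrier N \<Longrightarrow>
      f (LM_N.pr (LM.pr x y) z) = g (LM_N.pr (LM.pr x y) z)"
    and X: "X \<in> carrier LM_N.T"
  shows "f X = g X"
proof (rule LM_N.add_maps_eqI[OF f g _ X])
  fix Y z assume Y: "Y \<in> carrier LM.T" and z: "z \<in> carrier N"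
  have a: "(\<lambda>Y. LM_N.pr Y z) \<in> add_maps LM.T LM_N.T"
    using LM_N.balanced_pure z by (simp add: balanced_def)
  show "f (LM_N.pr Y z) = g (LM_N.pr Y z)"
    by (rule LM.add_maps_eqI[OF add_maps_comp[OF a f] add_maps_comp[OF a g] _ Y]) (simp add: eq z)
qed

lemma add_maps_eqI_right:
  assumes f: "f \<in> add_maps L_MN.T H" and g: "g \<in> add_maps L_MN.T H"
    and eq: "\<And>x y z. x \<in> carrier L \<Longrightarrow> y \<in> carrier M \<Longrightarrow> z \<in> carrier N \<Longrightarrow>
      f (L_MN.pr x (MN.pr y z)) = g (L_MN.pr x (MN.pr y z))"
    and X: "X \<in> carrier L_MN.T"
  shows "f X = g X"
proof (rule L_MN.add_maps_eqI[OF f g _ X])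
  fix x Y assume x: "x \<in> carrier L" and Y: "Y \<in> carrier MN.T"
  have a: "L_MN.pr x \<in> add_maps MN.T L_MN.T"
    using L_MN.balanced_pure x by (simp add: balanced_def)
  show "f (L_MN.pr x Y) = g (L_MN.pr x Y)"
    by (rule MN.add_maps_eqI[OF add_maps_comp[OF a f] add_maps_comp[OF a g] _ Y]) (simp add: eq x)
qed

context
  fixes H :: "('t, 'u) ring_scheme" and h
  assumes H: "abelian_group H" and h: "balanced3 R L M N H h"
begin

lemma balanced3D:
  "z \<in> carrier N \<Longrightarrow> balanced R L M H (\<lambda>x y. h x y z)" "x \<in> carrier L \<Longrightarrow> balanced R M N H (h x)"
  using h by (auto simp: balanced3_def)

lemma add3:
  assumes "x \<in> carrier L" "y \<in> carrier M" "z \<in> carrier N"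
  shows "x' \<in> carrier L \<Longrightarrow> h (x \<oplus>\<^bsub>L\<^esub> x') y z = h x y z \<oplus>\<^bsub>H\<^esub> h x' y z"
    "z' \<in> carrier N \<Longrightarrow> h x y (z \<oplus>\<^bsub>N\<^esub> z') = h x y z \<oplus>\<^bsub>H\<^esub> h x y z'"
    "r \<in> carrier R \<Longrightarrow> h (r \<odot>\<^bsub>L\<^esub> x) y z = h x (r \<odot>\<^bsub>M\<^esub> y) z"
    "r \<in> carrier R \<Longrightarrow> h x (r \<odot>\<^bsub>M\<^esub> y) z = h x y (r \<odot>\<^bsub>N\<^esub> z)"
  using balanced3D assms by (auto simp: balanced_def add_maps_def)

lemma balanced3_left: "balanced R LM.T N H (\<lambda>X z. tensor_lift H (\<lambda>x y. h x y z) X)"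
proof (rule balancedI)
  note la = LM.tensor_lift_add_maps[OF H balanced3D(1)] and lp = LM.tensor_lift_pure[OF H balanced3D(1)]
  show "z \<in> carrier N \<Longrightarrow> (\<lambda>X. tensor_lift H (\<lambda>x y. h x y z) X) \<in> add_maps LM.T H" for z by (rule la)
  show "(\<lambda>z. tensor_lift H (\<lambda>x y. h x y z) X) \<in> add_maps N H" if X: "X \<in> carrier LM.T" for X
  proof (rule add_mapsI)
    fix z z' assume z: "z \<in> carrier N" "z' \<in> carrier N"
    show "tensor_lift H (\<lambda>x y. h x y (z \<oplus>\<^bsub>N\<^esub> z')) X =
        tensor_lift H (\<lambda>x y. h x y z) X \<oplus>\<^bsub>H\<^esub> tensor_lift H (\<lambda>x y. h x y z') X"
      by (rule LM.add_maps_eqI[OF la add_maps_sum[OF la la H] _ X]) (simp_all add: z lp add3)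
  qed (rule add_maps_closed[OF la X])
  show "tensor_lift H (\<lambda>x y. h x y z) (r \<odot>\<^bsub>LM.T\<^esub> X) = tensor_lift H (\<lambda>x y. h x y (r \<odot>\<^bsub>N\<^esub> z)) X"
    if "r \<in> carrier R" "X \<in> carrier LM.T" "z \<in> carrier N" for r X z
    by (rule LM.add_maps_eqI[OF add_maps_comp[OF LM.smult_add_maps la] la _ that(2)])
      (simp_all add: that LM.smult_pure lp add3)
qed

lemma balanced3_right: "balanced R L MN.T H (\<lambda>x Y. tensor_lift H (\<lambda>y z. h x y z) Y)"
proof (rule balancedI)
  note la = MN.tensor_lift_add_maps[OF H balanced3D(2)] and lp = MN.tensor_lift_pure[OF H balanced3D(2)]
  show "x \<in> carrier L \<Longrightarrow> (\<lambda>X. tensor_lift H (\<lambda>y z. h x y z) X) \<in> add_maps MN.T H" for x by (rule la)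
  show "(\<lambda>x. tensor_lift H (\<lambda>y z. h x y z) X) \<in> add_maps L H" if X: "X \<in> carrier MN.T" for X
  proof (rule add_mapsI)
    fix x x' assume z: "x \<in> carrier L" "x' \<in> carrier L"
    show "tensor_lift H (\<lambda>y z. h (x \<oplus>\<^bsub>L\<^esub> x') y z) X =
        tensor_lift H (\<lambda>y z. h x y z) X \<oplus>\<^bsub>H\<^esub> tensor_lift H (\<lambda>y z. h x' y z) X"
      by (rule MN.add_maps_eqI[OF la add_maps_sum[OF la la H] _ X]) (simp_all add: z lp add3)
  qed (rule add_maps_closed[OF la X])
  show "tensor_lift H (\<lambda>y z. h (r \<odot>\<^bsub>L\<^esub> x) y z) X = tensor_lift H (\<lambda>y z. h x y z) (r \<odot>\<^bsub>MN.T\<^esub> X)"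
    if "r \<in> carrier R" "x \<in> carrier L" "X \<in> carrier MN.T" for r X x
    by (rule MN.add_maps_eqI[OF la add_maps_comp[OF MN.smult_add_maps la] _ that(3)])
      (simp_all add: that MN.smult_pure lp add3)
qed

end

lemma balanced3_assoc: "balanced3 R L M N L_MN.T (\<lambda>x y z. L_MN.pr x (MN.pr y z))"
  unfolding balanced3_def
  by (auto intro!: balancedI add_mapsI simp: L_MN.pure_closed MN.pure_closed L_MN.pure_add_left
      L_MN.pure_add_right[symmetric] MN.pure_add_left MN.pure_add_right MN.pure_balanced
      L_MN.pure_balanced MN.smult_pure)

lemma balanced3_unassoc: "balanced3 R L M N LM_N.T (\<lambda>x y z. LM_N.pr (LM.pr x y) z)"
  unfolding balanced3_def
  by (auto intro!: balancedI add_mapsI simp: LM_N.pure_closed LM.pure_closed LM_N.pure_add_left[symmetric]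
      LM_N.pure_add_right LM.pure_add_left LM.pure_add_right LM.pure_balanced
      LM_N.pure_balanced[symmetric] LM.smult_pure)

abbreviation "asc \<equiv> tensor_assoc R L M N"

lemma assoc_add_maps: "asc \<in> add_maps LM_N.T L_MN.T"
  unfolding tensor_assoc_def Let_def
  by (intro LM_N.tensor_lift_add_maps L_MN.abelian_group_T balanced3_left balanced3_assoc)

lemma assoc_pure:
  assumes "x \<in> carrier L" "y \<in> carrier M" "z \<in> carrier N"
  shows "asc (LM_N.pr (LM.pr x y) z) = L_MN.pr x (MN.pr y z)"
  unfolding tensor_assoc_def Let_def
  using assms LM.pure_closed[of x y]
  by (simp add: LM_N.tensor_lift_pure[OF L_MN.abelian_group_T balanced3_left[OF L_MN.abelian_group_T balanced3_assoc]]
      LM.tensor_lift_pure[OF L_MN.abelian_group_T balanced3D(1)[OF L_MN.abelian_group_T balanced3_assoc]])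

text \<open>The inverse of \<open>asc\<close>. It serves to carry injectivity from one bracketing of
  a triple tensor product to the other.\<close>

definition "unasc = tensor_lift LM_N.T (\<lambda>x Y. tensor_lift LM_N.T (\<lambda>y z. LM_N.pr (LM.pr x y) z) Y)"

lemma unassoc_add_maps: "unasc \<in> add_maps L_MN.T LM_N.T"
  unfolding unasc_def
  by (intro L_MN.tensor_lift_add_maps LM_N.abelian_group_T balanced3_right balanced3_unassoc)

lemma unassoc_pure:
  assumes "x \<in> carrier L" "y \<in> carrier M" "z \<in> carrier N"
  shows "unasc (L_MN.pr x (MN.pr y z)) = LM_N.pr (LM.pr x y) z"
  unfolding unasc_def
  using assms MN.pure_closed[of y z]
  by (simp add: L_MN.tensor_lift_pure[OF LM_N.abelian_group_T balanced3_right[OF LM_N.abelian_group_T balanced3_unassoc]]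
      MN.tensor_lift_pure[OF LM_N.abelian_group_T balanced3D(2)[OF LM_N.abelian_group_T balanced3_unassoc]])

lemma unassoc_assoc: "X \<in> carrier LM_N.T \<Longrightarrow> unasc (asc X) = X"
  by (rule add_maps_eqI_left[OF add_maps_comp[OF assoc_add_maps unassoc_add_maps] add_maps_id])
    (simp_all add: assoc_pure unassoc_pure)

lemma assoc_unassoc: "X \<in> carrier L_MN.T \<Longrightarrow> asc (unasc X) = X"
  by (rule add_maps_eqI_right[OF add_maps_comp[OF unassoc_add_maps assoc_add_maps] add_maps_id])
    (simp_all add: assoc_pure unassoc_pure)

end

text \<open>Used along two changes of scalars: from R to R[s,1/s] through constant Laurent
  polynomials, and from R[t] to R[s,1/s] through the inclusions.\<close>

lemma assoc_natural:
  assumes "tensor_triple R L M N" "tensor_triple R' L' M' N'" and phi: "\<phi> \<in> carrier R \<rightarrow> carrier R'"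
    and f: "f \<in> semilin \<phi> R L L'" and g: "g \<in> semilin \<phi> R M M'" and h: "h \<in> semilin \<phi> R N N'"
    and X: "X \<in> carrier (tensor R (tensor R L M) N)"
  shows "tensor_assoc R' L' M' N' (tensor_map R' (tensor R' L' M') N' (tensor_map R' L' M' f g) h X) =
    tensor_map R' L' (tensor R' M' N') f (tensor_map R' M' N' g h) (tensor_assoc R L M N X)"
proof -
  interpret D: tensor_triple R L M N by fact
  interpret E: tensor_triple R' L' M' N' by fact
  note fg = tensor_map_semilin[OF D.LM.tensor_pair_axioms E.LM.tensor_pair_axioms f g phi]
    and gh = tensor_map_semilin[OF D.MN.tensor_pair_axioms E.MN.tensor_pair_axioms g h phi]
  note fg_h = tensor_map_semilin[OF D.LM_N.tensor_pair_axioms E.LM_N.tensor_pair_axioms fg h phi]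
    and f_gh = tensor_map_semilin[OF D.L_MN.tensor_pair_axioms E.L_MN.tensor_pair_axioms f gh phi]
  note ps = tensor_map_pure[OF D.LM.tensor_pair_axioms E.LM.tensor_pair_axioms f g phi]
    tensor_map_pure[OF D.MN.tensor_pair_axioms E.MN.tensor_pair_axioms g h phi]
    tensor_map_pure[OF D.LM_N.tensor_pair_axioms E.LM_N.tensor_pair_axioms fg h phi]
    tensor_map_pure[OF D.L_MN.tensor_pair_axioms E.L_MN.tensor_pair_axioms f gh phi]
  show ?thesis
    by (rule D.add_maps_eqI_left[OF add_maps_comp[OF semilin_add_maps[OF fg_h] E.assoc_add_maps]
          add_maps_comp[OF D.assoc_add_maps semilin_add_maps[OF f_gh]] _ X])
      (simp add: ps D.LM.pure_closed D.MN.pure_closed D.assoc_pure E.assoc_pure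
        semilin_closed[OF f] semilin_closed[OF g] semilin_closed[OF h])
qed

section \<open>The tensor product of two algebras\<close>

lemmas cring_rules = ringE(3,4)[OF cring.axioms(1)] monoid.m_closed[OF ringE(2)[OF cring.axioms(1)]]
  monoid.one_closed[OF ringE(2)[OF cring.axioms(1)]]

lemma (in algebra) smult_mult_r:
  "a \<in> carrier R \<Longrightarrow> x \<in> carrier M \<Longrightarrow> y \<in> carrier M \<Longrightarrow> x \<otimes>\<^bsub>M\<^esub> (a \<odot>\<^bsub>M\<^esub> y) = a \<odot>\<^bsub>M\<^esub> (x \<otimes>\<^bsub>M\<^esub> y)"
  using smult_assoc2[of a y x] by (simp add: cring.cring_simprules(14)[OF M_cring])

text \<open>A ring homomorphism into the tensor product is tested against its product and its unit
  only; for this, biadditivity of the product and its values on pure tensors suffice.\<close>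

locale tensor_algs = M: algebra R M + N: algebra R N
  for R :: "('k, 'm) ring_scheme" and M :: "('k, 'x, 'p) module_scheme" and N :: "('k, 'y, 'q) module_scheme"
begin

sublocale tensor_pair R M N
  by (simp add: tensor_pair_def M.module N.module)

lemma mult_T: "mult T X Y = tensor_lift T (\<lambda>x y. tensor_lift T (\<lambda>x' y'. pr (x \<otimes>\<^bsub>M\<^esub> x') (y \<otimes>\<^bsub>N\<^esub> y')) Y) X"
proof -
  have "tensor_lift (tensor_group R M N) = tensor_lift T"
    by (rule tensor_lift_cong_record) (simp_all add: tensor_def Let_def)
  then show ?thesis unfolding \<open>_ = tensor_lift T\<close>[symmetric] by (simp add: tensor_def Let_def)
qed

lemma one_T: "\<one>\<^bsub>T\<^esub> = pr \<one>\<^bsub>M\<^esub> \<one>\<^bsub>N\<^esub>"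
  by (simp add: tensor_def Let_def)

lemma balanced_mult_inner:
  "x \<in> carrier M \<Longrightarrow> y \<in> carrier N \<Longrightarrow>
    balanced R M N T (\<lambda>x' y'. pr (x \<otimes>\<^bsub>M\<^esub> x') (y \<otimes>\<^bsub>N\<^esub> y'))"
  by (intro balancedI add_mapsI)
    (simp_all add: pure_closed pure_add_left pure_add_right M.M_cring N.M_cring cring_rules
      M.smult_mult_r N.smult_mult_r pure_balanced)

lemma balanced_mult_outer:
  assumes Y: "Y \<in> carrier T"
  shows "balanced R M N T (\<lambda>x y. tensor_lift T (\<lambda>x' y'. pr (x \<otimes>\<^bsub>M\<^esub> x') (y \<otimes>\<^bsub>N\<^esub> y')) Y)"
proof -
  note la = tensor_lift_add_maps[OF abelian_group_T balanced_mult_inner]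
    and lp = tensor_lift_pure[OF abelian_group_T balanced_mult_inner]
  note [simp] = M.M_cring N.M_cring cring_rules
  show ?thesis
  proof (intro balancedI add_mapsI)
    fix x x' y assume xy: "x \<in> carrier M" "x' \<in> carrier M" "y \<in> carrier N"
    show "tensor_lift T (\<lambda>a b. pr ((x \<oplus>\<^bsub>M\<^esub> x') \<otimes>\<^bsub>M\<^esub> a) (y \<otimes>\<^bsub>N\<^esub> b)) Y =
      tensor_lift T (\<lambda>a b. pr (x \<otimes>\<^bsub>M\<^esub> a) (y \<otimes>\<^bsub>N\<^esub> b)) Y \<oplus>\<^bsub>T\<^esub>
      tensor_lift T (\<lambda>a b. pr (x' \<otimes>\<^bsub>M\<^esub> a) (y \<otimes>\<^bsub>N\<^esub> b)) Y"
      by (rule add_maps_eqI[OF la add_maps_sum[OF la la abelian_group_T] _ Y])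
        (use xy in \<open>simp_all add: lp pure_add_left\<close>)
  next
    fix x y y' assume xy: "x \<in> carrier M" "y \<in> carrier N" "y' \<in> carrier N"
    show "tensor_lift T (\<lambda>a b. pr (x \<otimes>\<^bsub>M\<^esub> a) ((y \<oplus>\<^bsub>N\<^esub> y') \<otimes>\<^bsub>N\<^esub> b)) Y =
      tensor_lift T (\<lambda>a b. pr (x \<otimes>\<^bsub>M\<^esub> a) (y \<otimes>\<^bsub>N\<^esub> b)) Y \<oplus>\<^bsub>T\<^esub>
      tensor_lift T (\<lambda>a b. pr (x \<otimes>\<^bsub>M\<^esub> a) (y' \<otimes>\<^bsub>N\<^esub> b)) Y"
      by (rule add_maps_eqI[OF la add_maps_sum[OF la la abelian_group_T] _ Y])
        (use xy in \<open>simp_all add: lp pure_add_right\<close>)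
  next
    fix r x y assume xy: "r \<in> carrier R" "x \<in> carrier M" "y \<in> carrier N"
    show "tensor_lift T (\<lambda>a b. pr ((r \<odot>\<^bsub>M\<^esub> x) \<otimes>\<^bsub>M\<^esub> a) (y \<otimes>\<^bsub>N\<^esub> b)) Y =
      tensor_lift T (\<lambda>a b. pr (x \<otimes>\<^bsub>M\<^esub> a) ((r \<odot>\<^bsub>N\<^esub> y) \<otimes>\<^bsub>N\<^esub> b)) Y"
      by (rule add_maps_eqI[OF la la _ Y])
        (use xy in \<open>simp_all add: lp M.smult_assoc2 N.smult_assoc2 pure_balanced\<close>)
  qed (simp_all add: add_maps_closed[OF la Y])
qed

lemma mult_add_maps_left: "Y \<in> carrier T \<Longrightarrow> (\<lambda>X. X \<otimes>\<^bsub>T\<^esub> Y) \<in> add_maps T T"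
  unfolding mult_T by (intro tensor_lift_add_maps abelian_group_T balanced_mult_outer)

lemma mult_pure_left:
  "x \<in> carrier M \<Longrightarrow> y \<in> carrier N \<Longrightarrow> Y \<in> carrier T \<Longrightarrow>
    pr x y \<otimes>\<^bsub>T\<^esub> Y = tensor_lift T (\<lambda>x' y'. pr (x \<otimes>\<^bsub>M\<^esub> x') (y \<otimes>\<^bsub>N\<^esub> y')) Y"
  unfolding mult_T by (intro tensor_lift_pure abelian_group_T balanced_mult_outer)

lemma mult_pure:
  "x \<in> carrier M \<Longrightarrow> y \<in> carrier N \<Longrightarrow> x' \<in> carrier M \<Longrightarrow> y' \<in> carrier N \<Longrightarrow>
    pr x y \<otimes>\<^bsub>T\<^esub> pr x' y' = pr (x \<otimes>\<^bsub>M\<^esub> x') (y \<otimes>\<^bsub>N\<^esub> y')"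
  by (simp add: mult_pure_left pure_closed tensor_lift_pure[OF abelian_group_T balanced_mult_inner])

text \<open>In the definition of the product the left factor is the outer variable of the nested
  lift, so additivity in it is immediate. In the right factor it is visible only when the left
  factor is a pure tensor, whence the induction.\<close>

lemma mult_add_maps_right:
  assumes X: "X \<in> carrier T" shows "mult T X \<in> add_maps T T"
  using X
proof (induction X rule: T_induct)
  case (pure x y)
  have "tensor_lift T (\<lambda>x' y'. pr (x \<otimes>\<^bsub>M\<^esub> x') (y \<otimes>\<^bsub>N\<^esub> y')) \<in> add_maps T T"
    by (intro tensor_lift_add_maps abelian_group_T balanced_mult_inner pure)
  then show ?case using pure by (simp add: add_maps_def mult_pure_left Pi_def)
next
  case (add X Y)
  then show ?case
    using add_maps_sum[OF add.IH abelian_group_T] add_maps_add[OF mult_add_maps_left]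
    by (simp add: add_maps_def Pi_def)
qed

lemma mult_closed: "X \<in> carrier T \<Longrightarrow> Y \<in> carrier T \<Longrightarrow> X \<otimes>\<^bsub>T\<^esub> Y \<in> carrier T"
  by (rule add_maps_closed[OF mult_add_maps_right])

lemma one_closed: "\<one>\<^bsub>T\<^esub> \<in> carrier T"
  by (simp add: one_T pure_closed M.M_cring N.M_cring cring_rules)

lemma eqI2:
  assumes "\<And>Y. Y \<in> carrier T \<Longrightarrow> (\<lambda>X. f X Y) \<in> add_maps T H" "\<And>Y. Y \<in> carrier T \<Longrightarrow> (\<lambda>X. g X Y) \<in> add_maps T H"
    and "\<And>X. X \<in> carrier T \<Longrightarrow> f X \<in> add_maps T H" "\<And>X. X \<in> carrier T \<Longrightarrow> g X \<in> add_maps T H"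
    and "\<And>x y x' y'. x \<in> carrier M \<Longrightarrow> y \<in> carrier N \<Longrightarrow> x' \<in> carrier M \<Longrightarrow> y' \<in> carrier N \<Longrightarrow>
        f (pr x y) (pr x' y') = g (pr x y) (pr x' y')"
    and X: "X \<in> carrier T" and Y: "Y \<in> carrier T"
  shows "f X Y = g X Y"
proof (rule add_maps_eqI[OF assms(1)[OF Y] assms(2)[OF Y] _ X])
  fix x y assume xy: "x \<in> carrier M" "y \<in> carrier N"
  show "f (pr x y) Y = g (pr x y) Y"
    by (rule add_maps_eqI[OF assms(3,4) _ Y]) (simp_all add: xy pure_closed assms(5))
qed

text \<open>Needed to multiply \<open>s^m\<close> times a constant tensor by \<open>s^n\<close>
  times another, which is how the base change of a coaction acts on a product of monomials.\<close>

lemma smult_mult_smult: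
  assumes p: "p \<in> carrier R" and q: "q \<in> carrier R" and X: "X \<in> carrier T" and Y: "Y \<in> carrier T"
  shows "(p \<odot>\<^bsub>T\<^esub> X) \<otimes>\<^bsub>T\<^esub> (q \<odot>\<^bsub>T\<^esub> Y) = (p \<otimes>\<^bsub>R\<^esub> q) \<odot>\<^bsub>T\<^esub> (X \<otimes>\<^bsub>T\<^esub> Y)"
proof (rule eqI2[where f = "\<lambda>X Y. (p \<odot>\<^bsub>T\<^esub> X) \<otimes>\<^bsub>T\<^esub> (q \<odot>\<^bsub>T\<^esub> Y)" and g = "\<lambda>X Y. (p \<otimes>\<^bsub>R\<^esub> q) \<odot>\<^bsub>T\<^esub> (X \<otimes>\<^bsub>T\<^esub> Y)",
      OF _ _ _ _ _ X Y])
  have pq: "p \<otimes>\<^bsub>R\<^esub> q \<in> carrier R" using p q by simp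
  fix Y assume "Y \<in> carrier T"
  then show "(\<lambda>X. (p \<odot>\<^bsub>T\<^esub> X) \<otimes>\<^bsub>T\<^esub> (q \<odot>\<^bsub>T\<^esub> Y)) \<in> add_maps T T"
    "(\<lambda>X. (p \<otimes>\<^bsub>R\<^esub> q) \<odot>\<^bsub>T\<^esub> (X \<otimes>\<^bsub>T\<^esub> Y)) \<in> add_maps T T"
    "(\<lambda>X. (p \<odot>\<^bsub>T\<^esub> Y) \<otimes>\<^bsub>T\<^esub> (q \<odot>\<^bsub>T\<^esub> X)) \<in> add_maps T T"
    "(\<lambda>X. (p \<otimes>\<^bsub>R\<^esub> q) \<odot>\<^bsub>T\<^esub> (Y \<otimes>\<^bsub>T\<^esub> X)) \<in> add_maps T T"
    using p q pq
    by (auto intro!: add_maps_comp[OF smult_add_maps mult_add_maps_left]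
        add_maps_comp[OF smult_add_maps mult_add_maps_right]
        add_maps_comp[OF mult_add_maps_left smult_add_maps] add_maps_comp[OF mult_add_maps_right smult_add_maps])
next
  fix x y x' y' assume "x \<in> carrier M" "y \<in> carrier N" "x' \<in> carrier M" "y' \<in> carrier N"
  then show "(p \<odot>\<^bsub>T\<^esub> pr x y) \<otimes>\<^bsub>T\<^esub> (q \<odot>\<^bsub>T\<^esub> pr x' y') = (p \<otimes>\<^bsub>R\<^esub> q) \<odot>\<^bsub>T\<^esub> (pr x y \<otimes>\<^bsub>T\<^esub> pr x' y')"
    using p q by (simp add: smult_pure mult_pure pure_closed M.smult_assoc1[symmetric] M.smult_assoc2 M.smult_mult_r M.R.m_comm[of q p]
        M.M_cring N.M_cring cring_rules)
qed

end

lemma tensor_map_mult: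
  assumes "tensor_algs R M N" "tensor_algs R' M' N'" and phi: "\<phi> \<in> carrier R \<rightarrow> carrier R'"
    and f: "f \<in> semilin \<phi> R M M'" and g: "g \<in> semilin \<phi> R N N'"
    and fm: "\<And>x x'. x \<in> carrier M \<Longrightarrow> x' \<in> carrier M \<Longrightarrow> f (x \<otimes>\<^bsub>M\<^esub> x') = f x \<otimes>\<^bsub>M'\<^esub> f x'"
    and gm: "\<And>y y'. y \<in> carrier N \<Longrightarrow> y' \<in> carrier N \<Longrightarrow> g (y \<otimes>\<^bsub>N\<^esub> y') = g y \<otimes>\<^bsub>N'\<^esub> g y'"
    and X: "X \<in> carrier (tensor R M N)" and Y: "Y \<in> carrier (tensor R M N)"
  shows "tensor_map R' M' N' f g (X \<otimes>\<^bsub>tensor R M N\<^esub> Y) =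
    tensor_map R' M' N' f g X \<otimes>\<^bsub>tensor R' M' N'\<^esub> tensor_map R' M' N' f g Y"
proof -
  interpret D: tensor_algs R M N by fact
  interpret E: tensor_algs R' M' N' by fact
  let ?j = "tensor_map R' M' N' f g"
  have j: "?j \<in> add_maps D.T E.T"
    by (rule semilin_add_maps[OF tensor_map_semilin[OF D.tensor_pair_axioms E.tensor_pair_axioms f g phi]])
  note jp = tensor_map_pure[OF D.tensor_pair_axioms E.tensor_pair_axioms f g phi]
  note jc = add_maps_closed[OF j]
  show ?thesis
  proof (rule D.eqI2[where f = "\<lambda>X Y. ?j (X \<otimes>\<^bsub>D.T\<^esub> Y)" and g = "\<lambda>X Y. ?j X \<otimes>\<^bsub>E.T\<^esub> ?j Y", OF _ _ _ _ _ X Y])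
    fix Y assume Y: "Y \<in> carrier D.T"
    show "(\<lambda>X. ?j (X \<otimes>\<^bsub>D.T\<^esub> Y)) \<in> add_maps D.T E.T"
      by (rule add_maps_comp[OF D.mult_add_maps_left[OF Y] j])
    show "(\<lambda>X. ?j (Y \<otimes>\<^bsub>D.T\<^esub> X)) \<in> add_maps D.T E.T"
      by (rule add_maps_comp[OF D.mult_add_maps_right[OF Y] j])
    show "(\<lambda>X. ?j X \<otimes>\<^bsub>E.T\<^esub> ?j Y) \<in> add_maps D.T E.T"
      by (rule add_maps_comp[OF j E.mult_add_maps_left[OF jc[OF Y]]])
    show "(\<lambda>X. ?j Y \<otimes>\<^bsub>E.T\<^esub> ?j X) \<in> add_maps D.T E.T"
      by (rule add_maps_comp[OF j E.mult_add_maps_right[OF jc[OF Y]]])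
  next
    fix x y x' y' assume "x \<in> carrier M" "y \<in> carrier N" "x' \<in> carrier M" "y' \<in> carrier N"
    then show "?j (D.pr x y \<otimes>\<^bsub>D.T\<^esub> D.pr x' y') = ?j (D.pr x y) \<otimes>\<^bsub>E.T\<^esub> ?j (D.pr x' y')"
      by (simp add: D.mult_pure jp fm gm E.mult_pure semilin_closed[OF f] semilin_closed[OF g]
        D.M.M_cring D.N.M_cring cring_rules)
  qed
qed

section \<open>Laurent polynomials\<close>

lemma laurent_simps:
  "carrier (laurent R C) = {f. (\<forall>i. f i \<in> carrier C) \<and> finite {i. f i \<noteq> \<zero>\<^bsub>C\<^esub>}}"
  "\<zero>\<^bsub>laurent R C\<^esub> = (\<lambda>n. \<zero>\<^bsub>C\<^esub>)" "f \<oplus>\<^bsub>laurent R C\<^esub> g = (\<lambda>n. f n \<oplus>\<^bsub>C\<^esub> g n)"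
  "\<one>\<^bsub>laurent R C\<^esub> = lmono C 0 \<one>\<^bsub>C\<^esub>"
  by (simp_all add: laurent_def)

lemma self_alg_simps [simp]:
  "carrier (self_alg R) = carrier R" "\<zero>\<^bsub>self_alg R\<^esub> = \<zero>\<^bsub>R\<^esub>" "\<one>\<^bsub>self_alg R\<^esub> = \<one>\<^bsub>R\<^esub>" "add (self_alg R) = add R"
  "mult (self_alg R) = mult R" "smult (self_alg R) = mult R" "lmono (self_alg R) = lmono R"
  by (simp_all add: self_alg_def lmono_def fun_eq_iff)

locale laurent_group = C: abelian_group C for R :: "('k, 'm) ring_scheme" and C :: "('k, 'c, 'p) module_scheme"
begin

abbreviation "LC \<equiv> laurent R C"

lemma abelian_group_L: "abelian_group LC"
proof (rule abelian_groupI)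
  fix f g assume f: "f \<in> carrier LC" and g: "g \<in> carrier LC"
  have "finite ({i. f i \<noteq> \<zero>\<^bsub>C\<^esub>} \<union> {i. g i \<noteq> \<zero>\<^bsub>C\<^esub>})" using f g by (simp add: laurent_simps)
  then have "finite {i. f i \<oplus>\<^bsub>C\<^esub> g i \<noteq> \<zero>\<^bsub>C\<^esub>}" by (rule rev_finite_subset) auto
  then show "f \<oplus>\<^bsub>LC\<^esub> g \<in> carrier LC" using f g by (simp add: laurent_simps)
next
  fix f assume f: "f \<in> carrier LC"
  have "{i. \<ominus>\<^bsub>C\<^esub> f i \<noteq> \<zero>\<^bsub>C\<^esub>} \<subseteq> {i. f i \<noteq> \<zero>\<^bsub>C\<^esub>}" by auto
  then have "finite {i. \<ominus>\<^bsub>C\<^esub> f i \<noteq> \<zero>\<^bsub>C\<^esub>}" using f by (simp add: laurent_simps finite_subset)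
  then show "\<exists>g\<in>carrier LC. g \<oplus>\<^bsub>LC\<^esub> f = \<zero>\<^bsub>LC\<^esub>"
    using f by (intro bexI[of _ "\<lambda>i. \<ominus>\<^bsub>C\<^esub> f i"]) (simp_all add: laurent_simps C.l_neg)
qed (auto simp: laurent_simps C.a_ac)

sublocale L: abelian_group LC by (rule abelian_group_L)

lemma minus_L: "f \<in> carrier LC \<Longrightarrow> \<ominus>\<^bsub>LC\<^esub> f = (\<lambda>n. \<ominus>\<^bsub>C\<^esub> f n)"
proof (rule L.minus_equality)
  assume f: "f \<in> carrier LC"
  have "{i. \<ominus>\<^bsub>C\<^esub> f i \<noteq> \<zero>\<^bsub>C\<^esub>} \<subseteq> {i. f i \<noteq> \<zero>\<^bsub>C\<^esub>}" by auto
  then have "finite {i. \<ominus>\<^bsub>C\<^esub> f i \<noteq> \<zero>\<^bsub>C\<^esub>}" using f by (simp add: laurent_simps finite_subset)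
  then show "(\<lambda>n. \<ominus>\<^bsub>C\<^esub> f n) \<in> carrier LC" using f by (simp add: laurent_simps)
qed (simp_all add: laurent_simps C.l_neg)

lemma minus_L_zero: "f \<in> carrier LC \<Longrightarrow> f n = \<zero>\<^bsub>C\<^esub> \<Longrightarrow> (\<ominus>\<^bsub>LC\<^esub> f) n = \<zero>\<^bsub>C\<^esub>"
  by (simp add: minus_L)

lemma coeff_closed: "f \<in> carrier LC \<Longrightarrow> f n \<in> carrier C"
  by (simp add: laurent_simps)

lemma lmono_closed: "c \<in> carrier C \<Longrightarrow> lmono C n c \<in> carrier LC"
proof -
  assume c: "c \<in> carrier C"
  have "finite {i. lmono C n c i \<noteq> \<zero>\<^bsub>C\<^esub>}" by (rule finite_subset[of _ "{n}"]) (auto simp: lmono_def)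
  then show ?thesis using c by (simp add: laurent_simps lmono_def)
qed

lemma lmono_add_maps: "lmono C n \<in> add_maps C LC"
  by (rule add_mapsI) (simp add: lmono_closed, simp add: laurent_simps lmono_def fun_eq_iff)

text \<open>The hypothesis on monomials concerns only the components of the given \<open>f\<close>.
  For a subalgebra such as the contraction this is decisive: only those monomials can be shown to
  belong to it.\<close>

lemma L_decompose:
  assumes f: "f \<in> carrier LC" and zero: "P \<zero>\<^bsub>LC\<^esub>" and mono: "\<And>n. P (lmono C n (f n))"
    and add: "\<And>g h. g \<in> carrier LC \<Longrightarrow> h \<in> carrier LC \<Longrightarrow> P g \<Longrightarrow> P h \<Longrightarrow> P (g \<oplus>\<^bsub>LC\<^esub> h)"
  shows "P f"
proof -
  \<comment> \<open>Induction over the truncations of \<open>f\<close> to finite sets of degrees;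
    the truncation to the support is \<open>f\<close> itself.\<close>
  have "finite S \<Longrightarrow> (\<lambda>n. if n \<in> S then f n else \<zero>\<^bsub>C\<^esub>) \<in> carrier LC \<and> P (\<lambda>n. if n \<in> S then f n else \<zero>\<^bsub>C\<^esub>)" for S
  proof (induction S rule: finite_induct)
    case empty
    then show ?case using zero L.zero_closed by (simp add: laurent_simps(2))
  next
    case (insert n S)
    let ?g = "\<lambda>n. if n \<in> S then f n else \<zero>\<^bsub>C\<^esub>"
    have eq: "lmono C n (f n) \<oplus>\<^bsub>LC\<^esub> ?g = (\<lambda>i. if i \<in> insert n S then f i else \<zero>\<^bsub>C\<^esub>)"
      using f insert.hyps by (auto simp: laurent_simps lmono_def)
    have m: "lmono C n (f n) \<in> carrier LC" by (intro lmono_closed coeff_closed f)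
    have "lmono C n (f n) \<oplus>\<^bsub>LC\<^esub> ?g \<in> carrier LC \<and> P (lmono C n (f n) \<oplus>\<^bsub>LC\<^esub> ?g)"
      using insert.IH add[OF m _ mono] m by auto
    then show ?case unfolding eq .
  qed
  from this[of "{i. f i \<noteq> \<zero>\<^bsub>C\<^esub>}"] have "P (\<lambda>n. if f n \<noteq> \<zero>\<^bsub>C\<^esub> then f n else \<zero>\<^bsub>C\<^esub>)"
    using f by (simp add: laurent_simps)
  moreover have "(\<lambda>n. if f n \<noteq> \<zero>\<^bsub>C\<^esub> then f n else \<zero>\<^bsub>C\<^esub>) = f" by auto
  ultimately show ?thesis by simp
qed

lemma lmono_zero: "lmono C n \<zero>\<^bsub>C\<^esub> = \<zero>\<^bsub>LC\<^esub>"
  by (simp add: laurent_simps(2) lmono_def fun_eq_iff)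

lemma L_induct [consumes 1, case_names mono add]:
  assumes f: "f \<in> carrier LC" and mono: "\<And>n c. c \<in> carrier C \<Longrightarrow> P (lmono C n c)"
    and add: "\<And>f g. f \<in> carrier LC \<Longrightarrow> g \<in> carrier LC \<Longrightarrow> P f \<Longrightarrow> P g \<Longrightarrow> P (f \<oplus>\<^bsub>LC\<^esub> g)"
  shows "P f"
  by (rule L_decompose[OF f]) (use f mono[of "\<zero>\<^bsub>C\<^esub>" 0] in \<open>auto simp: lmono_zero coeff_closed intro: mono add\<close>)

lemma add_maps_eqI:
  assumes "f \<in> add_maps LC H" "g \<in> add_maps LC H" "\<And>n c. c \<in> carrier C \<Longrightarrow> f (lmono C n c) = g (lmono C n c)"
    and "x \<in> carrier LC"
  shows "f x = g x"
  using assms(4) by (induction x rule: L_induct) (simp_all add: assms(3) add_maps_add[OF assms(1)] add_maps_add[OF assms(2)])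

text \<open>The additive map out of C[s,1/s] with prescribed values on monomials. Convolution, the
  base change of a coaction and \<open>unmix\<close> are all of this shape.\<close>

definition lsum :: "('t, 'u) ring_scheme \<Rightarrow> (int \<Rightarrow> 'c \<Rightarrow> 't) \<Rightarrow> (int \<Rightarrow> 'c) \<Rightarrow> 't" where
  "lsum H \<Phi> f = (\<Oplus>\<^bsub>H\<^esub>n\<in>{n. f n \<noteq> \<zero>\<^bsub>C\<^esub>}. \<Phi> n (f n))"

context
  fixes H :: "('t, 'u) ring_scheme" and \<Phi> :: "int \<Rightarrow> 'c \<Rightarrow> 't"
  assumes H: "abelian_group H" and \<Phi>: "\<And>n. \<Phi> n \<in> add_maps C H"
begin

interpretation H: abelian_group H by (rule H)

lemma lsum_superset:
  assumes "f \<in> carrier LC" "finite S" "{n. f n \<noteq> \<zero>\<^bsub>C\<^esub>} \<subseteq> S"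
  shows "lsum H \<Phi> f = (\<Oplus>\<^bsub>H\<^esub>n\<in>S. \<Phi> n (f n))"
  unfolding lsum_def
  by (rule H.add.finprod_mono_neutral_cong_left)
    (use assms in \<open>auto simp: add_maps_zero[OF \<Phi> C.abelian_group_axioms H] laurent_simps
      intro!: add_maps_closed[OF \<Phi>]\<close>)

lemma lsum_add_maps: "lsum H \<Phi> \<in> add_maps LC H"
proof (rule add_mapsI)
  fix f assume "f \<in> carrier LC"
  then show "lsum H \<Phi> f \<in> carrier H"
    unfolding lsum_def by (intro H.finsum_closed) (auto simp: coeff_closed add_maps_closed[OF \<Phi>])
next
  fix f g assume fg: "f \<in> carrier LC" "g \<in> carrier LC"
  let ?S = "{i. f i \<noteq> \<zero>\<^bsub>C\<^esub>} \<union> {i. g i \<noteq> \<zero>\<^bsub>C\<^esub>}"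
  have S: "finite ?S" using fg by (simp add: laurent_simps)
  have sub: "{n. (f \<oplus>\<^bsub>LC\<^esub> g) n \<noteq> \<zero>\<^bsub>C\<^esub>} \<subseteq> ?S" by (auto simp: laurent_simps)
  have "lsum H \<Phi> (f \<oplus>\<^bsub>LC\<^esub> g) = (\<Oplus>\<^bsub>H\<^esub>n\<in>?S. \<Phi> n (f n) \<oplus>\<^bsub>H\<^esub> \<Phi> n (g n))"
    unfolding lsum_superset[OF L.a_closed[OF fg] S sub]
    by (rule H.finsum_cong')
      (use fg in \<open>auto simp: laurent_simps add_maps_add[OF \<Phi>] intro!: add_maps_closed[OF \<Phi>]\<close>)
  also have "\<dots> = lsum H \<Phi> f \<oplus>\<^bsub>H\<^esub> lsum H \<Phi> g"
    using fg S by (subst H.finsum_addf)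
      (auto simp: lsum_superset[of _ ?S] coeff_closed intro!: add_maps_closed[OF \<Phi>])
  finally show "lsum H \<Phi> (f \<oplus>\<^bsub>LC\<^esub> g) = lsum H \<Phi> f \<oplus>\<^bsub>H\<^esub> lsum H \<Phi> g" .
qed

lemma lsum_lmono: "c \<in> carrier C \<Longrightarrow> lsum H \<Phi> (lmono C n c) = \<Phi> n c"
proof -
  assume c: "c \<in> carrier C"
  have "{i. lmono C n c i \<noteq> \<zero>\<^bsub>C\<^esub>} \<subseteq> {n}" by (auto simp: lmono_def)
  then show ?thesis
    using lsum_superset[OF lmono_closed[OF c], of "{n}" n] add_maps_closed[OF \<Phi> c, of n]
    by (simp add: lmono_def)
qed

end

end

section \<open>Convolution of Laurent polynomials\<close>

text \<open>Multiplication and scalar multiplication of Laurent polynomials are both instances of \<open>conv\<close>.\<close>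

locale laurent_conv = A: laurent_group R A + B: laurent_group R B + H: laurent_group R H
  for R :: "('k, 'm) ring_scheme" and A :: "('k, 'a, 'p) module_scheme" and B :: "('k, 'b, 'q) module_scheme"
    and H :: "('k, 'h, 's) module_scheme" +
  fixes h :: "'a \<Rightarrow> 'b \<Rightarrow> 'h"
  assumes h_left: "\<And>b. b \<in> carrier B \<Longrightarrow> (\<lambda>a. h a b) \<in> add_maps A H"
    and h_right: "\<And>a. a \<in> carrier A \<Longrightarrow> h a \<in> add_maps B H"
begin

definition conv :: "(int \<Rightarrow> 'a) \<Rightarrow> (int \<Rightarrow> 'b) \<Rightarrow> int \<Rightarrow> 'h" where
  "conv f g = (\<lambda>n. \<Oplus>\<^bsub>H\<^esub>i\<in>{i. f i \<noteq> \<zero>\<^bsub>A\<^esub>}. h (f i) (g (n - i)))"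

lemma conv_lsum: "conv f g = (\<lambda>n. A.lsum H (\<lambda>i a. h a (g (n - i))) f)"
  by (simp add: conv_def A.lsum_def)

lemma conv_lmono_left:
  assumes "a \<in> carrier A" "g \<in> carrier B.LC"
  shows "conv (lmono A m a) g = (\<lambda>n. h a (g (n - m)))"
  unfolding conv_lsum
  by (rule ext, rule A.lsum_lmono) (use assms in \<open>auto simp: H.C.abelian_group_axioms h_left B.coeff_closed\<close>)

lemma h_zero_right: "a \<in> carrier A \<Longrightarrow> h a \<zero>\<^bsub>B\<^esub> = \<zero>\<^bsub>H\<^esub>"
  by (rule add_maps_zero[OF h_right B.C.abelian_group_axioms H.C.abelian_group_axioms])

lemma conv_lmono: "a \<in> carrier A \<Longrightarrow> b \<in> carrier B \<Longrightarrow> conv (lmono A m a) (lmono B n b) = lmono H (m + n) (h a b)"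
  by (simp add: conv_lmono_left B.lmono_closed) (auto simp: lmono_def h_zero_right fun_eq_iff)

lemma conv_add_left:
  assumes "f \<in> carrier A.LC" "f' \<in> carrier A.LC" "g \<in> carrier B.LC"
  shows "conv (f \<oplus>\<^bsub>A.LC\<^esub> f') g = conv f g \<oplus>\<^bsub>H.LC\<^esub> conv f' g"
proof -
  have *: "A.lsum H (\<lambda>i a. h a (g (n - i))) \<in> add_maps A.LC H" for n
    by (rule A.lsum_add_maps) (use assms in \<open>auto simp: H.C.abelian_group_axioms h_left B.coeff_closed\<close>)
  then show ?thesis unfolding conv_lsum using assms
    by (simp add: laurent_simps(3)[where C = H] add_maps_add[OF *])
qed

lemma conv_add_right:
  assumes "f \<in> carrier A.LC" "g \<in> carrier B.LC" "g' \<in> carrier B.LC"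
  shows "conv f (g \<oplus>\<^bsub>B.LC\<^esub> g') = conv f g \<oplus>\<^bsub>H.LC\<^esub> conv f g'"
proof
  fix n
  have "conv f (g \<oplus>\<^bsub>B.LC\<^esub> g') n =
    (\<Oplus>\<^bsub>H\<^esub>i\<in>{i. f i \<noteq> \<zero>\<^bsub>A\<^esub>}. h (f i) (g (n - i)) \<oplus>\<^bsub>H\<^esub> h (f i) (g' (n - i)))"
    unfolding conv_def using assms
    by (intro H.C.finsum_cong') (auto simp: laurent_simps add_maps_add[OF h_right] intro!: add_maps_closed[OF h_right])
  also have "\<dots> = conv f g n \<oplus>\<^bsub>H\<^esub> conv f g' n"
    unfolding conv_def using assms
    by (intro H.C.finsum_addf) (auto simp: laurent_simps intro!: add_maps_closed[OF h_right])
  finally show "conv f (g \<oplus>\<^bsub>B.LC\<^esub> g') n = (conv f g \<oplus>\<^bsub>H.LC\<^esub> conv f g') n"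
    by (simp add: laurent_simps)
qed

lemma conv_closed:
  assumes f: "f \<in> carrier A.LC" and g: "g \<in> carrier B.LC" shows "conv f g \<in> carrier H.LC"
  using f
proof (induction f rule: A.L_induct)
  case (mono m a)
  have "{i. h a (g (i - m)) \<noteq> \<zero>\<^bsub>H\<^esub>} \<subseteq> (\<lambda>i. i + m) ` {i. g i \<noteq> \<zero>\<^bsub>B\<^esub>}"
  proof
    fix i assume "i \<in> {i. h a (g (i - m)) \<noteq> \<zero>\<^bsub>H\<^esub>}"
    then have "g (i - m) \<noteq> \<zero>\<^bsub>B\<^esub>" using mono by (auto simp: h_zero_right)
    then show "i \<in> (\<lambda>i. i + m) ` {i. g i \<noteq> \<zero>\<^bsub>B\<^esub>}" by (intro image_eqI[of _ _ "i - m"]) auto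
  qed
  then have "finite {i. h a (g (i - m)) \<noteq> \<zero>\<^bsub>H\<^esub>}"
    by (rule finite_subset) (use g in \<open>simp add: laurent_simps\<close>)
  then show ?case
    using mono g by (simp add: conv_lmono_left) (simp add: laurent_simps add_maps_closed[OF h_right])
next
  case (add f f')
  then show ?case using g by (simp add: conv_add_left)
qed

text \<open>Degrees add under convolution, so a set of degrees closed under addition yields a set of
  Laurent polynomials closed under products; this is applied to the even nonnegative degrees of
  R[t].\<close>

lemma conv_support:
  assumes "f \<in> carrier A.LC" "g \<in> carrier B.LC"
    and Q: "\<And>i j. f i \<noteq> \<zero>\<^bsub>A\<^esub> \<Longrightarrow> g j \<noteq> \<zero>\<^bsub>B\<^esub> \<Longrightarrow> Q (i + j)"
    and n: "conv f g n \<noteq> \<zero>\<^bsub>H\<^esub>"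
  shows "Q n"
proof (rule ccontr)
  assume "\<not> Q n"
  then have "f i \<noteq> \<zero>\<^bsub>A\<^esub> \<Longrightarrow> g (n - i) = \<zero>\<^bsub>B\<^esub>" for i using Q[of i "n - i"] by auto
  then have "conv f g n = (\<Oplus>\<^bsub>H\<^esub>i\<in>{i. f i \<noteq> \<zero>\<^bsub>A\<^esub>}. \<zero>\<^bsub>H\<^esub>)"
    unfolding conv_def using assms(1)
    by (intro H.C.finsum_cong') (auto simp: h_zero_right A.coeff_closed)
  then show False using n by simp
qed

end

locale laurent_alg = algebra R C for R :: "('k, 'm) ring_scheme" and C :: "('k, 'c, 'p) module_scheme"
begin

sublocale laurent_group R C
  by (simp add: laurent_group_def is_abelian_group)

sublocale mul: laurent_conv R C C C "mult C"
  by unfold_locales (auto intro!: add_mapsI simp: l_distr r_distr)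

lemma mult_conv: "mult LC = mul.conv"
  by (simp add: laurent_def mul.conv_def fun_eq_iff)

lemma lmono_mult: "a \<in> carrier C \<Longrightarrow> b \<in> carrier C \<Longrightarrow> lmono C m a \<otimes>\<^bsub>LC\<^esub> lmono C n b = lmono C (m + n) (a \<otimes>\<^bsub>C\<^esub> b)"
  by (simp add: mult_conv mul.conv_lmono)

lemma L_mult_closed: "f \<in> carrier LC \<Longrightarrow> g \<in> carrier LC \<Longrightarrow> f \<otimes>\<^bsub>LC\<^esub> g \<in> carrier LC"
  by (simp add: mult_conv mul.conv_closed)

lemma L_mult_support:
  assumes "f \<in> carrier LC" "g \<in> carrier LC"
    and "\<And>i j. f i \<noteq> \<zero>\<^bsub>C\<^esub> \<Longrightarrow> g j \<noteq> \<zero>\<^bsub>C\<^esub> \<Longrightarrow> Q (i + j)" and "(f \<otimes>\<^bsub>LC\<^esub> g) n \<noteq> \<zero>\<^bsub>C\<^esub>"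
  shows "Q n"
  by (rule mul.conv_support[OF assms(1,2), of Q]) (use assms(3,4) in \<open>simp_all add: mult_conv\<close>)

lemma L_distr:
  "f \<in> carrier LC \<Longrightarrow> g \<in> carrier LC \<Longrightarrow> h \<in> carrier LC \<Longrightarrow>
    (f \<oplus>\<^bsub>LC\<^esub> g) \<otimes>\<^bsub>LC\<^esub> h = f \<otimes>\<^bsub>LC\<^esub> h \<oplus>\<^bsub>LC\<^esub> g \<otimes>\<^bsub>LC\<^esub> h"
  "f \<in> carrier LC \<Longrightarrow> g \<in> carrier LC \<Longrightarrow> h \<in> carrier LC \<Longrightarrow>
    h \<otimes>\<^bsub>LC\<^esub> (f \<oplus>\<^bsub>LC\<^esub> g) = h \<otimes>\<^bsub>LC\<^esub> f \<oplus>\<^bsub>LC\<^esub> h \<otimes>\<^bsub>LC\<^esub> g"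
  by (simp_all add: mult_conv mul.conv_add_left mul.conv_add_right)

text \<open>Both sides are additive in each variable, so three nested inductions leave only
  monomials, where associativity in C and of addition of exponents remain.\<close>

lemma L_assoc:
  assumes f: "f \<in> carrier LC" and g: "g \<in> carrier LC" and h: "h \<in> carrier LC"
  shows "(f \<otimes>\<^bsub>LC\<^esub> g) \<otimes>\<^bsub>LC\<^esub> h = f \<otimes>\<^bsub>LC\<^esub> (g \<otimes>\<^bsub>LC\<^esub> h)"
  using f
proof (induction f rule: L_induct)
  case (mono m a)
  note a = this
  show ?case using g
  proof (induction g rule: L_induct)
    case (mono n b)
    note b = this
    show ?case using h
    proof (induction h rule: L_induct)
      case (mono k c)
      then show ?case using a b by (simp add: lmono_mult m_assoc add.assoc)
    qed (simp add: a b L_distr L_mult_closed lmono_closed)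
  qed (simp add: a h L_distr L_mult_closed lmono_closed)
qed (simp add: g h L_distr L_mult_closed lmono_closed)

lemma L_comm:
  assumes f: "f \<in> carrier LC" and g: "g \<in> carrier LC"
  shows "f \<otimes>\<^bsub>LC\<^esub> g = g \<otimes>\<^bsub>LC\<^esub> f"
  using f
proof (induction f rule: L_induct)
  case (mono m a)
  note a = this
  show ?case using g
  proof (induction g rule: L_induct)
    case (mono n b)
    then show ?case using a by (simp add: lmono_mult m_comm add.commute)
  qed (simp add: a L_distr L_mult_closed lmono_closed)
qed (simp add: g L_distr L_mult_closed lmono_closed)

lemma L_one: "f \<in> carrier LC \<Longrightarrow> \<one>\<^bsub>LC\<^esub> \<otimes>\<^bsub>LC\<^esub> f = f"
  by (induction f rule: L_induct) (simp_all add: laurent_simps(4) lmono_mult L_distr lmono_closed)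

lemma cring_L: "cring LC"
proof (intro cringI abelian_group_L comm_monoidI)
  show "\<one>\<^bsub>LC\<^esub> \<in> carrier LC" by (simp add: laurent_simps(4) lmono_closed)
qed (fact L_mult_closed L_assoc L_comm L_one L_distr)+

end

section \<open>Laurent polynomials as an algebra over R[s,1/s]\<close>

lemma algebra_self_alg: "cring R \<Longrightarrow> algebra R (self_alg R)"
proof -
  assume "cring R"
  then interpret R: cring R .
  have "abelian_group (self_alg R)"
    by (rule abelian_groupI) (auto simp: R.a_ac intro: R.l_neg)
  moreover have "comm_monoid (self_alg R)"
    by (rule comm_monoidI) (auto simp: R.m_ac)
  ultimately have "cring (self_alg R)"
    by (rule cringI) (simp add: R.l_distr)
  then show ?thesis
    by (rule algebraI[OF \<open>cring R\<close>]) (simp_all add: R.l_distr R.r_distr R.m_assoc)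
qed

context laurent_alg
begin

sublocale LR: laurent_alg R "self_alg R"
  by (simp add: laurent_alg_def algebra_self_alg R.is_cring)

abbreviation "LB \<equiv> laurent_base R"

sublocale scl: laurent_conv R "self_alg R" C C "smult C"
  by unfold_locales (auto intro!: add_mapsI simp: smult_l_distr smult_r_distr)

lemma smult_conv: "smult LC = scl.conv"
  by (simp add: laurent_def scl.conv_def fun_eq_iff)

lemma lmono_smult: "r \<in> carrier R \<Longrightarrow> c \<in> carrier C \<Longrightarrow> lmono R m r \<odot>\<^bsub>LC\<^esub> lmono C n c = lmono C (m + n) (r \<odot>\<^bsub>C\<^esub> c)"
  using scl.conv_lmono[of r c m n] by (simp add: smult_conv)

lemma lmono_base_closed: "r \<in> carrier R \<Longrightarrow> lmono R m r \<in> carrier LB"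
  using LR.lmono_closed[of r m] by simp

lemma lmono_base_mult: "r \<in> carrier R \<Longrightarrow> s \<in> carrier R \<Longrightarrow> lmono R m r \<otimes>\<^bsub>LB\<^esub> lmono R n s = lmono R (m + n) (r \<otimes>\<^bsub>R\<^esub> s)"
  using LR.lmono_mult[of r s m n] by simp

lemmas LB_induct [consumes 1, case_names mono add] = LR.L_induct[simplified]

lemma L_smult_closed: "p \<in> carrier LB \<Longrightarrow> f \<in> carrier LC \<Longrightarrow> p \<odot>\<^bsub>LC\<^esub> f \<in> carrier LC"
  by (simp add: smult_conv scl.conv_closed)

lemma L_smult_distr:
  "p \<in> carrier LB \<Longrightarrow> q \<in> carrier LB \<Longrightarrow> f \<in> carrier LC \<Longrightarrow>
    (p \<oplus>\<^bsub>LB\<^esub> q) \<odot>\<^bsub>LC\<^esub> f = p \<odot>\<^bsub>LC\<^esub> f \<oplus>\<^bsub>LC\<^esub> q \<odot>\<^bsub>LC\<^esub> f"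
  "p \<in> carrier LB \<Longrightarrow> f \<in> carrier LC \<Longrightarrow> g \<in> carrier LC \<Longrightarrow>
    p \<odot>\<^bsub>LC\<^esub> (f \<oplus>\<^bsub>LC\<^esub> g) = p \<odot>\<^bsub>LC\<^esub> f \<oplus>\<^bsub>LC\<^esub> p \<odot>\<^bsub>LC\<^esub> g"
  by (simp_all add: smult_conv scl.conv_add_left scl.conv_add_right)

lemma algebra_L: "algebra LB LC"
proof (rule algebraI)
  show "cring LB" by (rule LR.cring_L)
  show "cring LC" by (rule cring_L)
  note cl = LR.L_mult_closed L_mult_closed lmono_closed lmono_base_closed L_smult_closed
  note ds = LR.L_distr L_distr L_smult_distr
  fix p f assume p: "p \<in> carrier LB" and f: "f \<in> carrier LC"
  show "p \<odot>\<^bsub>LC\<^esub> f \<in> carrier LC" using p f by (rule L_smult_closed)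
  {
    fix q assume q: "q \<in> carrier LB"
    show "(p \<oplus>\<^bsub>LB\<^esub> q) \<odot>\<^bsub>LC\<^esub> f = p \<odot>\<^bsub>LC\<^esub> f \<oplus>\<^bsub>LC\<^esub> q \<odot>\<^bsub>LC\<^esub> f" using p q f by (simp add: ds)
    show "(p \<otimes>\<^bsub>LB\<^esub> q) \<odot>\<^bsub>LC\<^esub> f = p \<odot>\<^bsub>LC\<^esub> (q \<odot>\<^bsub>LC\<^esub> f)"
      using p
    proof (induction p rule: LB_induct)
      case (mono m a)
      note a = this
      show ?case using q
      proof (induction q rule: LB_induct)
        case (mono n b)
        note b = this
        show ?case using f
        proof (induction f rule: L_induct)
          case (mono k c)
          then show ?case using a b by (simp add: lmono_base_mult lmono_smult smult_assoc1 add.assoc)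
        qed (simp add: a b ds cl)
      qed (simp add: a f ds cl)
    qed (simp add: q f ds cl)
  next
    fix g assume g: "g \<in> carrier LC"
    show "p \<odot>\<^bsub>LC\<^esub> (f \<oplus>\<^bsub>LC\<^esub> g) = p \<odot>\<^bsub>LC\<^esub> f \<oplus>\<^bsub>LC\<^esub> p \<odot>\<^bsub>LC\<^esub> g" using p g f by (simp add: ds)
    show "(p \<odot>\<^bsub>LC\<^esub> f) \<otimes>\<^bsub>LC\<^esub> g = p \<odot>\<^bsub>LC\<^esub> (f \<otimes>\<^bsub>LC\<^esub> g)"
      using p
    proof (induction p rule: LB_induct)
      case (mono m a)
      note a = this
      show ?case using f
      proof (induction f rule: L_induct)
        case (mono n b)
        note b = this
        show ?case using g
        proof (induction g rule: L_induct)
          case (mono k c)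
          then show ?case using a b by (simp add: lmono_mult lmono_smult smult_assoc2 add.assoc)
        qed (simp add: a b ds cl)
      qed (simp add: a g ds cl)
    qed (simp add: g f ds cl)
  }
next
  fix f assume f: "f \<in> carrier LC"
  show "\<one>\<^bsub>LB\<^esub> \<odot>\<^bsub>LC\<^esub> f = f" using f
    by (induction f rule: L_induct) (simp_all add: laurent_simps(4) lmono_smult L_smult_distr lmono_closed lmono_base_closed)
qed

end

section \<open>The subring R[t] and restriction of scalars\<close>

lemma module_restrict_scalars:
  assumes "module R M" "H \<subseteq> carrier R" "cring (R\<lparr>carrier := H\<rparr>)"
  shows "module (R\<lparr>carrier := H\<rparr>) M"
proof -
  interpret M: module R M by fact
  show ?thesis
    by (rule moduleI)
      (use assms in \<open>auto simp: M.abelian_group_axioms subset_iff M.smult_l_distr M.smult_r_distr M.smult_assoc1\<close>)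
qed

lemma algebra_subalgebra:
  assumes "algebra R M" "H \<subseteq> carrier R" "cring (R\<lparr>carrier := H\<rparr>)" "E \<subseteq> carrier M" "cring (M\<lparr>carrier := E\<rparr>)"
    and "\<And>r x. r \<in> H \<Longrightarrow> x \<in> E \<Longrightarrow> r \<odot>\<^bsub>M\<^esub> x \<in> E"
  shows "algebra (R\<lparr>carrier := H\<rparr>) (M\<lparr>carrier := E\<rparr>)"
proof -
  interpret M: algebra R M by fact
  show ?thesis
    by (rule algebraI)
      (use assms in \<open>auto simp: subset_iff M.smult_l_distr M.smult_r_distr M.smult_assoc1 M.smult_assoc2\<close>)
qed

lemma poly_t_simps:
  "carrier (poly_t R) = {p \<in> carrier (laurent_base R). \<forall>i. p i \<noteq> \<zero>\<^bsub>R\<^esub> \<longrightarrow> 0 \<le> i \<and> even i}"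
  "add (poly_t R) = add (laurent_base R)" "mult (poly_t R) = mult (laurent_base R)"
  "\<zero>\<^bsub>poly_t R\<^esub> = \<zero>\<^bsub>laurent_base R\<^esub>" "\<one>\<^bsub>poly_t R\<^esub> = \<one>\<^bsub>laurent_base R\<^esub>"
  "smult (poly_t R) = smult (laurent_base R)"
  by (simp_all add: poly_t_def)

lemma poly_t_subset: "carrier (poly_t R) \<subseteq> carrier (laurent_base R)"
  by (auto simp: poly_t_simps)

context laurent_alg
begin

abbreviation "P \<equiv> poly_t R"

lemma lmono_poly_t: "r \<in> carrier R \<Longrightarrow> 0 \<le> n \<Longrightarrow> even n \<Longrightarrow> lmono R n r \<in> carrier P"
  by (simp add: poly_t_simps lmono_base_closed) (simp add: lmono_def)

lemma cring_poly_t: "cring P"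
proof -
  interpret LB: cring LB by (rule LR.cring_L)
  have "subcring (carrier P) LB"
  proof (rule LB.subcringI')
    show "subring (carrier P) LB"
    proof (rule LB.subringI)
      show "carrier P \<subseteq> carrier LB" by (rule poly_t_subset)
      show "\<one>\<^bsub>LB\<^esub> \<in> carrier P" by (simp add: laurent_simps(4) lmono_poly_t)
      fix p q assume p: "p \<in> carrier P"
      have pL: "p \<in> carrier LB" using p poly_t_subset by auto
      show "\<ominus>\<^bsub>LB\<^esub> p \<in> carrier P"
        using p LR.minus_L_zero[OF pL] LR.L.a_inv_closed[OF pL] by (auto simp: poly_t_simps)
      assume q: "q \<in> carrier P"
      have qL: "q \<in> carrier LB" using q poly_t_subset by auto
      have "i \<ge> 0 \<and> even i" if "(p \<otimes>\<^bsub>LB\<^esub> q) i \<noteq> \<zero>\<^bsub>R\<^esub>" for i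
        by (rule LR.L_mult_support[OF pL qL, of "\<lambda>i. i \<ge> 0 \<and> even i"])
          (use p q that in \<open>auto simp: poly_t_simps\<close>)
      then show "p \<otimes>\<^bsub>LB\<^esub> q \<in> carrier P" by (simp add: poly_t_simps LB.m_closed[OF pL qL])
      have "i \<ge> 0 \<and> even i" if "(p \<oplus>\<^bsub>LB\<^esub> q) i \<noteq> \<zero>\<^bsub>R\<^esub>" for i
        using p q that by (auto simp: poly_t_simps laurent_simps(3)) (metis R.l_zero R.zero_closed)+
      then show "p \<oplus>\<^bsub>LB\<^esub> q \<in> carrier P" by (simp add: poly_t_simps LR.L.a_closed[OF pL qL])
    qed
  qed
  then have "cring (LB\<lparr>carrier := carrier P\<rparr>)"
    using LB.subcring_iff[OF poly_t_subset] by simp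
  then show ?thesis by (simp add: poly_t_def)
qed

lemma poly_t_restrict: "P = LB\<lparr>carrier := carrier P\<rparr>"
  by (simp add: poly_t_def)

lemma module_poly_t: "module LB M \<Longrightarrow> module P M"
  using module_restrict_scalars[OF _ poly_t_subset] cring_poly_t poly_t_restrict by metis

end

section \<open>Eigenspaces of an involution when 2 is a unit\<close>

locale inv_alg = laurent_alg R C for R :: "('k, 'm) ring_scheme" and C :: "('k, 'c, 'p) module_scheme" +
  fixes \<sigma> :: "'c \<Rightarrow> 'c"
  assumes involution: "alg_involution R C \<sigma>" and two: "\<one>\<^bsub>R\<^esub> \<oplus>\<^bsub>R\<^esub> \<one>\<^bsub>R\<^esub> \<in> Units R"
begin

lemma sigma_lin: "\<sigma> \<in> semilin (\<lambda>r. r) R C C"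
  using involution by (simp add: alg_involution_def alg_maps_def lin_maps_semilin)

lemmas sigma_closed [simp] = semilin_closed[OF sigma_lin]
  and sigma_add = semilin_add[OF sigma_lin]
  and sigma_smult = semilin_smult[OF sigma_lin]

lemma sigma_ring_hom:
  "a \<in> carrier C \<Longrightarrow> b \<in> carrier C \<Longrightarrow> \<sigma> (a \<otimes>\<^bsub>C\<^esub> b) = \<sigma> a \<otimes>\<^bsub>C\<^esub> \<sigma> b" "\<sigma> \<one>\<^bsub>C\<^esub> = \<one>\<^bsub>C\<^esub>"
  using involution by (auto simp: alg_involution_def alg_maps_def ring_hom_def)

lemma sigma_sigma [simp]: "a \<in> carrier C \<Longrightarrow> \<sigma> (\<sigma> a) = a"
  using involution by (simp add: alg_involution_def)

lemma sigma_zero: "\<sigma> \<zero>\<^bsub>C\<^esub> = \<zero>\<^bsub>C\<^esub>"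
  by (rule add_maps_zero[OF semilin_add_maps[OF sigma_lin] M.abelian_group_axioms M.abelian_group_axioms])

lemma sigma_minus: "a \<in> carrier C \<Longrightarrow> \<sigma> (\<ominus>\<^bsub>C\<^esub> a) = \<ominus>\<^bsub>C\<^esub> \<sigma> a"
  by (rule add_maps_minus[OF semilin_add_maps[OF sigma_lin] M.abelian_group_axioms M.abelian_group_axioms])

text \<open>Elements of the contraction algebra have their coefficient of degree \<open>n\<close> in \<open>eig n\<close>.\<close>

definition "eig (n :: int) = (if even n then eig_plus C \<sigma> else eig_minus C \<sigma>)"

lemma eig_subset: "eig n \<subseteq> carrier C"
  by (auto simp: eig_def eig_plus_def eig_minus_def)

lemma eig_add: "a \<in> eig n \<Longrightarrow> b \<in> eig n \<Longrightarrow> a \<oplus>\<^bsub>C\<^esub> b \<in> eig n"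
  by (auto simp: eig_def eig_plus_def eig_minus_def sigma_add M.minus_add split: if_splits)

lemma eig_zero: "\<zero>\<^bsub>C\<^esub> \<in> eig n"
  by (auto simp: eig_def eig_plus_def eig_minus_def sigma_zero)

lemma eig_minus: "a \<in> eig n \<Longrightarrow> \<ominus>\<^bsub>C\<^esub> a \<in> eig n"
  by (auto simp: eig_def eig_plus_def eig_minus_def sigma_minus)

lemma eig_mult: "a \<in> eig m \<Longrightarrow> b \<in> eig n \<Longrightarrow> a \<otimes>\<^bsub>C\<^esub> b \<in> eig (m + n)"
  by (auto simp: eig_def eig_plus_def eig_minus_def sigma_ring_hom l_minus r_minus split: if_splits)

lemma eig_one: "\<one>\<^bsub>C\<^esub> \<in> eig 0"
  by (simp add: eig_def eig_plus_def sigma_ring_hom)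

lemma eig_smult: "r \<in> carrier R \<Longrightarrow> a \<in> eig n \<Longrightarrow> r \<odot>\<^bsub>C\<^esub> a \<in> eig n"
  by (auto simp: eig_def eig_plus_def eig_minus_def sigma_smult smult_r_minus)

lemma half_closed [simp]: "half R \<in> carrier R"
  unfolding half_def using two by (rule R.Units_inv_closed)

lemma half_two: "half R \<oplus>\<^bsub>R\<^esub> half R = \<one>\<^bsub>R\<^esub>"
  using R.Units_l_inv[OF two] by (simp add: half_def[symmetric] R.r_distr)

lemma half_double: "a \<in> carrier C \<Longrightarrow> half R \<odot>\<^bsub>C\<^esub> (a \<oplus>\<^bsub>C\<^esub> a) = a"
  using smult_l_distr[of "half R" "half R" a] by (simp add: smult_r_distr half_two)

text \<open>\<open>pls\<close> and \<open>mns\<close> are the projections onto the two eigenspaces;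
  they are linear over R and exist because 2 is a unit.\<close>

definition "pls a = half R \<odot>\<^bsub>C\<^esub> (a \<oplus>\<^bsub>C\<^esub> \<sigma> a)"
definition "mns a = half R \<odot>\<^bsub>C\<^esub> (a \<oplus>\<^bsub>C\<^esub> \<ominus>\<^bsub>C\<^esub> \<sigma> a)"

lemma pls_eig: "a \<in> carrier C \<Longrightarrow> pls a \<in> eig 0"
  by (simp add: pls_def eig_def eig_plus_def sigma_smult sigma_add M.a_comm)

lemma mns_eig: "a \<in> carrier C \<Longrightarrow> mns a \<in> eig (-1)"
  by (simp add: mns_def eig_def eig_minus_def sigma_smult sigma_add sigma_minus M.a_comm M.minus_add
      smult_r_minus[symmetric])

lemma pls_closed [simp]: "a \<in> carrier C \<Longrightarrow> pls a \<in> carrier C"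
  and mns_closed [simp]: "a \<in> carrier C \<Longrightarrow> mns a \<in> carrier C"
  by (simp_all add: pls_def mns_def)

lemma pls_mns: "a \<in> carrier C \<Longrightarrow> pls a \<oplus>\<^bsub>C\<^esub> mns a = a"
proof -
  assume a: "a \<in> carrier C"
  have "(a \<oplus>\<^bsub>C\<^esub> \<sigma> a) \<oplus>\<^bsub>C\<^esub> (a \<oplus>\<^bsub>C\<^esub> \<ominus>\<^bsub>C\<^esub> \<sigma> a) = a \<oplus>\<^bsub>C\<^esub> a"
    using a by (simp add: M.a_ac M.r_neg1 M.r_neg2 M.r_neg)
  then show ?thesis using a by (simp add: pls_def mns_def smult_r_distr[symmetric] half_double)
qed

lemma sigma_pls_mns: "a \<in> carrier C \<Longrightarrow> \<sigma> a = pls a \<oplus>\<^bsub>C\<^esub> \<ominus>\<^bsub>C\<^esub> mns a"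
  using pls_mns[of "\<sigma> a"] by (simp add: pls_def mns_def M.a_comm M.minus_add smult_r_minus[symmetric])

lemma pls_add_maps: "pls \<in> add_maps C C"
  by (rule add_mapsI) (simp_all add: pls_def sigma_add smult_r_distr M.a_ac)

lemma mns_add_maps: "mns \<in> add_maps C C"
  by (rule add_mapsI) (simp_all add: mns_def sigma_add smult_r_distr M.a_ac M.minus_add)

lemma pls_smult: "r \<in> carrier R \<Longrightarrow> a \<in> carrier C \<Longrightarrow> pls (r \<odot>\<^bsub>C\<^esub> a) = r \<odot>\<^bsub>C\<^esub> pls a"
  by (simp add: pls_def sigma_smult smult_r_distr smult_assoc1[symmetric] R.m_comm)

lemma mns_smult: "r \<in> carrier R \<Longrightarrow> a \<in> carrier C \<Longrightarrow> mns (r \<odot>\<^bsub>C\<^esub> a) = r \<odot>\<^bsub>C\<^esub> mns a"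
  by (simp add: mns_def sigma_smult smult_r_distr smult_assoc1[symmetric] R.m_comm smult_r_minus[symmetric])

lemma pls_even: "even n \<Longrightarrow> a \<in> eig n \<Longrightarrow> pls a = a"
  by (simp add: eig_def eig_plus_def pls_def half_double)

lemma mns_even: "even n \<Longrightarrow> a \<in> eig n \<Longrightarrow> mns a = \<zero>\<^bsub>C\<^esub>"
  by (simp add: eig_def eig_plus_def mns_def M.r_neg)

lemma pls_odd: "odd n \<Longrightarrow> a \<in> eig n \<Longrightarrow> pls a = \<zero>\<^bsub>C\<^esub>"
  by (simp add: eig_def eig_minus_def pls_def M.r_neg)

lemma mns_odd: "odd n \<Longrightarrow> a \<in> eig n \<Longrightarrow> mns a = a"
  by (simp add: eig_def eig_minus_def mns_def half_double)

section \<open>Contraction algebras\<close>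

abbreviation "Ct \<equiv> contraction R C \<sigma>"

definition "ct_gens = (\<lambda>p. p \<odot>\<^bsub>LC\<^esub> \<one>\<^bsub>LC\<^esub>) ` carrier P \<union> lmono C 0 ` eig 0 \<union> lmono C (-1) ` eig (-1)"

lemma contraction_simps:
  "carrier Ct = generate_ring LC ct_gens" "add Ct = add LC" "mult Ct = mult LC" "smult Ct = smult LC"
  "\<zero>\<^bsub>Ct\<^esub> = \<zero>\<^bsub>LC\<^esub>" "\<one>\<^bsub>Ct\<^esub> = \<one>\<^bsub>LC\<^esub>"
  by (simp_all add: contraction_def ct_gens_def eig_def)

sublocale LA: algebra LB LC by (rule algebra_L)

lemma ct_gens_subset: "ct_gens \<subseteq> carrier LC"
  using poly_t_subset eig_subset
  by (auto simp: ct_gens_def intro!: L_smult_closed lmono_closed monoid.one_closed[OF ringE(2)[OF cring.axioms(1)[OF cring_L]]])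

lemma subring_Ct: "subring (carrier Ct) LC"
  unfolding contraction_simps
  by (rule ring.generate_ring_is_subring[OF cring.axioms(1)[OF cring_L] ct_gens_subset])

lemma Ct_subset: "carrier Ct \<subseteq> carrier LC"
  by (rule subringE(1)[OF subring_Ct])

lemma cring_Ct: "cring Ct"
proof -
  have "subcring (carrier Ct) LC"
    by (rule LA.subcringI'[OF subring_Ct])
  then have "cring (LC\<lparr>carrier := carrier Ct\<rparr>)" using LA.subcring_iff[OF Ct_subset] by simp
  then show ?thesis by (simp add: contraction_def)
qed

lemma Ct_gens: "p \<in> carrier P \<Longrightarrow> p \<odot>\<^bsub>LC\<^esub> \<one>\<^bsub>LC\<^esub> \<in> carrier Ct" "a \<in> eig 0 \<Longrightarrow> lmono C 0 a \<in> carrier Ct"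
  "a \<in> eig (-1) \<Longrightarrow> lmono C (-1) a \<in> carrier Ct"
  by (auto simp: contraction_simps ct_gens_def intro!: generate_ring.incl)

lemma Ct_closed: "f \<in> carrier Ct \<Longrightarrow> g \<in> carrier Ct \<Longrightarrow> f \<oplus>\<^bsub>LC\<^esub> g \<in> carrier Ct"
  "f \<in> carrier Ct \<Longrightarrow> g \<in> carrier Ct \<Longrightarrow> f \<otimes>\<^bsub>LC\<^esub> g \<in> carrier Ct" "\<zero>\<^bsub>LC\<^esub> \<in> carrier Ct" "\<one>\<^bsub>LC\<^esub> \<in> carrier Ct"
  using subring_Ct subringE by metis+

lemma Ct_smult:
  assumes p: "p \<in> carrier P" and f: "f \<in> carrier Ct" shows "p \<odot>\<^bsub>LC\<^esub> f \<in> carrier Ct"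
proof -
  have pL: "p \<in> carrier LB" and fL: "f \<in> carrier LC" using p f poly_t_subset Ct_subset by auto
  have "p \<odot>\<^bsub>LC\<^esub> f = (p \<odot>\<^bsub>LC\<^esub> \<one>\<^bsub>LC\<^esub>) \<otimes>\<^bsub>LC\<^esub> f"
    using LA.smult_assoc2[OF pL _ fL, of "\<one>\<^bsub>LC\<^esub>"] Ct_closed(4) Ct_subset by (auto simp: L_one[OF fL])
  then show ?thesis using Ct_gens(1)[OF p] f by (simp add: Ct_closed)
qed

lemma algebra_Ct: "algebra P Ct"
proof -
  have "cring (LB\<lparr>carrier := carrier P\<rparr>)" "cring (LC\<lparr>carrier := carrier Ct\<rparr>)"
    using cring_poly_t cring_Ct by (simp_all add: poly_t_def contraction_def)
  then have "algebra (LB\<lparr>carrier := carrier P\<rparr>) (LC\<lparr>carrier := carrier Ct\<rparr>)"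
    by (rule algebra_subalgebra[OF algebra_L poly_t_subset _ Ct_subset]) (rule Ct_smult)
  then show ?thesis by (simp add: poly_t_def contraction_def)
qed

lemma lmono_apply: "lmono C m a n = (if n = m then a else \<zero>\<^bsub>C\<^esub>)"
  by (simp add: lmono_def)

lemma finsum_invariant:
  assumes "finite I" "\<And>i. i \<in> I \<Longrightarrow> f i \<in> carrier C" "\<And>i. i \<in> I \<Longrightarrow> Q (f i)" "Q \<zero>\<^bsub>C\<^esub>"
    and "\<And>a b. a \<in> carrier C \<Longrightarrow> b \<in> carrier C \<Longrightarrow> Q a \<Longrightarrow> Q b \<Longrightarrow> Q (a \<oplus>\<^bsub>C\<^esub> b)"
  shows "Q (\<Oplus>\<^bsub>C\<^esub>i\<in>I. f i)"
  using assms(1-3)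
proof (induction I rule: finite_induct)
  case empty
  then show ?case using assms(4) by simp
next
  case (insert i I)
  have "(\<Oplus>\<^bsub>C\<^esub>i\<in>I. f i) \<in> carrier C" using insert.prems by (intro M.finsum_closed) auto
  then show ?case using insert by (auto simp: Pi_def intro!: assms(5))
qed

text \<open>The contraction is a graded subalgebra: generators are homogeneous apart from the
  scalars, whose components are again scalars from R[t], and components of sums and products are
  sums of products of components. Eigenspace and membership are proved together, for all degrees at
  once, because a component of a product involves components of all degrees.\<close>

lemma Ct_coeff:
  assumes "f \<in> carrier Ct"
  shows "f n \<in> eig n \<and> lmono C n (f n) \<in> carrier Ct"
  using assms[unfolded contraction_simps]
proof (induction f arbitrary: n rule: generate_ring.induct)
  case one
  show ?case
  proof (cases "n = 0")
    case True
    then have "\<one>\<^bsub>LC\<^esub> n = \<one>\<^bsub>C\<^esub>" by (simp add: laurent_simps(4) lmono_apply)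
    then show ?thesis using True Ct_closed(4) eig_one by (simp add: laurent_simps(4))
  next
    case False
    then have "\<one>\<^bsub>LC\<^esub> n = \<zero>\<^bsub>C\<^esub>" by (simp add: laurent_simps(4) lmono_apply)
    then show ?thesis by (simp add: eig_zero lmono_zero Ct_closed(3))
  qed
next
  case (incl h)
  then consider p where "p \<in> carrier P" "h = p \<odot>\<^bsub>LC\<^esub> \<one>\<^bsub>LC\<^esub>" | a where "a \<in> eig 0" "h = lmono C 0 a"
    | a where "a \<in> eig (-1)" "h = lmono C (-1) a"
    by (auto simp: ct_gens_def)
  then show ?case
  proof cases
    case 1
    then have pL: "p \<in> carrier LB" using poly_t_subset by auto
    then have pn: "p n \<in> carrier R" using LR.coeff_closed by simp
    have h: "h n = p n \<odot>\<^bsub>C\<^esub> \<one>\<^bsub>C\<^esub>" for n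
    proof -
      have "h n = scl.conv p (lmono C 0 \<one>\<^bsub>C\<^esub>) n" using 1 by (simp add: smult_conv laurent_simps(4))
      also have "\<dots> = p n \<odot>\<^bsub>C\<^esub> \<one>\<^bsub>C\<^esub>"
        using pL
      proof (induction p rule: LB_induct)
        case (mono m r)
        then show ?case using scl.conv_lmono[of r "\<one>\<^bsub>C\<^esub>" m 0] by (simp add: lmono_def)
      next
        case (add f g)
        then have "f n \<in> carrier R" "g n \<in> carrier R" using LR.coeff_closed by auto
        then show ?case
          using add scl.conv_add_left[OF add.hyps lmono_closed[of "\<one>\<^bsub>C\<^esub>" 0]]
          by (simp add: laurent_simps(3)[of R C] laurent_simps(3)[of R "self_alg R" f g] smult_l_distr)
      qed
      finally show ?thesis .
    qed
    have "h n \<in> eig n"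
    proof (cases "p n = \<zero>\<^bsub>R\<^esub>")
      case False
      then have "even n" using 1 by (auto simp: poly_t_simps)
      then show ?thesis using eig_smult[OF pn eig_one] by (simp add: h eig_def)
    qed (simp add: h eig_zero)
    moreover have "lmono C n (h n) \<in> carrier Ct"
    proof (cases "p n = \<zero>\<^bsub>R\<^esub>")
      case False
      then have n: "even n" "0 \<le> n" using 1 by (auto simp: poly_t_simps)
      have "lmono C n (h n) = lmono R n (p n) \<odot>\<^bsub>LC\<^esub> \<one>\<^bsub>LC\<^esub>"
        by (simp add: laurent_simps(4) lmono_smult pn h)
      then show ?thesis using Ct_gens(1)[OF lmono_poly_t[OF pn n(2,1)]] by simp
    qed (simp add: h lmono_zero Ct_closed)
    ultimately show ?thesis by simp
  next
    case 2
    then have "h n = (if n = 0 then a else \<zero>\<^bsub>C\<^esub>)" by (simp add: lmono_apply)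
    then show ?thesis using Ct_gens(2)[OF 2(1)] 2(1)
      by (cases "n = 0") (simp_all add: lmono_zero eig_zero Ct_closed(3))
  next
    case 3
    then have "h n = (if n = - 1 then a else \<zero>\<^bsub>C\<^esub>)" by (simp add: lmono_apply)
    then show ?thesis using Ct_gens(3)[OF 3(1)] 3(1)
      by (cases "n = - 1") (simp_all add: lmono_zero eig_zero Ct_closed(3))
  qed
next
  case (a_inv h)
  then have h: "h \<in> carrier LC" using Ct_subset by (auto simp: contraction_simps)
  have "lmono C n (\<ominus>\<^bsub>C\<^esub> h n) = \<ominus>\<^bsub>LC\<^esub> lmono C n (h n)"
    by (rule add_maps_minus[OF lmono_add_maps M.abelian_group_axioms L.abelian_group_axioms coeff_closed[OF h]])
  then show ?case
    using a_inv.IH[of n] subringE(5)[OF subring_Ct] by (auto simp: minus_L[OF h] eig_minus)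
next
  case (eng_add f g)
  then have h: "f \<in> carrier LC" "g \<in> carrier LC" using Ct_subset by (auto simp: contraction_simps)
  show ?case
    using eng_add.IH[of n] h Ct_closed(1)[of "lmono C n (f n)" "lmono C n (g n)"]
    by (simp add: laurent_simps(3)[of R C f g] eig_add add_maps_add[OF lmono_add_maps] coeff_closed)
next
  case (eng_mult f g)
  then have h: "f \<in> carrier LC" "g \<in> carrier LC" using Ct_subset by (auto simp: contraction_simps)
  have fin: "finite {i. f i \<noteq> \<zero>\<^bsub>C\<^esub>}" using h by (simp add: laurent_simps)
  have "(f \<otimes>\<^bsub>LC\<^esub> g) n = (\<Oplus>\<^bsub>C\<^esub>i\<in>{i. f i \<noteq> \<zero>\<^bsub>C\<^esub>}. f i \<otimes>\<^bsub>C\<^esub> g (n - i))"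
    by (simp add: mult_conv mul.conv_def)
  \<comment> \<open>Each summand of the convolution satisfies the invariant: it is the coefficient
    of a product of homogeneous components of degrees \<open>i\<close> and
    \<open>n - i\<close>.\<close>
  moreover have "(\<lambda>c. c \<in> eig n \<and> lmono C n c \<in> carrier Ct) (\<Oplus>\<^bsub>C\<^esub>i\<in>{i. f i \<noteq> \<zero>\<^bsub>C\<^esub>}. f i \<otimes>\<^bsub>C\<^esub> g (n - i))"
  proof (rule finsum_invariant[OF fin])
    fix i
    show "f i \<otimes>\<^bsub>C\<^esub> g (n - i) \<in> carrier C" using h by (simp add: coeff_closed)
    have "lmono C i (f i) \<otimes>\<^bsub>LC\<^esub> lmono C (n - i) (g (n - i)) = lmono C n (f i \<otimes>\<^bsub>C\<^esub> g (n - i))"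
      using h by (simp add: lmono_mult coeff_closed)
    then show "f i \<otimes>\<^bsub>C\<^esub> g (n - i) \<in> eig n \<and> lmono C n (f i \<otimes>\<^bsub>C\<^esub> g (n - i)) \<in> carrier Ct"
      using eng_mult.IH(1)[of i] eng_mult.IH(2)[of "n - i"] eig_mult[of "f i" i "g (n - i)" "n - i"]
        Ct_closed(2)[of "lmono C i (f i)" "lmono C (n - i) (g (n - i))"] by simp
  next
    fix a b assume "a \<in> carrier C" "b \<in> carrier C" "a \<in> eig n \<and> lmono C n a \<in> carrier Ct" "b \<in> eig n \<and> lmono C n b \<in> carrier Ct"
    then show "a \<oplus>\<^bsub>C\<^esub> b \<in> eig n \<and> lmono C n (a \<oplus>\<^bsub>C\<^esub> b) \<in> carrier Ct"
      by (simp add: eig_add add_maps_add[OF lmono_add_maps] Ct_closed)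
  qed (simp add: eig_zero lmono_zero Ct_closed)
  ultimately show ?case by simp
qed

lemma Ct_induct [consumes 1, case_names mono add]:
  assumes f: "f \<in> carrier Ct" and mono: "\<And>n a. a \<in> eig n \<Longrightarrow> lmono C n a \<in> carrier Ct \<Longrightarrow> Q (lmono C n a)"
    and add: "\<And>f g. f \<in> carrier Ct \<Longrightarrow> g \<in> carrier Ct \<Longrightarrow> Q f \<Longrightarrow> Q g \<Longrightarrow> Q (f \<oplus>\<^bsub>LC\<^esub> g)"
  shows "Q f"
proof -
  have "f \<in> carrier LC" using f Ct_subset by auto
  then have "f \<in> carrier Ct \<and> Q f"
  proof (rule L_decompose)
    show "\<zero>\<^bsub>LC\<^esub> \<in> carrier Ct \<and> Q \<zero>\<^bsub>LC\<^esub>"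
      using mono[OF eig_zero, of 0] by (simp add: lmono_zero Ct_closed)
    show "\<And>n. lmono C n (f n) \<in> carrier Ct \<and> Q (lmono C n (f n))"
      using Ct_coeff[OF f] mono by blast
  qed (auto intro: add Ct_closed)
  then show ?thesis ..
qed

end

section \<open>Using flatness with test modules of arbitrary types\<close>

text \<open>The isomorphic copy of \<open>N\<close> on the image of an injection \<open>e\<close>,
  which moves a module to the type on which flatness is assumed. As only modules are tested, the
  multiplicative fields are left undefined.\<close>

definition transport :: "('x \<Rightarrow> 'u) \<Rightarrow> ('k, 'x, 'p) module_scheme \<Rightarrow> ('k, 'u) module" where
  "transport e N = (let d = inv_into (carrier N) e in
     \<lparr>carrier = e ` carrier N, monoid.mult = undefined, monoid.one = undefined, ring.zero = e \<zero>\<^bsub>N\<^esub>,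
      add = (\<lambda>x y. e (d x \<oplus>\<^bsub>N\<^esub> d y)), smult = (\<lambda>r x. e (r \<odot>\<^bsub>N\<^esub> d x))\<rparr>)"

lemma module_transport:
  assumes "module R N" and inj: "inj_on e (carrier N)"
  shows "module R (transport e N)"
proof -
  interpret N: module R N by fact
  note [simp] = inv_into_f_f[OF inj]
  show ?thesis
  proof (rule moduleI)
    show "cring R" using N.module_axioms by (simp add: module_def)
    show "abelian_group (transport e N)"
      by (rule abelian_groupI)
        (auto simp: transport_def Let_def N.a_ac intro!: bexI[of _ "\<ominus>\<^bsub>N\<^esub> _"] simp: N.r_neg)
  qed (auto simp: transport_def Let_def N.smult_l_distr N.smult_r_distr N.smult_assoc1)
qed

lemma transport_lin:
  assumes "module R N" and inj: "inj_on e (carrier N)"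
  shows "e \<in> semilin (\<lambda>r. r) R N (transport e N)"
    and "inv_into (carrier N) e \<in> semilin (\<lambda>r. r) R (transport e N) N"
proof -
  interpret N: module R N by fact
  note [simp] = inv_into_f_f[OF inj]
  show "e \<in> semilin (\<lambda>r. r) R N (transport e N)"
    by (intro semilinI add_mapsI) (auto simp: transport_def Let_def)
  show "inv_into (carrier N) e \<in> semilin (\<lambda>r. r) R (transport e N) N"
    by (intro semilinI add_mapsI) (auto simp: transport_def Let_def)
qed

text \<open>Transport of structure: conjugating \<open>f\<close> by the codings gives an injective
  map between test modules of the admissible type. Flatness applies to it, and functoriality of the
  tensor product brings the conclusion back.\<close>

lemma flat_module_inj:
  fixes e :: "'x \<Rightarrow> 'u" and e' :: "'y \<Rightarrow> 'u"
  assumes flat: "flat_module TYPE('u) R Q" and N: "module R N" and M: "module R M"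
    and f: "f \<in> semilin (\<lambda>r. r) R N M" and inj: "inj_on f (carrier N)"
    and e: "inj_on e (carrier N)" and e': "inj_on e' (carrier M)"
  shows "inj_on (tensor_map R M Q f (\<lambda>x. x)) (carrier (tensor R N Q))"
proof -
  let ?d = "inv_into (carrier N) e" and ?N = "transport e N" and ?M = "transport e' M"
  let ?f = "\<lambda>x. e' (f (?d x))"
  have Q: "module R Q" using flat by (simp add: flat_module_def)
  note tp = tensor_pair.intro[OF _ Q]
  note N' = module_transport[OF N e] and M' = module_transport[OF M e']
  note le = transport_lin(1)[OF N e] and ld = transport_lin(2)[OF N e] and le' = transport_lin(1)[OF M e']
  have lf: "?f \<in> semilin (\<lambda>r. r) R ?N ?M"
    using semilin_comp[OF semilin_comp[OF ld f funcset_id'] le' funcset_id'] by simp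
  have "inj_on ?f (carrier ?N)"
  proof (rule inj_onI)
    fix x y assume xy: "x \<in> carrier ?N" "y \<in> carrier ?N" "?f x = ?f y"
    obtain a b where ab: "a \<in> carrier N" "b \<in> carrier N" "x = e a" "y = e b"
      using xy by (auto simp: transport_def Let_def)
    then have "e' (f a) = e' (f b)" using xy(3) by (simp add: inv_into_f_f[OF e])
    then have "f a = f b" using e' semilin_closed[OF f] ab by (auto dest: inj_onD)
    then show "x = y" using inj ab by (auto dest: inj_onD)
  qed
  then have fi: "inj_on (tensor_map R ?M Q ?f (\<lambda>x. x)) (carrier (tensor R ?N Q))"
    using flat N' M' lf unfolding flat_module_def lin_maps_semilin by blast
  show ?thesis
  proof (rule inj_onI)
    let ?eN = "tensor_map R ?N Q e (\<lambda>x. x)"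
    fix X Y assume X: "X \<in> carrier (tensor R N Q)" and Y: "Y \<in> carrier (tensor R N Q)"
      and eq: "tensor_map R M Q f (\<lambda>x. x) X = tensor_map R M Q f (\<lambda>x. x) Y"
    \<comment> \<open>The coding of \<open>N\<close> stays injective after tensoring because its
      inverse supplies a left inverse.\<close>
    have d: "tensor_map R N Q ?d (\<lambda>x. x) (?eN Z) = Z" if Z: "Z \<in> carrier (tensor R N Q)" for Z
    proof -
      have "tensor_map R N Q ?d (\<lambda>x. x) (?eN Z) = tensor_map R N Q (\<lambda>x. ?d (e x)) (\<lambda>x. x) Z"
        by (rule tensor_map_comp[OF tp[OF N] tp[OF N'] tp[OF N] funcset_id' funcset_id' le semilin_id ld semilin_id Z])
      also have "\<dots> = tensor_map R N Q (\<lambda>x. x) (\<lambda>x. x) Z"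
        by (rule tensor_map_cong[OF tp[OF N] tp[OF N] semilin_comp[OF le ld funcset_id'] semilin_id funcset_id'
              semilin_id semilin_id _ _ Z]) (simp_all add: inv_into_f_f[OF e])
      also have "\<dots> = Z" by (rule tensor_map_id[OF tp[OF N] Z])
      finally show ?thesis .
    qed
    \<comment> \<open>The square formed by \<open>f\<close>, its conjugate and the two codings
      commutes after tensoring.\<close>
    have fe: "tensor_map R ?M Q ?f (\<lambda>x. x) (?eN Z) = tensor_map R ?M Q e' (\<lambda>x. x) (tensor_map R M Q f (\<lambda>x. x) Z)"
      if Z: "Z \<in> carrier (tensor R N Q)" for Z
    proof -
      have "tensor_map R ?M Q ?f (\<lambda>x. x) (?eN Z) = tensor_map R ?M Q (\<lambda>x. ?f (e x)) (\<lambda>x. x) Z"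
        by (rule tensor_map_comp[OF tp[OF N] tp[OF N'] tp[OF M'] funcset_id' funcset_id' le semilin_id lf semilin_id Z])
      also have "\<dots> = tensor_map R ?M Q (\<lambda>x. e' (f x)) (\<lambda>x. x) Z"
        by (rule tensor_map_cong[OF tp[OF N] tp[OF M'] semilin_comp[OF le lf funcset_id'] semilin_id funcset_id'
              semilin_comp[OF f le' funcset_id'] semilin_id _ _ Z]) (simp_all add: inv_into_f_f[OF e])
      also have "\<dots> = tensor_map R ?M Q e' (\<lambda>x. x) (tensor_map R M Q f (\<lambda>x. x) Z)"
        by (rule tensor_map_comp[symmetric, OF tp[OF N] tp[OF M] tp[OF M'] funcset_id' funcset_id' f semilin_id le' semilin_id Z])
      finally show ?thesis .
    qed
    note cl = semilin_closed[OF tensor_map_semilin[OF tp[OF N] tp[OF N'] le semilin_id funcset_id']]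
    have "tensor_map R ?M Q ?f (\<lambda>x. x) (?eN X) = tensor_map R ?M Q ?f (\<lambda>x. x) (?eN Y)"
      by (rule trans[OF fe[OF X] trans[OF arg_cong[OF eq, of "tensor_map R ?M Q e' (\<lambda>x. x)"] fe[OF Y, symmetric]]])
    moreover have "?eN X \<in> carrier (tensor R ?N Q)" by (rule cl[OF X])
    moreover have "?eN Y \<in> carrier (tensor R ?N Q)" by (rule cl[OF Y])
    ultimately have "?eN X = ?eN Y" using fi unfolding inj_on_def by blast
    then have "tensor_map R N Q ?d (\<lambda>x. x) (?eN X) = tensor_map R N Q ?d (\<lambda>x. x) (?eN Y)" by (rule arg_cong)
    then show "X = Y" unfolding d[OF X] d[OF Y] .
  qed
qed

text \<open>A coset is determined by any of its elements. Passing to a representative removes one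
  level of \<open>set\<close> from the type, so that tensors can be coded in the same type as formal
  sums.\<close>

lemma inj_on_some_rep: "module R M \<Longrightarrow> module R N \<Longrightarrow> inj_on (\<lambda>X. SOME c. c \<in> X) (carrier (tensor R M N))"
proof (rule inj_onI)
  fix X Y assume "module R M" "module R N"
  then interpret tensor_pair R M N by (rule tensor_pair.intro)
  assume X: "X \<in> carrier T" and Y: "Y \<in> carrier T" and eq: "(SOME c. c \<in> X) = (SOME c. c \<in> Y)"
  have ex: "\<exists>c\<in>Z. Z = K #>\<^bsub>F\<^esub> c \<and> c \<in> carrier F" if "Z \<in> carrier T" for Z
    using that group.rcos_self[OF group_F _ subgroup_K] by (auto simp: carrier_T)
  have rep: "Z = K #>\<^bsub>F\<^esub> (SOME c. c \<in> Z)" if Z: "Z \<in> carrier T" for Z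
  proof -
    obtain c where c: "c \<in> Z" "Z = K #>\<^bsub>F\<^esub> c" "c \<in> carrier F" using ex[OF Z] by auto
    have "(SOME c. c \<in> Z) \<in> Z" using c(1) by (rule someI)
    then show ?thesis
      using group.repr_independence[OF group_F _ c(3) subgroup_K] c(2) by simp
  qed
  show "X = Y" using rep[OF X] rep[OF Y] eq by simp
qed

text \<open>A finitely supported function is determined by its graph, and a point of the graph (a triple of two
  functions and an integer) is coded by one function, by interleaving modulo 3.\<close>

definition interleave :: "('b \<Rightarrow> 'w) \<Rightarrow> ('a \<Rightarrow> 'w) \<Rightarrow> 'w \<Rightarrow> 'w \<Rightarrow> (int \<Rightarrow> 'b) \<times> (int \<Rightarrow> 'a) \<Rightarrow> int \<Rightarrow> int \<Rightarrow> 'w" where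
  "interleave i j u v p n = (\<lambda>k. if k mod 3 = 0 then i (fst p (k div 3)) else if k mod 3 = 1 then j (snd p (k div 3))
     else if k div 3 = n then u else v)"

text \<open>Residues 0 and 1 modulo 3 hold the two functions. Residue 2 holds the integer as an
  indicator function with values \<open>u\<close> and \<open>v\<close>, which is why these must
  differ.\<close>

lemma interleave_inj:
  assumes "inj i" "inj j" "u \<noteq> v" and eq: "interleave i j u v p n = interleave i j u v q m"
  shows "p = q \<and> n = m"
proof -
  have "fst p k = fst q k" for k
    using fun_cong[OF eq, of "3 * k"] assms(1) by (simp add: interleave_def inj_eq)
  moreover have "snd p k = snd q k" for k
    using fun_cong[OF eq, of "3 * k + 1"] assms(2) by (simp add: interleave_def inj_eq)
  moreover have "n = m"
    using fun_cong[OF eq, of "3 * n + 2"] assms(3) by (auto simp: interleave_def split: if_splits)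
  ultimately show ?thesis by (simp add: prod_eq_iff fun_eq_iff)
qed

definition graph_code :: "('b \<Rightarrow> 'w) \<Rightarrow> ('a \<Rightarrow> 'w) \<Rightarrow> 'w \<Rightarrow> 'w \<Rightarrow> ((int \<Rightarrow> 'b) \<times> (int \<Rightarrow> 'a) \<Rightarrow>\<^sub>0 int) \<Rightarrow> (int \<Rightarrow> 'w) set" where
  "graph_code i j u v c = range (\<lambda>p. interleave i j u v p (Poly_Mapping.lookup c p))"

lemma inj_graph_code:
  assumes "inj i" "inj j" "u \<noteq> v" shows "inj (graph_code i j u v)"
proof (rule injI)
  fix c d assume "graph_code i j u v c = graph_code i j u v d"
  then have "interleave i j u v p (Poly_Mapping.lookup c p) \<in> range (\<lambda>p. interleave i j u v p (Poly_Mapping.lookup d p))" for p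
    by (auto simp: graph_code_def)
  note graph = this
  have "Poly_Mapping.lookup c p = Poly_Mapping.lookup d p" for p
  proof -
    obtain q where "interleave i j u v p (Poly_Mapping.lookup c p) = interleave i j u v q (Poly_Mapping.lookup d q)"
      using graph[of p] by blast
    then show ?thesis using interleave_inj[OF assms] by metis
  qed
  then show "c = d" by (rule poly_mapping_eqI)
qed

lemma inj_frag_pair: "inj (\<lambda>x. frag_of (x, y))"
  by (rule injI) (simp add: frag_of_eq)

section \<open>Injectivity of the comparison map\<close>

context inv_alg
begin

text \<open>For a module \<open>M\<close> over Laurent polynomials, \<open>unmix M\<close> is the inverse of
  \<open>M \<otimes>\<^bsub>R[t]\<^esub> Ct \<rightarrow> M \<otimes>\<^bsub>R[s,1/s]\<^esub> C[s,1/s]\<close>: it sends \<open>m \<otimes> s\<^sup>n a\<close> to \<open>s\<^sup>n m \<otimes> a\<^sub>+ + s\<^sup>n\<^sup>+\<^sup>1 m \<otimes> s\<^sup>-\<^sup>1 a\<^sub>-\<close>.\<close>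

definition "unmix_coeff M m n a =
   pure_tensor P M Ct (lmono R n \<one>\<^bsub>R\<^esub> \<odot>\<^bsub>M\<^esub> m) (lmono C 0 (pls a)) \<oplus>\<^bsub>tensor P M Ct\<^esub>
   pure_tensor P M Ct (lmono R (n + 1) \<one>\<^bsub>R\<^esub> \<odot>\<^bsub>M\<^esub> m) (lmono C (-1) (mns a))"

definition "unmix M = tensor_lift (tensor P M Ct) (\<lambda>m g. lsum (tensor P M Ct) (unmix_coeff M m) g)"

lemma lmono_base_one: "lmono R n \<one>\<^bsub>R\<^esub> \<in> carrier LB"
  by (simp add: lmono_base_closed)

lemma module_Ct: "module P Ct"
  using algebra_Ct by (rule algebra.module)

lemma module_LC: "module LB LC"
  using algebra_L by (rule algebra.module)

context
  fixes M :: "(int \<Rightarrow> 'k, 'x, 'q) module_scheme"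
  assumes M: "module LB M"
begin

interpretation M: module LB M by (rule M)
interpretation MCt: tensor_pair P M Ct
  by (rule tensor_pair.intro[OF module_poly_t[OF M] module_Ct])
interpretation MLC: tensor_pair LB M LC
  by (rule tensor_pair.intro[OF M module_LC])

lemma smult_lmono_smult:
  "r \<in> carrier R \<Longrightarrow> r' \<in> carrier R \<Longrightarrow> m \<in> carrier M \<Longrightarrow>
    lmono R n r \<odot>\<^bsub>M\<^esub> (lmono R n' r' \<odot>\<^bsub>M\<^esub> m) = lmono R (n + n') (r \<otimes>\<^bsub>R\<^esub> r') \<odot>\<^bsub>M\<^esub> m"
  by (simp add: M.smult_assoc1[symmetric] lmono_base_closed lmono_base_mult)

lemma lmono_one_smult: "m \<in> carrier M \<Longrightarrow> lmono R 0 \<one>\<^bsub>R\<^esub> \<odot>\<^bsub>M\<^esub> m = m"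
  using M.smult_one[of m] by (simp add: laurent_simps(4))

lemma lmono_pls_mns: "a \<in> carrier C \<Longrightarrow> lmono C 0 (pls a) \<in> carrier Ct" "a \<in> carrier C \<Longrightarrow> lmono C (-1) (mns a) \<in> carrier Ct"
  by (simp_all add: Ct_gens pls_eig mns_eig)

lemma unmix_coeff_add_maps:
  assumes m: "m \<in> carrier M" shows "unmix_coeff M m n \<in> add_maps C MCt.T"
  unfolding unmix_coeff_def using m lmono_base_one M.smult_closed
  by (intro add_maps_sum MCt.abelian_group_T add_mapsI)
    (simp_all add: MCt.pure_closed lmono_pls_mns add_maps_add[OF pls_add_maps] add_maps_add[OF mns_add_maps]
      add_maps_add[OF lmono_add_maps] contraction_simps(2)[symmetric] MCt.pure_add_right)

lemma unmix_coeff_add: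
  assumes "m \<in> carrier M" "m' \<in> carrier M" "a \<in> carrier C"
  shows "unmix_coeff M (m \<oplus>\<^bsub>M\<^esub> m') n a = unmix_coeff M m n a \<oplus>\<^bsub>MCt.T\<^esub> unmix_coeff M m' n a"
  unfolding unmix_coeff_def using assms lmono_base_one
  by (simp add: M.smult_r_distr MCt.pure_add_left MCt.pure_closed lmono_pls_mns MCt.T.a_ac)

lemma unmix_lsum_lmono:
  "m \<in> carrier M \<Longrightarrow> a \<in> carrier C \<Longrightarrow> lsum MCt.T (unmix_coeff M m) (lmono C n a) = unmix_coeff M m n a"
  by (rule lsum_lmono[OF MCt.abelian_group_T unmix_coeff_add_maps])

lemma unmix_lsum_add_maps: "m \<in> carrier M \<Longrightarrow> lsum MCt.T (unmix_coeff M m) \<in> add_maps LC MCt.T"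
  by (rule lsum_add_maps[OF MCt.abelian_group_T unmix_coeff_add_maps])

text \<open>The power of s is already collected on the module side, where \<open>s^k\<close> merges
  with it. Only the constant \<open>r\<close> crosses the tensor sign, which is legitimate over
  R[t].\<close>

lemma unmix_coeff_smult:
  assumes "m \<in> carrier M" "a \<in> carrier C" "r \<in> carrier R"
  shows "unmix_coeff M (lmono R k r \<odot>\<^bsub>M\<^esub> m) n a = unmix_coeff M m (k + n) (r \<odot>\<^bsub>C\<^esub> a)"
proof -
  have 1: "lmono R n' \<one>\<^bsub>R\<^esub> \<odot>\<^bsub>M\<^esub> (lmono R k r \<odot>\<^bsub>M\<^esub> m) = lmono R 0 r \<odot>\<^bsub>M\<^esub> (lmono R (k + n') \<one>\<^bsub>R\<^esub> \<odot>\<^bsub>M\<^esub> m)" for n'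
    using assms by (simp add: smult_lmono_smult add.commute)
  have 2: "MCt.pr (lmono R 0 r \<odot>\<^bsub>M\<^esub> x) (lmono C j b) = MCt.pr x (lmono C j (r \<odot>\<^bsub>C\<^esub> b))"
    if "x \<in> carrier M" "b \<in> carrier C" "lmono C j b \<in> carrier Ct" for x j b
    using that assms MCt.pure_balanced[OF lmono_poly_t[OF assms(3), of 0] that(1,3)]
    by (simp add: contraction_simps lmono_smult)
  show ?thesis
    unfolding unmix_coeff_def 1 using assms lmono_base_one
    by (simp add: 2 lmono_pls_mns pls_smult mns_smult add.assoc)
qed

text \<open>\<open>unmix\<close> starts from a tensor product over R[s,1/s] although it ends in one
  over R[t], so balancedness is required for all Laurent scalars; by additivity in the scalar it
  reduces to monomials.\<close>

lemma balanced_unmix: "balanced LB M LC MCt.T (\<lambda>m g. lsum MCt.T (unmix_coeff M m) g)"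
proof (rule balancedI)
  note la = unmix_lsum_add_maps
  show "lsum MCt.T (unmix_coeff M m) \<in> add_maps LC MCt.T" if "m \<in> carrier M" for m by (rule la[OF that])
  show "(\<lambda>m. lsum MCt.T (unmix_coeff M m) g) \<in> add_maps M MCt.T" if g: "g \<in> carrier LC" for g
  proof (rule add_mapsI)
    fix m m' assume m: "m \<in> carrier M" "m' \<in> carrier M"
    show "lsum MCt.T (unmix_coeff M (m \<oplus>\<^bsub>M\<^esub> m')) g =
      lsum MCt.T (unmix_coeff M m) g \<oplus>\<^bsub>MCt.T\<^esub> lsum MCt.T (unmix_coeff M m') g"
      by (rule add_maps_eqI[OF la add_maps_sum[OF la la MCt.abelian_group_T] _ g])
        (use m in \<open>simp_all add: unmix_lsum_lmono unmix_coeff_add\<close>)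
  qed (rule add_maps_closed[OF la g])
  show "lsum MCt.T (unmix_coeff M (q \<odot>\<^bsub>M\<^esub> m)) g = lsum MCt.T (unmix_coeff M m) (q \<odot>\<^bsub>LC\<^esub> g)"
    if q: "q \<in> carrier LB" and m: "m \<in> carrier M" and g: "g \<in> carrier LC" for q m g
    using q
  proof (induction q rule: LB_induct)
    case (mono k r)
    have s: "smult LC (lmono R k r) \<in> add_maps LC LC"
      by (rule add_mapsI) (use mono in \<open>simp_all add: L_smult_closed lmono_base_closed L_smult_distr\<close>)
    show ?case
      by (rule add_maps_eqI[OF la add_maps_comp[OF s la] _ g])
        (use mono m in \<open>simp_all add: unmix_lsum_lmono lmono_base_closed lmono_smult unmix_coeff_smult\<close>)
  next
    case (add p q)
    have "lsum MCt.T (unmix_coeff M (p \<odot>\<^bsub>M\<^esub> m \<oplus>\<^bsub>M\<^esub> q \<odot>\<^bsub>M\<^esub> m)) g =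
      lsum MCt.T (unmix_coeff M (p \<odot>\<^bsub>M\<^esub> m)) g \<oplus>\<^bsub>MCt.T\<^esub> lsum MCt.T (unmix_coeff M (q \<odot>\<^bsub>M\<^esub> m)) g"
      by (rule add_maps_eqI[OF la add_maps_sum[OF la la MCt.abelian_group_T] _ g])
        (use m add in \<open>simp_all add: unmix_lsum_lmono unmix_coeff_add\<close>)
    then show ?case
      using add m g by (simp add: M.smult_l_distr L_smult_distr add_maps_add[OF la] L_smult_closed)
  qed
qed

lemma Ct_incl: "(\<lambda>x. x) \<in> semilin (\<lambda>r. r) P Ct LC"
  using Ct_subset by (intro semilinI add_mapsI) (auto simp: contraction_simps(2,4))

lemma id_base: "(\<lambda>x. x) \<in> semilin (\<lambda>r. r) P M M"
  by (rule semilin_id)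

lemma funcset_base: "(\<lambda>x. x) \<in> carrier P \<rightarrow> carrier LB"
  using poly_t_subset by auto

text \<open>Even powers of s are powers of t and cross a tensor sign over R[t], including negative
  ones as long as both monomials concerned lie in the contraction.\<close>

lemma even_shift:
  assumes m: "m \<in> carrier M" and a: "a \<in> carrier C" and e: "even e"
    and c: "lmono C j a \<in> carrier Ct" "lmono C (e + j) a \<in> carrier Ct"
  shows "MCt.pr (lmono R e \<one>\<^bsub>R\<^esub> \<odot>\<^bsub>M\<^esub> m) (lmono C j a) = MCt.pr m (lmono C (e + j) a)"
proof (cases "0 \<le> e")
  case True
  then show ?thesis
    using MCt.pure_balanced[OF lmono_poly_t[of "\<one>\<^bsub>R\<^esub>" e] m c(1)] e a by (simp add: contraction_simps lmono_smult)
next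
  \<comment> \<open>A negative power of t is not in R[t]. Instead the opposite positive power is
    moved from right to left, where it cancels against \<open>s^e\<close>.\<close>
  case False
  then have P: "lmono R (-e) \<one>\<^bsub>R\<^esub> \<in> carrier P" using e by (simp add: lmono_poly_t)
  have "lmono C j a = lmono R (-e) \<one>\<^bsub>R\<^esub> \<odot>\<^bsub>Ct\<^esub> lmono C (e + j) a"
    using a by (simp add: contraction_simps lmono_smult)
  then show ?thesis
    using MCt.pure_balanced[OF P _ c(2), of "lmono R e \<one>\<^bsub>R\<^esub> \<odot>\<^bsub>M\<^esub> m"] m lmono_base_one
    by (simp add: smult_lmono_smult lmono_one_smult)
qed

text \<open>On m \<otimes> s^n a with a in \<open>eig n\<close> one of the two summands of
  \<open>unmix\<close> vanishes. What remains is s^n m \<otimes> a for even n and s^(n+1) m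
  \<otimes> s^(-1) a for odd n; in both cases an even power of s moves back to the right
  factor.\<close>

lemma unmix_tensor_map:
  assumes X: "X \<in> carrier MCt.T"
  shows "unmix M (tensor_map LB M LC (\<lambda>x. x) (\<lambda>x. x) X) = X"
proof (rule MCt.add_maps_eqI[OF _ add_maps_id _ X])
  note tm = tensor_map_semilin[OF MCt.tensor_pair_axioms MLC.tensor_pair_axioms id_base Ct_incl funcset_base]
  note tp = tensor_map_pure[OF MCt.tensor_pair_axioms MLC.tensor_pair_axioms id_base Ct_incl funcset_base]
  have u: "unmix M \<in> add_maps MLC.T MCt.T"
    unfolding unmix_def by (intro MLC.tensor_lift_add_maps MCt.abelian_group_T balanced_unmix)
  show "(\<lambda>X. unmix M (tensor_map LB M LC (\<lambda>x. x) (\<lambda>x. x) X)) \<in> add_maps MCt.T MCt.T"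
    by (rule add_maps_comp[OF semilin_add_maps[OF tm] u])
  fix m g assume m: "m \<in> carrier M" and g: "g \<in> carrier Ct"
  have "lsum MCt.T (unmix_coeff M m) g = MCt.pr m g"
    using g
  proof (induction g rule: Ct_induct)
    case (mono n a)
    have a: "a \<in> carrier C" using mono(1) eig_subset by auto
    show ?case
    proof (cases "even n")
      case True
      have "unmix_coeff M m n a = MCt.pr (lmono R n \<one>\<^bsub>R\<^esub> \<odot>\<^bsub>M\<^esub> m) (lmono C 0 a)"
        using mono a m True lmono_base_one MCt.pure_zero_right[of "lmono R (n + 1) \<one>\<^bsub>R\<^esub> \<odot>\<^bsub>M\<^esub> m"] lmono_pls_mns(1)[OF a]
        by (simp add: unmix_coeff_def pls_even mns_even lmono_zero contraction_simps(5) MCt.pure_closed)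
      then show ?thesis
        using even_shift[OF m a True, of 0] mono(2) lmono_pls_mns(1)[OF a] pls_even[OF True mono(1)]
        by (simp add: unmix_lsum_lmono[OF m a])
    next
      case False
      have "unmix_coeff M m n a = MCt.pr (lmono R (n + 1) \<one>\<^bsub>R\<^esub> \<odot>\<^bsub>M\<^esub> m) (lmono C (-1) a)"
        using mono a m False lmono_base_one MCt.pure_zero_right[of "lmono R n \<one>\<^bsub>R\<^esub> \<odot>\<^bsub>M\<^esub> m"] lmono_pls_mns(2)[OF a]
        by (simp add: unmix_coeff_def pls_odd mns_odd lmono_zero contraction_simps(5) MCt.pure_closed)
      then show ?thesis
        using even_shift[OF m a, of "n + 1" "-1"] False mono(2) lmono_pls_mns(2)[OF a] mns_odd[OF False mono(1)]
        by (simp add: unmix_lsum_lmono[OF m a])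
    qed
  next
    case (add f g)
    then have "f \<in> carrier LC" "g \<in> carrier LC" using Ct_subset by auto
    then show ?case
      using add MCt.pure_add_right[OF m add(1,2)] by (simp add: add_maps_add[OF unmix_lsum_add_maps[OF m]] contraction_simps(2))
  qed
  moreover have "g \<in> carrier LC" using g Ct_subset by auto
  ultimately show "unmix M (tensor_map LB M LC (\<lambda>x. x) (\<lambda>x. x) (MCt.pr m g)) = MCt.pr m g"
    using m g by (simp add: tp unmix_def MLC.tensor_lift_pure[OF MCt.abelian_group_T balanced_unmix])
qed

text \<open>Composed with \<open>unmix\<close>, the map in question becomes \<open>f\<close>
  tensored with the identity of the contraction, which flatness makes injective. It is applied
  twice: to the inclusion of a contraction into its Laurent algebra, and then to the comparison map
  \<open>incl\<close> itself.\<close>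

lemma contraction_tensor_inj:
  fixes e :: "'z \<Rightarrow> 'u" and e' :: "'x \<Rightarrow> 'u"
  assumes flat: "flat_module TYPE('u) P Ct" and N: "module P N" and f: "f \<in> semilin (\<lambda>r. r) P N M"
    and inj: "inj_on f (carrier N)" and e: "inj_on e (carrier N)" and e': "inj_on e' (carrier M)"
  shows "inj_on (tensor_map LB M LC f (\<lambda>x. x)) (carrier (tensor P N Ct))"
proof (rule inj_onI)
  note tp = tensor_pair.intro[OF N module_Ct]
  have fi: "inj_on (tensor_map P M Ct f (\<lambda>x. x)) (carrier (tensor P N Ct))"
    by (rule flat_module_inj[OF flat N module_poly_t[OF M] f inj e e'])
  note tm = tensor_map_semilin[OF tp MCt.tensor_pair_axioms f semilin_id funcset_id']
  have fac: "tensor_map P M Ct f (\<lambda>x. x) X = unmix M (tensor_map LB M LC f (\<lambda>x. x) X)"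
    if X: "X \<in> carrier (tensor P N Ct)" for X
  proof -
    have "tensor_map LB M LC (\<lambda>x. x) (\<lambda>x. x) (tensor_map P M Ct f (\<lambda>x. x) X) = tensor_map LB M LC f (\<lambda>x. x) X"
      by (rule tensor_map_comp[OF tp MCt.tensor_pair_axioms MLC.tensor_pair_axioms funcset_id' funcset_base
            f semilin_id id_base Ct_incl X])
    then show ?thesis using unmix_tensor_map[OF semilin_closed[OF tm X]] by simp
  qed
  fix X Y assume "X \<in> carrier (tensor P N Ct)" "Y \<in> carrier (tensor P N Ct)"
    "tensor_map LB M LC f (\<lambda>x. x) X = tensor_map LB M LC f (\<lambda>x. x) Y"
  then show "X = Y" using fac inj_onD[OF fi] by metis
qed

end

end

section \<open>Base change of linear maps to Laurent polynomials\<close>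

lemma laurent_map_semilin:
  assumes "laurent_alg R C" "laurent_alg R D" and f: "f \<in> semilin (\<lambda>r. r) R C D"
  shows laurent_map_lmono: "\<And>n c. laurent_map f (lmono C n c) = lmono D n (f c)"
    and "laurent_map f \<in> semilin (\<lambda>r. r) (laurent_base R) (laurent R C) (laurent R D)"
proof -
  interpret C: laurent_alg R C by fact
  interpret D: laurent_alg R D by fact
  have f0: "f \<zero>\<^bsub>C\<^esub> = \<zero>\<^bsub>D\<^esub>"
    by (rule add_maps_zero[OF semilin_add_maps[OF f] C.M.abelian_group_axioms D.M.abelian_group_axioms])
  then show lm: "\<And>n c. laurent_map f (lmono C n c) = lmono D n (f c)"
    by (simp add: laurent_map_def lmono_def fun_eq_iff)
  have add: "laurent_map f \<in> add_maps C.LC D.LC"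
  proof (rule add_mapsI)
    fix g assume g: "g \<in> carrier C.LC"
    have "{i. f (g i) \<noteq> \<zero>\<^bsub>D\<^esub>} \<subseteq> {i. g i \<noteq> \<zero>\<^bsub>C\<^esub>}" using f0 by auto
    then have "finite {i. f (g i) \<noteq> \<zero>\<^bsub>D\<^esub>}" using g by (simp add: laurent_simps finite_subset)
    then show "laurent_map f g \<in> carrier D.LC"
      using g semilin_closed[OF f] by (simp add: laurent_simps laurent_map_def)
  qed (simp add: laurent_simps laurent_map_def semilin_add[OF f])
  note cl = add_maps_closed[OF add] and ad = add_maps_add[OF add]
  show "laurent_map f \<in> semilin (\<lambda>r. r) C.LB C.LC D.LC"
  proof (rule semilinI[OF add])
    fix p g assume p: "p \<in> carrier C.LB" and g: "g \<in> carrier C.LC"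
    show "laurent_map f (p \<odot>\<^bsub>C.LC\<^esub> g) = p \<odot>\<^bsub>D.LC\<^esub> laurent_map f g"
      using p
    proof (induction p rule: C.LB_induct)
      case (mono m r)
      note r = this
      show ?case using g
      proof (induction g rule: C.L_induct)
        case (mono n c)
        then show ?case using r semilin_closed[OF f]
          by (simp add: C.lmono_smult D.lmono_smult lm semilin_smult[OF f])
      next
        case (add g h)
        then show ?case using r
          by (simp add: C.L_smult_distr D.L_smult_distr ad cl C.lmono_base_closed C.L_smult_closed)
      qed
    next
      case (add p q)
      then show ?case using g
        by (simp add: C.L_smult_distr D.L_smult_distr ad cl C.L_smult_closed)
    qed
  qed
qed

lemma laurent_map_mult:
  assumes "laurent_alg R C" "laurent_alg R D" and f: "f \<in> semilin (\<lambda>r. r) R C D"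
    and m: "\<And>a b. a \<in> carrier C \<Longrightarrow> b \<in> carrier C \<Longrightarrow> f (a \<otimes>\<^bsub>C\<^esub> b) = f a \<otimes>\<^bsub>D\<^esub> f b"
    and g: "g \<in> carrier (laurent R C)" and h: "h \<in> carrier (laurent R C)"
  shows "laurent_map f (g \<otimes>\<^bsub>laurent R C\<^esub> h) = laurent_map f g \<otimes>\<^bsub>laurent R D\<^esub> laurent_map f h"
proof -
  interpret C: laurent_alg R C by fact
  interpret D: laurent_alg R D by fact
  note lm = laurent_map_lmono[OF assms(1-3)]
  note sl = laurent_map_semilin(2)[OF assms(1-3)]
  note cl = semilin_closed[OF sl] and ad = semilin_add[OF sl]
  show ?thesis using g
  proof (induction g rule: C.L_induct)
    case (mono m a)
    note a = this
    show ?case using h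
    proof (induction h rule: C.L_induct)
      case (mono n b)
      then show ?case using a semilin_closed[OF f] by (simp add: C.lmono_mult D.lmono_mult lm m)
    qed (use a in \<open>simp add: C.L_distr D.L_distr ad cl C.lmono_closed C.L_mult_closed\<close>)
  qed (use h in \<open>simp add: C.L_distr D.L_distr ad cl C.L_mult_closed\<close>)
qed

section \<open>Tensor products of contraction algebras\<close>

locale inv_alg_pair = X: inv_alg R M \<mu> + Y: inv_alg R N \<nu>
  for R :: "('k, 'm) ring_scheme" and M :: "('k, 'x, 'p) module_scheme" and \<mu>
    and N :: "('k, 'y, 'q) module_scheme" and \<nu>
begin

abbreviation "LB \<equiv> laurent_base R"
abbreviation "P \<equiv> poly_t R"
abbreviation "ML \<equiv> laurent R M"
abbreviation "NL \<equiv> laurent R N"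
abbreviation "Mt \<equiv> contraction R M \<mu>"
abbreviation "Nt \<equiv> contraction R N \<nu>"

sublocale T: tensor_algs R M N
  by (simp add: tensor_algs_def X.algebra_axioms Y.algebra_axioms)
sublocale TL: tensor_algs "laurent_base R" "laurent R M" "laurent R N"
  by (simp add: tensor_algs_def X.algebra_L Y.algebra_L)
sublocale Tt: tensor_algs "poly_t R" "contraction R M \<mu>" "contraction R N \<nu>"
  by (simp add: tensor_algs_def X.algebra_Ct Y.algebra_Ct)

text \<open>Constant tensors inside the Laurent tensor product; semilinear along the inclusion of R
  in R[s,1/s].\<close>

definition "iota = tensor_map LB ML NL (lmono M 0) (lmono N 0)"

lemma lmono_semilin: "lmono M 0 \<in> semilin (lmono R 0) R M ML" "lmono N 0 \<in> semilin (lmono R 0) R N NL"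
  using X.lmono_add_maps Y.lmono_add_maps by (auto intro!: semilinI simp: X.lmono_smult Y.lmono_smult)

lemma lmono_funcset: "lmono R 0 \<in> carrier R \<rightarrow> carrier LB"
  by (simp add: X.lmono_base_closed)

lemma iota_semilin: "iota \<in> semilin (lmono R 0) R T.T TL.T"
  unfolding iota_def
  by (rule tensor_map_semilin[OF T.tensor_pair_axioms TL.tensor_pair_axioms lmono_semilin lmono_funcset])

lemma iota_pure: "x \<in> carrier M \<Longrightarrow> y \<in> carrier N \<Longrightarrow> iota (T.pr x y) = TL.pr (lmono M 0 x) (lmono N 0 y)"
  unfolding iota_def
  by (rule tensor_map_pure[OF T.tensor_pair_axioms TL.tensor_pair_axioms lmono_semilin lmono_funcset])

lemma iota_mult: "X \<in> carrier T.T \<Longrightarrow> Y \<in> carrier T.T \<Longrightarrow> iota (X \<otimes>\<^bsub>T.T\<^esub> Y) = iota X \<otimes>\<^bsub>TL.T\<^esub> iota Y"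
  unfolding iota_def
  by (rule tensor_map_mult[OF T.tensor_algs_axioms TL.tensor_algs_axioms lmono_funcset lmono_semilin])
    (simp_all add: X.lmono_mult Y.lmono_mult)

lemma iota_one: "iota \<one>\<^bsub>T.T\<^esub> = \<one>\<^bsub>TL.T\<^esub>"
  by (simp add: T.one_T TL.one_T iota_pure laurent_simps(4) X.M_cring Y.M_cring cring_rules)

lemmas iota_closed = semilin_closed[OF iota_semilin]
  and iota_add = semilin_add[OF iota_semilin]

text \<open>A power of s on a tensor can be shared between the factors in any way. The freedom is
  used to give each factor the degree that its eigenspace demands.\<close>

lemma lmono_smult_pure:
  assumes "x \<in> carrier M" "y \<in> carrier N" "i + j = n"
  shows "lmono R n \<one>\<^bsub>R\<^esub> \<odot>\<^bsub>TL.T\<^esub> iota (T.pr x y) = TL.pr (lmono M i x) (lmono N j y)"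
proof -
  have "lmono R n \<one>\<^bsub>R\<^esub> \<odot>\<^bsub>TL.T\<^esub> iota (T.pr x y) =
    (lmono R i \<one>\<^bsub>R\<^esub> \<otimes>\<^bsub>LB\<^esub> lmono R j \<one>\<^bsub>R\<^esub>) \<odot>\<^bsub>TL.T\<^esub> iota (T.pr x y)"
    using assms(3) by (simp add: X.lmono_base_mult)
  also have "\<dots> = lmono R i \<one>\<^bsub>R\<^esub> \<odot>\<^bsub>TL.T\<^esub> (lmono R j \<one>\<^bsub>R\<^esub> \<odot>\<^bsub>TL.T\<^esub> iota (T.pr x y))"
    using assms by (simp add: TL.T.smult_assoc1 X.lmono_base_one iota_closed T.pure_closed)
  also have "lmono R j \<one>\<^bsub>R\<^esub> \<odot>\<^bsub>TL.T\<^esub> iota (T.pr x y) = TL.pr (lmono M 0 x) (lmono N j y)"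
    using assms(1,2) by (simp add: iota_pure TL.smult_pure_right X.lmono_closed Y.lmono_closed X.lmono_base_one
        Y.lmono_smult)
  also have "lmono R i \<one>\<^bsub>R\<^esub> \<odot>\<^bsub>TL.T\<^esub> TL.pr (lmono M 0 x) (lmono N j y) = TL.pr (lmono M i x) (lmono N j y)"
    using assms(1,2) by (simp add: TL.smult_pure X.lmono_closed Y.lmono_closed X.lmono_base_one X.lmono_smult)
  finally show ?thesis .
qed

abbreviation "incl \<equiv> contraction_tensor_incl R M N"

lemma funcset_base: "(\<lambda>x. x) \<in> carrier P \<rightarrow> carrier LB"
  using poly_t_subset by auto

lemma incl_semilin: "incl \<in> semilin (\<lambda>r. r) P Tt.T TL.T"
  unfolding contraction_tensor_incl_def
  by (rule tensor_map_semilin[OF Tt.tensor_pair_axioms TL.tensor_pair_axioms X.Ct_incl[OF X.module_LC]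
        Y.Ct_incl[OF Y.module_LC] funcset_base])

lemma incl_pure: "x \<in> carrier Mt \<Longrightarrow> y \<in> carrier Nt \<Longrightarrow> incl (Tt.pr x y) = TL.pr x y"
  unfolding contraction_tensor_incl_def
  by (rule tensor_map_pure[OF Tt.tensor_pair_axioms TL.tensor_pair_axioms X.Ct_incl[OF X.module_LC]
        Y.Ct_incl[OF Y.module_LC] funcset_base])

lemma incl_mult: "X \<in> carrier Tt.T \<Longrightarrow> Y \<in> carrier Tt.T \<Longrightarrow> incl (X \<otimes>\<^bsub>Tt.T\<^esub> Y) = incl X \<otimes>\<^bsub>TL.T\<^esub> incl Y"
  unfolding contraction_tensor_incl_def
  by (rule tensor_map_mult[OF Tt.tensor_algs_axioms TL.tensor_algs_axioms funcset_base X.Ct_incl[OF X.module_LC]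
        Y.Ct_incl[OF Y.module_LC]])
    (simp_all add: X.contraction_simps(3) Y.contraction_simps(3))

lemma incl_one: "incl \<one>\<^bsub>Tt.T\<^esub> = \<one>\<^bsub>TL.T\<^esub>"
  unfolding Tt.one_T TL.one_T X.contraction_simps(6) Y.contraction_simps(6)
  by (rule incl_pure[OF X.Ct_closed(4) Y.Ct_closed(4)])

lemmas incl_add = semilin_add[OF incl_semilin]
  and incl_smult = semilin_smult[OF incl_semilin]

text \<open>Existence of a restriction amounts to membership in this image. As it is closed under
  sums, negatives, products and R[t]-multiples and contains 1, membership need only be checked on
  generators of the contraction.\<close>

abbreviation "im \<equiv> incl ` carrier Tt.T"

lemma im_add: "U \<in> im \<Longrightarrow> V \<in> im \<Longrightarrow> U \<oplus>\<^bsub>TL.T\<^esub> V \<in> im"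
  using incl_add by (auto simp: image_iff intro!: bexI[of _ "_ \<oplus>\<^bsub>Tt.T\<^esub> _"])

lemma im_mult: "U \<in> im \<Longrightarrow> V \<in> im \<Longrightarrow> U \<otimes>\<^bsub>TL.T\<^esub> V \<in> im"
  using incl_mult by (auto simp: image_iff intro!: bexI[of _ "_ \<otimes>\<^bsub>Tt.T\<^esub> _"] Tt.mult_closed)

lemma im_smult: "p \<in> carrier P \<Longrightarrow> U \<in> im \<Longrightarrow> p \<odot>\<^bsub>TL.T\<^esub> U \<in> im"
  using incl_smult by (auto simp: image_iff intro!: bexI[of _ "_ \<odot>\<^bsub>Tt.T\<^esub> _"])

lemma im_minus: "U \<in> im \<Longrightarrow> \<ominus>\<^bsub>TL.T\<^esub> U \<in> im"
  using add_maps_minus[OF semilin_add_maps[OF incl_semilin] Tt.abelian_group_T TL.abelian_group_T]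
  by (auto simp: image_iff intro!: bexI[of _ "\<ominus>\<^bsub>Tt.T\<^esub> _"])

lemma im_one: "\<one>\<^bsub>TL.T\<^esub> \<in> im"
  using incl_one Tt.one_closed by (metis imageI)

lemma im_pure: "x \<in> carrier Mt \<Longrightarrow> y \<in> carrier Nt \<Longrightarrow> TL.pr x y \<in> im"
  using incl_pure Tt.pure_closed by (metis imageI)

abbreviation "\<tau> \<equiv> tensor_map R M N \<mu> \<nu>"

lemma tau_semilin: "\<tau> \<in> semilin (\<lambda>r. r) R T.T T.T"
  by (rule tensor_map_semilin[OF T.tensor_pair_axioms T.tensor_pair_axioms X.sigma_lin Y.sigma_lin funcset_id'])

lemma tau_pure: "x \<in> carrier M \<Longrightarrow> y \<in> carrier N \<Longrightarrow> \<tau> (T.pr x y) = T.pr (\<mu> x) (\<nu> y)"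
  by (rule tensor_map_pure[OF T.tensor_pair_axioms T.tensor_pair_axioms X.sigma_lin Y.sigma_lin funcset_id'])

text \<open>Expanding both factors into eigenparts gives x \<otimes> y = E + D, where E collects the
  terms of equal parity and D the mixed ones; the involution turns this into E - D.\<close>

lemma pure_split:
  assumes x: "x \<in> carrier M" and y: "y \<in> carrier N"
  defines "E \<equiv> T.pr (X.pls x) (Y.pls y) \<oplus>\<^bsub>T.T\<^esub> T.pr (X.mns x) (Y.mns y)"
    and "D \<equiv> T.pr (X.mns x) (Y.pls y) \<oplus>\<^bsub>T.T\<^esub> T.pr (X.pls x) (Y.mns y)"
  shows "T.pr x y \<oplus>\<^bsub>T.T\<^esub> T.pr (\<mu> x) (\<nu> y) = E \<oplus>\<^bsub>T.T\<^esub> E"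
    and "T.pr x y \<oplus>\<^bsub>T.T\<^esub> \<ominus>\<^bsub>T.T\<^esub> T.pr (\<mu> x) (\<nu> y) = D \<oplus>\<^bsub>T.T\<^esub> D"
proof -
  note cl = x y X.pls_closed[OF x] X.mns_closed[OF x] Y.pls_closed[OF y] Y.mns_closed[OF y]
  note [simp] = cl T.pure_closed T.pure_add_left T.pure_add_right T.pure_minus_left T.pure_minus_right
  have ED: "E \<in> carrier T.T" "D \<in> carrier T.T" by (simp_all add: E_def D_def)
  have "T.pr x y = T.pr (X.pls x \<oplus>\<^bsub>M\<^esub> X.mns x) (Y.pls y \<oplus>\<^bsub>N\<^esub> Y.mns y)"
    using x y by (simp only: X.pls_mns Y.pls_mns)
  also have "\<dots> = E \<oplus>\<^bsub>T.T\<^esub> D"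
    by (simp add: E_def D_def T.T.a_ac)
  finally have 1: "T.pr x y = E \<oplus>\<^bsub>T.T\<^esub> D" .
  have add4: "(a \<oplus>\<^bsub>T.T\<^esub> b) \<oplus>\<^bsub>T.T\<^esub> (c \<oplus>\<^bsub>T.T\<^esub> d) = (a \<oplus>\<^bsub>T.T\<^esub> c) \<oplus>\<^bsub>T.T\<^esub> (b \<oplus>\<^bsub>T.T\<^esub> d)"
    if "a \<in> carrier T.T" "b \<in> carrier T.T" "c \<in> carrier T.T" "d \<in> carrier T.T" for a b c d
    using that by (simp add: T.T.a_ac)
  have "T.pr (\<mu> x) (\<nu> y) = E \<oplus>\<^bsub>T.T\<^esub> \<ominus>\<^bsub>T.T\<^esub> D"
    using x y by (simp add: X.sigma_pls_mns Y.sigma_pls_mns E_def D_def T.T.a_ac T.T.minus_add)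
  then show "T.pr x y \<oplus>\<^bsub>T.T\<^esub> T.pr (\<mu> x) (\<nu> y) = E \<oplus>\<^bsub>T.T\<^esub> E"
    "T.pr x y \<oplus>\<^bsub>T.T\<^esub> \<ominus>\<^bsub>T.T\<^esub> T.pr (\<mu> x) (\<nu> y) = D \<oplus>\<^bsub>T.T\<^esub> D"
    using ED T.T.r_neg[OF ED(1)] T.T.r_neg[OF ED(2)] add4[of E D E "\<ominus>\<^bsub>T.T\<^esub> D"] add4[of E D "\<ominus>\<^bsub>T.T\<^esub> E" D]
    by (simp_all add: 1 T.T.minus_add)
qed

text \<open>The claim is made for X + \<tau> X and every X, rather than for invariant X, because
  invariance is not inherited by the pure tensors of which X is a sum. The resulting factor 2 is
  divided out afterwards.\<close>

lemma iota_even_im: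
  assumes "X \<in> carrier T.T" shows "iota (X \<oplus>\<^bsub>T.T\<^esub> \<tau> X) \<in> im"
  using assms
proof (induction X rule: T.T_induct)
  case (pure x y)
  have "TL.pr (lmono M 0 (X.pls x)) (lmono N 0 (Y.pls y)) \<in> im"
    using pure by (intro im_pure X.Ct_gens Y.Ct_gens X.pls_eig Y.pls_eig)
  moreover have "TL.pr (lmono M 0 (X.mns x)) (lmono N 0 (Y.mns y)) \<in> im"
  proof -
    have "lmono R 2 \<one>\<^bsub>R\<^esub> \<odot>\<^bsub>TL.T\<^esub> TL.pr (lmono M (-1) (X.mns x)) (lmono N (-1) (Y.mns y)) \<in> im"
      using pure by (intro im_smult im_pure X.Ct_gens Y.Ct_gens X.mns_eig Y.mns_eig X.lmono_poly_t) simp_all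
    \<comment> \<open>Multiplication by t raises the left factor from degree -1 to degree 1; the
      splittings 1 + (-1) and 0 + 0 of total degree 0 give the same tensor.\<close>
    moreover have "lmono R 2 \<one>\<^bsub>R\<^esub> \<odot>\<^bsub>TL.T\<^esub> TL.pr (lmono M (-1) (X.mns x)) (lmono N (-1) (Y.mns y)) =
      TL.pr (lmono M 0 (X.mns x)) (lmono N 0 (Y.mns y))"
      using pure lmono_smult_pure[of "X.mns x" "Y.mns y" 1 "-1" 0]  lmono_smult_pure[of "X.mns x" "Y.mns y" 0 0 0]
        X.lmono_one_smult[OF TL.module_T iota_closed[OF T.pure_closed]]
      by (simp add: TL.smult_pure X.lmono_closed Y.lmono_closed X.lmono_base_one X.lmono_smult)
    ultimately show ?thesis by simp
  qed
  ultimately show ?case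
    using pure by (simp add: tau_pure pure_split(1) iota_add iota_pure T.pure_closed im_add)
next
  case (add X Y)
  then have "iota (X \<oplus>\<^bsub>T.T\<^esub> Y \<oplus>\<^bsub>T.T\<^esub> \<tau> (X \<oplus>\<^bsub>T.T\<^esub> Y)) = iota (X \<oplus>\<^bsub>T.T\<^esub> \<tau> X) \<oplus>\<^bsub>TL.T\<^esub> iota (Y \<oplus>\<^bsub>T.T\<^esub> \<tau> Y)"
    by (simp add: iota_add[symmetric] semilin_add[OF tau_semilin] semilin_closed[OF tau_semilin] T.T.a_ac)
  then show ?case using add.IH im_add by metis
qed

text \<open>The same device on the -1 side: D has exactly one odd factor in each term, and that
  factor takes up the single s^(-1).\<close>

lemma iota_odd_im:
  assumes "X \<in> carrier T.T" shows "lmono R (-1) \<one>\<^bsub>R\<^esub> \<odot>\<^bsub>TL.T\<^esub> iota (X \<oplus>\<^bsub>T.T\<^esub> \<ominus>\<^bsub>T.T\<^esub> \<tau> X) \<in> im"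
  using assms
proof (induction X rule: T.T_induct)
  case (pure x y)
  have "TL.pr (lmono M (-1) (X.mns x)) (lmono N 0 (Y.pls y)) \<in> im"
    "TL.pr (lmono M 0 (X.pls x)) (lmono N (-1) (Y.mns y)) \<in> im"
    using pure by (auto intro!: im_pure X.Ct_gens Y.Ct_gens X.pls_eig Y.pls_eig X.mns_eig Y.mns_eig)
  then show ?case
    using pure lmono_smult_pure[of "X.mns x" "Y.pls y" "-1" 0 "-1"] lmono_smult_pure[of "X.pls x" "Y.mns y" 0 "-1" "-1"]
    by (simp add: tau_pure pure_split(2) iota_add iota_closed T.pure_closed im_add TL.T.smult_r_distr X.lmono_base_one)
next
  case (add X Y)
  then have "X \<oplus>\<^bsub>T.T\<^esub> Y \<oplus>\<^bsub>T.T\<^esub> \<ominus>\<^bsub>T.T\<^esub> \<tau> (X \<oplus>\<^bsub>T.T\<^esub> Y) = (X \<oplus>\<^bsub>T.T\<^esub> \<ominus>\<^bsub>T.T\<^esub> \<tau> X) \<oplus>\<^bsub>T.T\<^esub> (Y \<oplus>\<^bsub>T.T\<^esub> \<ominus>\<^bsub>T.T\<^esub> \<tau> Y)"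
    by (simp add: semilin_add[OF tau_semilin] semilin_closed[OF tau_semilin] T.T.a_ac T.T.minus_add)
  then show ?case
    using add by (simp add: iota_add iota_closed semilin_closed[OF tau_semilin] TL.T.smult_r_distr X.lmono_base_one im_add)
qed

end

section \<open>Restricting a coaction to the contraction algebras\<close>

text \<open>Only an equivariant algebra map into a tensor product is assumed, so that a coaction
  and, with both algebras equal, a comultiplication are treated at once.\<close>

locale comod = inv_alg_pair R M \<mu> N \<nu>
  for R :: "('k, 'm) ring_scheme" and M :: "('k, 'x, 'p) module_scheme" and \<mu>
    and N :: "('k, 'y, 'q) module_scheme" and \<nu> +
  fixes \<rho> :: "'x \<Rightarrow> ('x \<times> 'y \<Rightarrow>\<^sub>0 int) set"
  assumes rho: "\<rho> \<in> alg_maps R M (tensor R M N)"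
    and equivariant: "\<And>b. b \<in> carrier M \<Longrightarrow> \<rho> (\<mu> b) = tensor_map R M N \<mu> \<nu> (\<rho> b)"
begin

lemma rho_lin: "\<rho> \<in> semilin (\<lambda>r. r) R M T.T"
  and rho_mult: "a \<in> carrier M \<Longrightarrow> b \<in> carrier M \<Longrightarrow> \<rho> (a \<otimes>\<^bsub>M\<^esub> b) = \<rho> a \<otimes>\<^bsub>T.T\<^esub> \<rho> b"
  and rho_one: "\<rho> \<one>\<^bsub>M\<^esub> = \<one>\<^bsub>T.T\<^esub>"
  using rho by (auto simp: alg_maps_def lin_maps_semilin ring_hom_def)

lemmas rho_closed = semilin_closed[OF rho_lin]

abbreviation "rhoL \<equiv> laurent_comap R M M N \<rho>"

definition "coef n c = lmono R n \<one>\<^bsub>R\<^esub> \<odot>\<^bsub>TL.T\<^esub> iota (\<rho> c)"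

text \<open>Identifies the base change with an \<open>lsum\<close>, which yields additivity and the
  values on monomials.\<close>

lemma rhoL_lsum: "rhoL = X.lsum TL.T coef"
  by (simp add: fun_eq_iff laurent_comap_def Let_def X.lsum_def coef_def iota_def tensor_map_def)

lemma coef_add_maps: "coef n \<in> add_maps M TL.T"
  unfolding coef_def
  by (rule add_maps_comp[OF add_maps_comp[OF semilin_add_maps[OF rho_lin] semilin_add_maps[OF iota_semilin]]
        TL.smult_add_maps[OF X.lmono_base_one]])

lemma rhoL_add_maps: "rhoL \<in> add_maps ML TL.T"
  unfolding rhoL_lsum by (rule X.lsum_add_maps[OF TL.abelian_group_T coef_add_maps])

lemma rhoL_lmono: "b \<in> carrier M \<Longrightarrow> rhoL (lmono M n b) = lmono R n \<one>\<^bsub>R\<^esub> \<odot>\<^bsub>TL.T\<^esub> iota (\<rho> b)"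
  unfolding rhoL_lsum by (simp add: X.lsum_lmono[OF TL.abelian_group_T coef_add_maps] coef_def)

lemmas rhoL_closed = add_maps_closed[OF rhoL_add_maps]
  and rhoL_add = add_maps_add[OF rhoL_add_maps]

lemma rhoL_semilin: "rhoL \<in> semilin (\<lambda>r. r) LB ML TL.T"
proof (rule semilinI[OF rhoL_add_maps])
  fix p f assume p: "p \<in> carrier LB" and f: "f \<in> carrier ML"
  show "rhoL (p \<odot>\<^bsub>ML\<^esub> f) = p \<odot>\<^bsub>TL.T\<^esub> rhoL f"
    using p
  proof (induction p rule: X.LB_induct)
    case (mono m r)
    note r = this
    show ?case using f
    proof (induction f rule: X.L_induct)
      case (mono n b)
      have "lmono R (m + n) \<one>\<^bsub>R\<^esub> \<odot>\<^bsub>TL.T\<^esub> (lmono R 0 r \<odot>\<^bsub>TL.T\<^esub> iota (\<rho> b)) =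
        lmono R m r \<odot>\<^bsub>TL.T\<^esub> (lmono R n \<one>\<^bsub>R\<^esub> \<odot>\<^bsub>TL.T\<^esub> iota (\<rho> b))"
        using r mono by (simp add: X.smult_lmono_smult[OF TL.module_T] iota_closed rho_closed)
      then show ?case using r mono
        by (simp add: X.lmono_smult rhoL_lmono semilin_smult[OF rho_lin] semilin_smult[OF iota_semilin] rho_closed)
    next
      case (add f g)
      then show ?case using r
        by (simp add: X.L_smult_distr rhoL_add rhoL_closed X.lmono_base_closed X.L_smult_closed TL.T.smult_r_distr)
    qed
  next
    case (add p q)
    then show ?case using f
      by (simp add: X.L_smult_distr rhoL_add rhoL_closed X.L_smult_closed TL.T.smult_l_distr)
  qed
qed

lemmas rhoL_smult = semilin_smult[OF rhoL_semilin]

lemma rhoL_mult: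
  assumes f: "f \<in> carrier ML" and g: "g \<in> carrier ML"
  shows "rhoL (f \<otimes>\<^bsub>ML\<^esub> g) = rhoL f \<otimes>\<^bsub>TL.T\<^esub> rhoL g"
  using f
proof (induction f rule: X.L_induct)
  case (mono m a)
  note a = this
  show ?case using g
  proof (induction g rule: X.L_induct)
    case (mono n b)
    then show ?case using a
      by (simp add: X.lmono_mult rhoL_lmono rho_mult iota_mult rho_closed TL.smult_mult_smult X.lmono_base_one
          iota_closed X.lmono_base_mult)
  next
    case (add f g)
    then show ?case using a
      by (simp add: X.L_distr rhoL_add rhoL_closed X.lmono_closed X.L_mult_closed
          add_maps_add[OF TL.mult_add_maps_right])
  qed
next
  case (add f h)
  then show ?case using g
    by (simp add: X.L_distr rhoL_add rhoL_closed X.L_mult_closed add_maps_add[OF TL.mult_add_maps_left])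
qed

lemma rhoL_one: "rhoL \<one>\<^bsub>ML\<^esub> = \<one>\<^bsub>TL.T\<^esub>"
  by (simp add: laurent_simps(4) rhoL_lmono rho_one iota_one X.lmono_one_smult[OF TL.module_T] TL.one_closed)

lemma rhoL_lmono_zero: "b \<in> carrier M \<Longrightarrow> rhoL (lmono M 0 b) = iota (\<rho> b)"
  by (simp add: rhoL_lmono X.lmono_one_smult[OF TL.module_T] iota_closed rho_closed)

lemma half_poly_t: "lmono R 0 (half R) \<in> carrier P"
  by (simp add: X.lmono_poly_t)

text \<open>Undoes the doubling in \<open>iota_even_im\<close> and \<open>iota_odd_im\<close>: 1/2
  is a constant, hence in R[t], and preserves \<open>im\<close>.\<close>

lemma half_iota:
  assumes "X \<in> carrier T.T"
  shows "lmono R 0 (half R) \<odot>\<^bsub>TL.T\<^esub> iota (X \<oplus>\<^bsub>T.T\<^esub> X) = iota X"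
proof -
  have "half R \<odot>\<^bsub>T.T\<^esub> (X \<oplus>\<^bsub>T.T\<^esub> X) = X"
    using assms T.T.smult_l_distr[of "half R" "half R" X] by (simp add: T.T.smult_r_distr X.half_two)
  then show ?thesis using semilin_smult[OF iota_semilin, of "half R" "X \<oplus>\<^bsub>T.T\<^esub> X"] assms by simp
qed

lemma rhoL_even_im: assumes b: "b \<in> X.eig 0" shows "rhoL (lmono M 0 b) \<in> im"
proof -
  have bM: "b \<in> carrier M" using b X.eig_subset by auto
  have "\<tau> (\<rho> b) = \<rho> b" using equivariant[OF bM] b by (simp add: X.eig_def eig_plus_def)
  then have "iota (\<rho> b \<oplus>\<^bsub>T.T\<^esub> \<rho> b) \<in> im" using iota_even_im[OF rho_closed[OF bM]] by simp
  then have "lmono R 0 (half R) \<odot>\<^bsub>TL.T\<^esub> iota (\<rho> b \<oplus>\<^bsub>T.T\<^esub> \<rho> b) \<in> im"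
    by (rule im_smult[OF half_poly_t])
  then show ?thesis by (simp add: half_iota rho_closed bM rhoL_lmono_zero)
qed

lemma rhoL_odd_im: assumes b: "b \<in> X.eig (-1)" shows "rhoL (lmono M (-1) b) \<in> im"
proof -
  have bM: "b \<in> carrier M" using b X.eig_subset by auto
  note rb = rho_closed[OF bM]
  have "\<tau> (\<rho> b) = \<ominus>\<^bsub>T.T\<^esub> \<rho> b"
    using equivariant[OF bM] b add_maps_minus[OF semilin_add_maps[OF rho_lin] X.M.abelian_group_axioms T.abelian_group_T bM]
    by (simp add: X.eig_def eig_minus_def)
  then have "lmono R (-1) \<one>\<^bsub>R\<^esub> \<odot>\<^bsub>TL.T\<^esub> iota (\<rho> b \<oplus>\<^bsub>T.T\<^esub> \<rho> b) \<in> im"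
    using iota_odd_im[OF rb] rb by simp
  then have "lmono R 0 (half R) \<odot>\<^bsub>TL.T\<^esub> (lmono R (-1) \<one>\<^bsub>R\<^esub> \<odot>\<^bsub>TL.T\<^esub> iota (\<rho> b \<oplus>\<^bsub>T.T\<^esub> \<rho> b)) \<in> im"
    by (rule im_smult[OF half_poly_t])
  moreover have "lmono R 0 (half R) \<odot>\<^bsub>TL.T\<^esub> (lmono R (-1) \<one>\<^bsub>R\<^esub> \<odot>\<^bsub>TL.T\<^esub> iota (\<rho> b \<oplus>\<^bsub>T.T\<^esub> \<rho> b)) =
    lmono R (-1) \<one>\<^bsub>R\<^esub> \<odot>\<^bsub>TL.T\<^esub> (lmono R 0 (half R) \<odot>\<^bsub>TL.T\<^esub> iota (\<rho> b \<oplus>\<^bsub>T.T\<^esub> \<rho> b))"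
    using rb by (simp add: X.smult_lmono_smult[OF TL.module_T] iota_closed)
  ultimately show ?thesis by (simp add: half_iota rb rhoL_lmono[OF bM])
qed

lemma rhoL_im: assumes "f \<in> carrier Mt" shows "rhoL f \<in> im"
  using assms[unfolded X.contraction_simps]
proof (induction f rule: generate_ring.induct)
  case one
  then show ?case using rhoL_one im_one by simp
next
  case (incl h)
  then consider p where "p \<in> carrier P" "h = p \<odot>\<^bsub>ML\<^esub> \<one>\<^bsub>ML\<^esub>" | a where "a \<in> X.eig 0" "h = lmono M 0 a"
    | a where "a \<in> X.eig (-1)" "h = lmono M (-1) a"
    by (auto simp: X.ct_gens_def)
  then show ?case
  proof cases
    case 1
    then have "p \<in> carrier LB" "\<one>\<^bsub>ML\<^esub> \<in> carrier ML" using poly_t_subset X.Ct_closed(4) X.Ct_subset by auto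
    then show ?thesis using 1 by (simp add: rhoL_smult rhoL_one im_smult im_one)
  qed (simp_all add: rhoL_even_im rhoL_odd_im)
next
  case (a_inv h)
  then have "h \<in> carrier ML" using X.Ct_subset by (auto simp: X.contraction_simps)
  then show ?case
    using a_inv by (simp add: add_maps_minus[OF rhoL_add_maps X.abelian_group_L TL.abelian_group_T] im_minus)
next
  case (eng_add f g)
  then have "f \<in> carrier ML" "g \<in> carrier ML" using X.Ct_subset by (auto simp: X.contraction_simps)
  then show ?case using eng_add by (simp add: rhoL_add im_add)
next
  case (eng_mult f g)
  then have "f \<in> carrier ML" "g \<in> carrier ML" using X.Ct_subset by (auto simp: X.contraction_simps)
  then show ?case using eng_mult by (simp add: rhoL_mult im_mult)
qed

text \<open>For a linear map \<open>h\<close> out of \<open>M \<otimes> N\<close> and its base change \<open>hL\<close>, the map \<open>hL \<circ> rhoL\<close> is the base change of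
  \<open>h \<circ> \<rho>\<close>. Counit, antipode and differential action are all of this form.\<close>

lemma lift_rhoL_lmono:
  assumes H: "laurent_alg R H" and h: "balanced R M N H h" and hL: "balanced LB ML NL (laurent R H) hL"
    and hL_smult: "\<And>p x y. p \<in> carrier LB \<Longrightarrow> x \<in> carrier ML \<Longrightarrow> y \<in> carrier NL \<Longrightarrow>
      hL (p \<odot>\<^bsub>ML\<^esub> x) y = p \<odot>\<^bsub>laurent R H\<^esub> hL x y"
    and compat: "\<And>x y. x \<in> carrier M \<Longrightarrow> y \<in> carrier N \<Longrightarrow> hL (lmono M 0 x) (lmono N 0 y) = lmono R k \<one>\<^bsub>R\<^esub> \<odot>\<^bsub>laurent R H\<^esub> lmono H 0 (h x y)"
    and b: "b \<in> carrier M"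
  shows "tensor_lift (laurent R H) hL (rhoL (lmono M n b)) = lmono H (n + k) (tensor_lift H h (\<rho> b))"
proof -
  interpret H: laurent_alg R H by fact
  note la = T.tensor_lift_add_maps[OF H.M.abelian_group_axioms h]
    and lp = T.tensor_lift_pure[OF H.M.abelian_group_axioms h]
  note La = TL.tensor_lift_add_maps[OF H.abelian_group_L hL] and Lp = TL.tensor_lift_pure[OF H.abelian_group_L hL]
  have hcl: "h x y \<in> carrier H" if "x \<in> carrier M" "y \<in> carrier N" for x y
    using T.balanced_closed[OF h that] .
  have s: "tensor_lift H.LC hL (p \<odot>\<^bsub>TL.T\<^esub> Z) = p \<odot>\<^bsub>H.LC\<^esub> tensor_lift H.LC hL Z"
    if p: "p \<in> carrier LB" and Z: "Z \<in> carrier TL.T" for p Z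
  proof (rule TL.add_maps_eqI[OF add_maps_comp[OF TL.smult_add_maps[OF p] La] add_maps_comp[OF La] _ Z])
    show "smult H.LC p \<in> add_maps H.LC H.LC"
      by (rule add_mapsI) (simp_all add: p H.L_smult_closed H.L_smult_distr)
  qed (simp add: TL.smult_pure p Lp hL_smult X.L_smult_closed)
  have i: "tensor_lift H.LC hL (iota Z) = lmono H k (tensor_lift H h Z)" if Z: "Z \<in> carrier T.T" for Z
    by (rule T.add_maps_eqI[OF add_maps_comp[OF semilin_add_maps[OF iota_semilin] La]
          add_maps_comp[OF la H.lmono_add_maps] _ Z])
      (simp add: iota_pure Lp lp X.lmono_closed Y.lmono_closed compat H.lmono_smult hcl)
  show ?thesis
    using b add_maps_closed[OF la rho_closed[OF b]]
    by (simp add: rhoL_lmono s X.lmono_base_one iota_closed rho_closed i H.lmono_smult)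
qed

text \<open>A map \<open>g\<close> on the contractions that agrees with a Laurent map
  \<open>hL\<close> induces on the R[t]-tensor product the pullback of the lift of \<open>hL\<close>
  along \<open>incl\<close>. Identities for the contraction can thus be computed over
  R[s,1/s].\<close>

lemma lift_incl:
  assumes H: "abelian_group H" and hL: "balanced LB ML NL H hL"
    and sub: "carrier Ht \<subseteq> carrier H" "add Ht = add H" "abelian_group Ht"
    and g: "\<And>x y. x \<in> carrier Mt \<Longrightarrow> y \<in> carrier Nt \<Longrightarrow> g x y = hL x y \<and> hL x y \<in> carrier Ht"
    and X: "X \<in> carrier Tt.T"
  shows "tensor_lift Ht g X = tensor_lift H hL (incl X)" and "tensor_lift Ht g X \<in> carrier Ht"
proof -
  have bM: "x \<in> carrier ML" if "x \<in> carrier Mt" for x using that X.Ct_subset by auto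
  have bN: "x \<in> carrier NL" if "x \<in> carrier Nt" for x using that Y.Ct_subset by auto
  have cl: "x \<oplus>\<^bsub>ML\<^esub> x' \<in> carrier Mt" "p \<odot>\<^bsub>ML\<^esub> x \<in> carrier Mt" if "x \<in> carrier Mt" "x' \<in> carrier Mt" "p \<in> carrier P" for x x' p
    using that X.Ct_closed X.Ct_smult by auto
  have cl': "x \<oplus>\<^bsub>NL\<^esub> x' \<in> carrier Nt" "p \<odot>\<^bsub>NL\<^esub> x \<in> carrier Nt" if "x \<in> carrier Nt" "x' \<in> carrier Nt" "p \<in> carrier P" for x x' p
    using that Y.Ct_closed Y.Ct_smult by auto
  have pB: "p \<in> carrier LB" if "p \<in> carrier P" for p using that poly_t_subset by auto
  have zP: "\<zero>\<^bsub>P\<^esub> \<in> carrier P" by (rule Tt.M.R.zero_closed)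
  have hl: "hL (x \<oplus>\<^bsub>ML\<^esub> x') y = hL x y \<oplus>\<^bsub>H\<^esub> hL x' y" if "x \<in> carrier ML" "x' \<in> carrier ML" "y \<in> carrier NL" for x x' y
    using hL that by (auto simp: balanced_def add_maps_def)
  have hr: "hL x (y \<oplus>\<^bsub>NL\<^esub> y') = hL x y \<oplus>\<^bsub>H\<^esub> hL x y'" if "x \<in> carrier ML" "y \<in> carrier NL" "y' \<in> carrier NL" for x y y'
    using hL that by (auto simp: balanced_def add_maps_def)
  have hb: "hL (p \<odot>\<^bsub>ML\<^esub> x) y = hL x (p \<odot>\<^bsub>NL\<^esub> y)" if "x \<in> carrier ML" "y \<in> carrier NL" "p \<in> carrier LB" for x y p
    using hL that by (auto simp: balanced_def)
  have bal: "balanced P Mt Nt Ht g"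
    by (intro balancedI add_mapsI)
      (simp_all add: g X.contraction_simps(2,4) Y.contraction_simps(2,4) cl[OF _ _ zP] cl(2) cl'(2) cl'[OF _ _ zP]
        bM bN pB hl hr hb sub(2))
  note la = Tt.tensor_lift_add_maps[OF sub(3) bal] and lp = Tt.tensor_lift_pure[OF sub(3) bal]
  show "tensor_lift Ht g X \<in> carrier Ht" by (rule add_maps_closed[OF la X])
  have id: "(\<lambda>x. x) \<in> add_maps Ht H" using sub by (auto intro!: add_mapsI)
  show "tensor_lift Ht g X = tensor_lift H hL (incl X)"
    by (rule Tt.add_maps_eqI[OF add_maps_comp[OF la id] add_maps_comp[OF semilin_add_maps[OF incl_semilin]
            TL.tensor_lift_add_maps[OF H hL]] _ X])
      (simp add: lp incl_pure TL.tensor_lift_pure[OF H hL] bM bN g)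
qed

end

text \<open>Existence of the restricted map holds in \<open>comod\<close>. Injectivity of the
  comparison adds uniqueness, without which the definite description in
  \<open>contraction_comap\<close> would have no meaning.\<close>

locale comod_inj = comod +
  assumes incl_inj: "inj_on (contraction_tensor_incl R M N) (carrier (tensor (poly_t R) (contraction R M \<mu>) (contraction R N \<nu>)))"
begin

abbreviation "rhot \<equiv> contraction_comap R M M \<mu> N \<nu> \<rho>"

lemma comap_restricts: "comap_restricts R M \<mu> M \<mu> N \<nu> \<rho>"
  unfolding comap_restricts_def
proof
  fix f assume "f \<in> carrier Mt"
  from rhoL_im[OF this] obtain X where "X \<in> carrier Tt.T" "incl X = rhoL f" by auto
  then show "\<exists>!X. X \<in> carrier Tt.T \<and> incl X = rhoL f"
    using inj_onD[OF incl_inj] by (intro ex1I[of _ X]) auto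
qed

lemma rhot_closed: "f \<in> carrier Mt \<Longrightarrow> rhot f \<in> carrier Tt.T"
  and incl_rhot: "f \<in> carrier Mt \<Longrightarrow> incl (rhot f) = rhoL f"
  using theI'[of "\<lambda>X. X \<in> carrier Tt.T \<and> incl X = rhoL f"] comap_restricts
  unfolding comap_restricts_def contraction_comap_def by blast+

text \<open>Every property of the restricted map is obtained this way: both candidates have the same
  image under \<open>incl\<close>, where the property of the base change applies.\<close>

lemma rhot_eqI: "f \<in> carrier Mt \<Longrightarrow> X \<in> carrier Tt.T \<Longrightarrow> incl X = rhoL f \<Longrightarrow> rhot f = X"
  using inj_onD[OF incl_inj, of "rhot f" X] rhot_closed incl_rhot by simp

lemma rhot_semilin: "rhot \<in> semilin (\<lambda>r. r) P Mt Tt.T"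
proof (intro semilinI add_mapsI)
  fix f g assume f: "f \<in> carrier Mt" and g: "g \<in> carrier Mt"
  then have "f \<in> carrier ML" "g \<in> carrier ML" using X.Ct_subset by auto
  with f g show "rhot (f \<oplus>\<^bsub>Mt\<^esub> g) = rhot f \<oplus>\<^bsub>Tt.T\<^esub> rhot g"
    by (intro rhot_eqI) (simp_all add: rhot_closed incl_add incl_rhot X.contraction_simps(2) rhoL_add X.Ct_closed)
next
  fix p f assume p: "p \<in> carrier P" and f: "f \<in> carrier Mt"
  then have "f \<in> carrier ML" "p \<in> carrier LB" using X.Ct_subset poly_t_subset by auto
  with p f show "rhot (p \<odot>\<^bsub>Mt\<^esub> f) = p \<odot>\<^bsub>Tt.T\<^esub> rhot f"
    by (intro rhot_eqI) (simp_all add: rhot_closed incl_smult incl_rhot X.contraction_simps(4) rhoL_smult X.Ct_smult)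
qed (rule rhot_closed)

lemma rhot_alg_maps: "rhot \<in> alg_maps P Mt Tt.T"
proof -
  have "rhot \<in> ring_hom Mt Tt.T"
  proof (rule ring_hom_memI)
    fix f g assume f: "f \<in> carrier Mt" and g: "g \<in> carrier Mt"
    then have "f \<in> carrier ML" "g \<in> carrier ML" using X.Ct_subset by auto
    with f g show "rhot (f \<otimes>\<^bsub>Mt\<^esub> g) = rhot f \<otimes>\<^bsub>Tt.T\<^esub> rhot g"
      by (intro rhot_eqI) (simp_all add: rhot_closed incl_mult Tt.mult_closed incl_rhot X.contraction_simps(3) rhoL_mult X.Ct_closed)
    show "rhot (f \<oplus>\<^bsub>Mt\<^esub> g) = rhot f \<oplus>\<^bsub>Tt.T\<^esub> rhot g" by (rule semilin_add[OF rhot_semilin f g])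
  next
    show "rhot \<one>\<^bsub>Mt\<^esub> = \<one>\<^bsub>Tt.T\<^esub>"
      by (rule rhot_eqI)
        (simp_all add: Tt.one_closed incl_one X.contraction_simps(6) X.Ct_closed rhoL_one)
  qed (rule rhot_closed)
  then show ?thesis using rhot_semilin by (simp add: alg_maps_def lin_maps_semilin)
qed

end

lemma (in tensor_triple) assoc_smult:
  assumes r: "r \<in> carrier R" and X: "X \<in> carrier LM_N.T"
  shows "asc (r \<odot>\<^bsub>LM_N.T\<^esub> X) = r \<odot>\<^bsub>L_MN.T\<^esub> asc X"
  by (rule add_maps_eqI_left[OF add_maps_comp[OF LM_N.smult_add_maps[OF r] assoc_add_maps]
        add_maps_comp[OF assoc_add_maps L_MN.smult_add_maps[OF r]] _ X])
    (simp add: r LM_N.smult_pure LM.smult_pure LM.pure_closed assoc_pure L_MN.smult_pure MN.pure_closed)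

text \<open>Complements \<open>Ct_induct\<close>: for maps compatible with products it is enough to
  look at generators, so monomials of arbitrary degree never have to be examined.\<close>

lemma (in inv_alg) Ct_gen_induct [consumes 1, case_names one scalar even odd minus add mult]:
  assumes f: "f \<in> carrier Ct" and one: "Q \<one>\<^bsub>LC\<^esub>"
    and gens: "\<And>p. p \<in> carrier P \<Longrightarrow> Q (p \<odot>\<^bsub>LC\<^esub> \<one>\<^bsub>LC\<^esub>)" "\<And>a. a \<in> eig 0 \<Longrightarrow> Q (lmono C 0 a)"
      "\<And>a. a \<in> eig (-1) \<Longrightarrow> Q (lmono C (-1) a)"
    and minus: "\<And>f. f \<in> carrier Ct \<Longrightarrow> Q f \<Longrightarrow> Q (\<ominus>\<^bsub>LC\<^esub> f)"
    and add: "\<And>f g. f \<in> carrier Ct \<Longrightarrow> g \<in> carrier Ct \<Longrightarrow> Q f \<Longrightarrow> Q g \<Longrightarrow> Q (f \<oplus>\<^bsub>LC\<^esub> g)"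
    and mult: "\<And>f g. f \<in> carrier Ct \<Longrightarrow> g \<in> carrier Ct \<Longrightarrow> Q f \<Longrightarrow> Q g \<Longrightarrow> Q (f \<otimes>\<^bsub>LC\<^esub> g)"
  shows "Q f"
  using f[unfolded contraction_simps]
proof (induction f rule: generate_ring.induct)
  case (incl h)
  then show ?case using gens by (auto simp: ct_gens_def)
qed (auto simp: contraction_simps intro: one minus add mult)

section \<open>Pairing a coaction with a functional, over Laurent polynomials\<close>

context comod
begin

lemma balanced_diff:
  assumes \<psi>: "\<psi> \<in> semilin (\<lambda>r. r) R N (self_alg R)"
  shows "balanced R M N M (\<lambda>y a. \<psi> a \<odot>\<^bsub>M\<^esub> y)"
proof -
  have \<psi>c: "\<psi> a \<in> carrier R" if "a \<in> carrier N" for a using semilin_closed[OF \<psi> that] by simp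
  show ?thesis
    by (intro balancedI add_mapsI)
      (simp_all add: \<psi>c semilin_add[OF \<psi>] semilin_smult[OF \<psi>] X.smult_r_distr X.smult_l_distr
        X.smult_assoc1[symmetric] X.R.m_comm)
qed

lemma laurent_map_self:
  assumes \<psi>: "\<psi> \<in> semilin (\<lambda>r. r) R N (self_alg R)"
  shows "laurent_map \<psi> \<in> semilin (\<lambda>r. r) LB NL LB"
    and "laurent_map \<psi> (lmono N n a) = lmono R n (\<psi> a)"
  using laurent_map_semilin(2)[OF Y.laurent_alg_axioms X.LR.laurent_alg_axioms \<psi>]
    laurent_map_lmono[OF Y.laurent_alg_axioms X.LR.laurent_alg_axioms \<psi>] by simp_all

lemma smult_LB: "smult LB = mult LB"
  by (simp add: laurent_def fun_eq_iff)

text \<open>The exponent \<open>k\<close> is the power of s attached to the functional: 0 for the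
  counit and for derivations in the +1 eigenspace, 1 for those in the -1 eigenspace.\<close>

lemma balanced_diffL:
  assumes \<psi>: "\<psi> \<in> semilin (\<lambda>r. r) R N (self_alg R)"
  shows "balanced LB ML NL ML (\<lambda>y a. (lmono R k \<one>\<^bsub>R\<^esub> \<otimes>\<^bsub>LB\<^esub> laurent_map \<psi> a) \<odot>\<^bsub>ML\<^esub> y)"
proof -
  note l = laurent_map_self(1)[OF \<psi>]
  note [simp] = semilin_closed[OF l] X.lmono_base_one X.LR.L_mult_closed X.L_smult_closed
  have [simp]: "lmono R k \<one>\<^bsub>R\<^esub> \<otimes>\<^bsub>LB\<^esub> (r \<otimes>\<^bsub>LB\<^esub> p) = (lmono R k \<one>\<^bsub>R\<^esub> \<otimes>\<^bsub>LB\<^esub> p) \<otimes>\<^bsub>LB\<^esub> r" if "r \<in> carrier LB" "p \<in> carrier LB" for r p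
    using that X.LR.L_comm[OF that] by (simp add: X.LR.L_assoc)
  show ?thesis
    by (intro balancedI add_mapsI)
      (simp_all add: semilin_add[OF l] semilin_smult[OF l] smult_LB X.LA.smult_r_distr X.LA.smult_l_distr
        X.LA.smult_assoc1 X.LR.L_distr)
qed

lemma lift_diffL:
  assumes \<psi>: "\<psi> \<in> semilin (\<lambda>r. r) R N (self_alg R)" and b: "b \<in> carrier M"
  shows "tensor_lift ML (\<lambda>y a. (lmono R k \<one>\<^bsub>R\<^esub> \<otimes>\<^bsub>LB\<^esub> laurent_map \<psi> a) \<odot>\<^bsub>ML\<^esub> y) (rhoL (lmono M n b)) =
    lmono M (n + k) (diff_action M \<rho> \<psi> b)"
  unfolding diff_action_def
proof (rule lift_rhoL_lmono[OF X.laurent_alg_axioms balanced_diff[OF \<psi>] balanced_diffL[OF \<psi>] _ _ b])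
  note l = laurent_map_self(1)[OF \<psi>]
  fix p x y assume px: "p \<in> carrier LB" "x \<in> carrier ML" "y \<in> carrier NL"
  note cl = X.LR.L_mult_closed[OF X.lmono_base_one semilin_closed[OF l px(3)], of k]
  show "(lmono R k \<one>\<^bsub>R\<^esub> \<otimes>\<^bsub>LB\<^esub> laurent_map \<psi> y) \<odot>\<^bsub>ML\<^esub> (p \<odot>\<^bsub>ML\<^esub> x) =
    p \<odot>\<^bsub>ML\<^esub> ((lmono R k \<one>\<^bsub>R\<^esub> \<otimes>\<^bsub>LB\<^esub> laurent_map \<psi> y) \<odot>\<^bsub>ML\<^esub> x)"
    using px cl X.LA.smult_assoc1[OF cl px(1,2)] X.LA.smult_assoc1[OF px(1) cl px(2)] X.LR.L_comm[OF cl px(1)] by simp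
next
  fix x y assume "x \<in> carrier M" "y \<in> carrier N"
  moreover have "\<psi> y \<in> carrier R" if "y \<in> carrier N" for y using semilin_closed[OF \<psi> that] by simp
  ultimately show "(lmono R k \<one>\<^bsub>R\<^esub> \<otimes>\<^bsub>LB\<^esub> laurent_map \<psi> (lmono N 0 y)) \<odot>\<^bsub>ML\<^esub> lmono M 0 x =
    lmono R k \<one>\<^bsub>R\<^esub> \<odot>\<^bsub>ML\<^esub> lmono M 0 (\<psi> y \<odot>\<^bsub>M\<^esub> x)"
    by (simp add: laurent_map_self(2)[OF \<psi>] X.lmono_base_mult X.lmono_smult)
qed

end

context comod_inj
begin

lemma abelian_group_Mt: "abelian_group Mt"
  using Tt.M.abelian_group_axioms .

text \<open>The factor s^k can make a functional on the contraction take values in R[t] although its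
  base change alone does not; this is why the product with s^k, and not its factors, is required to
  land there.\<close>

lemma diff_rhot:
  assumes \<psi>: "\<psi> \<in> semilin (\<lambda>r. r) R N (self_alg R)" and f: "f \<in> carrier Mt"
    and \<Psi>: "\<And>a. a \<in> carrier Nt \<Longrightarrow> \<Psi> a = lmono R k \<one>\<^bsub>R\<^esub> \<otimes>\<^bsub>LB\<^esub> laurent_map \<psi> a \<and> \<Psi> a \<in> carrier P"
  shows "tensor_lift Mt (\<lambda>y a. \<Psi> a \<odot>\<^bsub>Mt\<^esub> y) (rhot f) =
    tensor_lift ML (\<lambda>y a. (lmono R k \<one>\<^bsub>R\<^esub> \<otimes>\<^bsub>LB\<^esub> laurent_map \<psi> a) \<odot>\<^bsub>ML\<^esub> y) (rhoL f)"
proof -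
  have "tensor_lift Mt (\<lambda>y a. \<Psi> a \<odot>\<^bsub>Mt\<^esub> y) (rhot f) =
    tensor_lift ML (\<lambda>y a. (lmono R k \<one>\<^bsub>R\<^esub> \<otimes>\<^bsub>LB\<^esub> laurent_map \<psi> a) \<odot>\<^bsub>ML\<^esub> y) (incl (rhot f))"
  proof (rule lift_incl(1)[OF X.abelian_group_L balanced_diffL[OF \<psi>] X.Ct_subset X.contraction_simps(2) abelian_group_Mt
        _ rhot_closed[OF f]])
    fix x y assume x: "x \<in> carrier Mt" and y: "y \<in> carrier Nt"
    have "\<Psi> y \<odot>\<^bsub>ML\<^esub> x \<in> carrier Mt" using \<Psi>[OF y] x by (intro X.Ct_smult) auto
    then show "\<Psi> y \<odot>\<^bsub>Mt\<^esub> x = (lmono R k \<one>\<^bsub>R\<^esub> \<otimes>\<^bsub>LB\<^esub> laurent_map \<psi> y) \<odot>\<^bsub>ML\<^esub> x \<and>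
      (lmono R k \<one>\<^bsub>R\<^esub> \<otimes>\<^bsub>LB\<^esub> laurent_map \<psi> y) \<odot>\<^bsub>ML\<^esub> x \<in> carrier Mt"
      using \<Psi>[OF y] by (simp add: X.contraction_simps(4))
  qed
  then show ?thesis by (simp add: incl_rhot f)
qed

end

section \<open>Coassociativity\<close>

text \<open>Coassociativity lives in triple tensor products, hence the second injectivity
  assumption. It is put on the bracketing with a single copy of \<open>N\<close> on the right, since
  that copy is the factor whose contraction is flat.\<close>

locale coassoc_comod = E: comod_inj R M \<mu> N \<nu> \<rho> + D: comod_inj R N \<nu> N \<nu> \<Delta>
  for R :: "('k, 'm) ring_scheme" and M :: "('k, 'x, 'p) module_scheme" and \<mu>
    and N :: "('k, 'y, 'q) module_scheme" and \<nu> and \<rho> and \<Delta> +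
  assumes coassoc: "\<And>b. b \<in> carrier M \<Longrightarrow>
      tensor_assoc R M N N (tensor_map R (tensor R M N) N \<rho> (\<lambda>x. x) (\<rho> b)) =
      tensor_map R M (tensor R N N) (\<lambda>x. x) \<Delta> (\<rho> b)"
    and incl3_inj: "inj_on (tensor_map (laurent_base R) (tensor (laurent_base R) (laurent R M) (laurent R N)) (laurent R N)
        (contraction_tensor_incl R M N) (\<lambda>x. x))
      (carrier (tensor (poly_t R) (tensor (poly_t R) (contraction R M \<mu>) (contraction R N \<nu>)) (contraction R N \<nu>)))"
begin

interpretation R3: tensor_triple R M N N
  by (simp add: tensor_triple_def E.T.tensor_pair_axioms D.T.tensor_pair_axioms)
interpretation L3: tensor_triple "laurent_base R" "laurent R M" "laurent R N" "laurent R N"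
  by (simp add: tensor_triple_def E.TL.tensor_pair_axioms D.TL.tensor_pair_axioms)
interpretation t3: tensor_triple "poly_t R" "contraction R M \<mu>" "contraction R N \<nu>" "contraction R N \<nu>"
  by (simp add: tensor_triple_def E.Tt.tensor_pair_axioms D.Tt.tensor_pair_axioms)

abbreviation "LB \<equiv> laurent_base R"
abbreviation "P \<equiv> poly_t R"
abbreviation "ML \<equiv> laurent R M"
abbreviation "NL \<equiv> laurent R N"
abbreviation "Mt \<equiv> contraction R M \<mu>"
abbreviation "Nt \<equiv> contraction R N \<nu>"

abbreviation "rho_id \<equiv> tensor_map R E.T.T N \<rho> (\<lambda>x. x)"
abbreviation "id_Delta \<equiv> tensor_map R M D.T.T (\<lambda>x. x) \<Delta>"
abbreviation "rhoL_id \<equiv> tensor_map LB E.TL.T NL E.rhoL (\<lambda>x. x)"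
abbreviation "id_DeltaL \<equiv> tensor_map LB ML D.TL.T (\<lambda>x. x) D.rhoL"
abbreviation "iota_left \<equiv> tensor_map LB E.TL.T NL E.iota (lmono N 0)"
abbreviation "iota_right \<equiv> tensor_map LB ML D.TL.T (lmono M 0) D.iota"

lemmas rho_id = E.T.tensor_pair_axioms R3.LM_N.tensor_pair_axioms E.rho_lin semilin_id funcset_id'
lemmas id_Delta = E.T.tensor_pair_axioms R3.L_MN.tensor_pair_axioms semilin_id D.rho_lin funcset_id'
lemmas rhoL_id = E.TL.tensor_pair_axioms L3.LM_N.tensor_pair_axioms E.rhoL_semilin semilin_id funcset_id'
lemmas id_DeltaL = E.TL.tensor_pair_axioms L3.L_MN.tensor_pair_axioms semilin_id D.rhoL_semilin funcset_id'
lemmas iota_left = R3.LM_N.tensor_pair_axioms L3.LM_N.tensor_pair_axioms E.iota_semilin E.lmono_semilin(2) E.lmono_funcset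
lemmas iota_right = R3.L_MN.tensor_pair_axioms L3.L_MN.tensor_pair_axioms E.lmono_semilin(1) D.iota_semilin E.lmono_funcset

text \<open>The Laurent coaction extends the original one on constant tensors; this square transfers
  the first side of the coassociativity law.\<close>

lemma rhoL_id_iota:
  assumes X: "X \<in> carrier E.T.T" shows "rhoL_id (E.iota X) = iota_left (rho_id X)"
  by (rule E.T.add_maps_eqI[OF
        add_maps_comp[OF semilin_add_maps[OF E.iota_semilin] semilin_add_maps[OF tensor_map_semilin[OF rhoL_id]]]
        add_maps_comp[OF semilin_add_maps[OF tensor_map_semilin[OF rho_id]] semilin_add_maps[OF tensor_map_semilin[OF iota_left]]]
        _ X])
    (simp add: E.iota_pure tensor_map_pure[OF rhoL_id] tensor_map_pure[OF rho_id] tensor_map_pure[OF iota_left]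
      E.rho_closed E.rhoL_lmono_zero E.X.lmono_closed E.Y.lmono_closed)

lemma id_DeltaL_iota:
  assumes X: "X \<in> carrier E.T.T" shows "id_DeltaL (E.iota X) = iota_right (id_Delta X)"
  by (rule E.T.add_maps_eqI[OF
        add_maps_comp[OF semilin_add_maps[OF E.iota_semilin] semilin_add_maps[OF tensor_map_semilin[OF id_DeltaL]]]
        add_maps_comp[OF semilin_add_maps[OF tensor_map_semilin[OF id_Delta]] semilin_add_maps[OF tensor_map_semilin[OF iota_right]]]
        _ X])
    (simp add: E.iota_pure tensor_map_pure[OF id_DeltaL] tensor_map_pure[OF id_Delta] tensor_map_pure[OF iota_right]
      D.rho_closed D.rhoL_lmono_zero E.X.lmono_closed E.Y.lmono_closed)

text \<open>All maps involved are linear over R[s,1/s], so s^n can be pulled out. What is left is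
  the law over R, carried over by the two squares above and naturality of the associator.\<close>

lemma coassocL:
  assumes f: "f \<in> carrier ML" shows "L3.asc (rhoL_id (E.rhoL f)) = id_DeltaL (E.rhoL f)"
proof (rule E.X.add_maps_eqI[OF
      add_maps_comp[OF add_maps_comp[OF E.rhoL_add_maps semilin_add_maps[OF tensor_map_semilin[OF rhoL_id]]] L3.assoc_add_maps]
      add_maps_comp[OF E.rhoL_add_maps semilin_add_maps[OF tensor_map_semilin[OF id_DeltaL]]] _ f])
  fix n b assume b: "b \<in> carrier M"
  note rb = E.rho_closed[OF b] and ib = E.iota_closed[OF E.rho_closed[OF b]]
  have "L3.asc (rhoL_id (E.iota (\<rho> b))) = L3.asc (iota_left (rho_id (\<rho> b)))"
    by (simp add: rhoL_id_iota rb)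
  also have "\<dots> = iota_right (R3.asc (rho_id (\<rho> b)))"
    unfolding E.iota_def D.iota_def
    by (rule assoc_natural[OF R3.tensor_triple_axioms L3.tensor_triple_axioms E.lmono_funcset E.lmono_semilin
          E.lmono_semilin(2) semilin_closed[OF tensor_map_semilin[OF rho_id] rb]])
  also have "\<dots> = id_DeltaL (E.iota (\<rho> b))"
    by (simp add: coassoc b id_DeltaL_iota rb)
  finally show "L3.asc (rhoL_id (E.rhoL (lmono M n b))) = id_DeltaL (E.rhoL (lmono M n b))"
    by (simp add: E.rhoL_lmono b semilin_smult[OF tensor_map_semilin[OF rhoL_id]] ib E.X.lmono_base_one
        semilin_smult[OF tensor_map_semilin[OF id_DeltaL]] L3.assoc_smult
        semilin_closed[OF tensor_map_semilin[OF rhoL_id]])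
qed

abbreviation "incl_left \<equiv> tensor_map LB E.TL.T NL E.incl (\<lambda>x. x)"
abbreviation "incl_right \<equiv> tensor_map LB ML D.TL.T (\<lambda>x. x) D.incl"
abbreviation "rhot_id \<equiv> tensor_map P E.Tt.T Nt E.rhot (\<lambda>x. x)"
abbreviation "id_Deltat \<equiv> tensor_map P Mt D.Tt.T (\<lambda>x. x) D.rhot"

lemmas incl_M = E.X.Ct_incl[OF E.X.module_LC] and incl_N = E.Y.Ct_incl[OF E.Y.module_LC]

lemmas incl_left = t3.LM_N.tensor_pair_axioms L3.LM_N.tensor_pair_axioms E.incl_semilin incl_N E.funcset_base
lemmas incl_right = t3.L_MN.tensor_pair_axioms L3.L_MN.tensor_pair_axioms incl_M D.incl_semilin E.funcset_base
lemmas rhot_id = E.Tt.tensor_pair_axioms t3.LM_N.tensor_pair_axioms E.rhot_semilin semilin_id funcset_id'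
lemmas id_Deltat = E.Tt.tensor_pair_axioms t3.L_MN.tensor_pair_axioms semilin_id D.rhot_semilin funcset_id'

lemma incl_rhot_id:
  assumes X: "X \<in> carrier E.Tt.T" shows "incl_left (rhot_id X) = rhoL_id (E.incl X)"
  by (rule E.Tt.add_maps_eqI[OF
        add_maps_comp[OF semilin_add_maps[OF tensor_map_semilin[OF rhot_id]] semilin_add_maps[OF tensor_map_semilin[OF incl_left]]]
        add_maps_comp[OF semilin_add_maps[OF E.incl_semilin] semilin_add_maps[OF tensor_map_semilin[OF rhoL_id]]] _ X])
    (simp add: E.incl_pure tensor_map_pure[OF rhoL_id] tensor_map_pure[OF rhot_id] tensor_map_pure[OF incl_left]
      E.rhot_closed E.incl_rhot semilin_closed[OF incl_M] semilin_closed[OF incl_N])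

lemma incl_id_Deltat:
  assumes X: "X \<in> carrier E.Tt.T" shows "incl_right (id_Deltat X) = id_DeltaL (E.incl X)"
  by (rule E.Tt.add_maps_eqI[OF
        add_maps_comp[OF semilin_add_maps[OF tensor_map_semilin[OF id_Deltat]] semilin_add_maps[OF tensor_map_semilin[OF incl_right]]]
        add_maps_comp[OF semilin_add_maps[OF E.incl_semilin] semilin_add_maps[OF tensor_map_semilin[OF id_DeltaL]]] _ X])
    (simp add: E.incl_pure tensor_map_pure[OF id_DeltaL] tensor_map_pure[OF id_Deltat] tensor_map_pure[OF incl_right]
      D.rhot_closed D.incl_rhot semilin_closed[OF incl_M] semilin_closed[OF incl_N])

lemma incl_assoc:
  assumes X: "X \<in> carrier t3.LM_N.T" shows "incl_right (t3.asc X) = L3.asc (incl_left X)"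
  unfolding contraction_tensor_incl_def
  by (rule assoc_natural[symmetric, OF t3.tensor_triple_axioms L3.tensor_triple_axioms E.funcset_base incl_M incl_N incl_N X])

text \<open>The law is an equation in the bracketing opposite to the one covered by
  \<open>incl3_inj\<close>. The associators on both levels are bijective and commute with the
  inclusions, so injectivity carries over.\<close>

lemma incl_right_inj:
  assumes X: "X \<in> carrier t3.L_MN.T" and Y: "Y \<in> carrier t3.L_MN.T" and eq: "incl_right X = incl_right Y"
  shows "X = Y"
proof -
  let ?X = "t3.unasc X" and ?Y = "t3.unasc Y"
  have cl: "?X \<in> carrier t3.LM_N.T" "?Y \<in> carrier t3.LM_N.T"
    using X Y add_maps_closed[OF t3.unassoc_add_maps] by auto
  have "L3.asc (incl_left ?X) = L3.asc (incl_left ?Y)"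
    using incl_assoc[OF cl(1)] incl_assoc[OF cl(2)] eq by (simp add: t3.assoc_unassoc X Y)
  then have "incl_left ?X = incl_left ?Y"
    using L3.unassoc_assoc[OF semilin_closed[OF tensor_map_semilin[OF incl_left] cl(1)]]
      L3.unassoc_assoc[OF semilin_closed[OF tensor_map_semilin[OF incl_left] cl(2)]] by metis
  then have "?X = ?Y" by (rule inj_onD[OF incl3_inj _ cl])
  then show "X = Y" using t3.assoc_unassoc[OF X] t3.assoc_unassoc[OF Y] by metis
qed

lemma coassoct:
  assumes f: "f \<in> carrier Mt" shows "t3.asc (rhot_id (E.rhot f)) = id_Deltat (E.rhot f)"
proof (rule incl_right_inj)
  note rf = E.rhot_closed[OF f]
  note cl = semilin_closed[OF tensor_map_semilin[OF rhot_id] rf]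
  show "t3.asc (rhot_id (E.rhot f)) \<in> carrier t3.L_MN.T" by (rule add_maps_closed[OF t3.assoc_add_maps cl])
  show "id_Deltat (E.rhot f) \<in> carrier t3.L_MN.T" by (rule semilin_closed[OF tensor_map_semilin[OF id_Deltat] rf])
  have "f \<in> carrier ML" using f E.X.Ct_subset by auto
  then show "incl_right (t3.asc (rhot_id (E.rhot f))) = incl_right (id_Deltat (E.rhot f))"
    by (simp add: incl_assoc cl incl_rhot_id incl_id_Deltat rf E.incl_rhot f coassocL)
qed

end

context comod_inj
begin

text \<open>A common pattern for the left counit and both antipode laws: \<open>h\<close> is the
  operation over R, \<open>hL\<close> its base change, \<open>g\<close> its restriction to the
  contractions, and \<open>\<Phi>\<close> the expected result, compared on monomials.\<close>

lemma lift_rhot: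
  assumes H: "laurent_alg R H" and h: "balanced R M N H h" and hL: "balanced LB ML NL (laurent R H) hL"
    and hL_smult: "\<And>p x y. p \<in> carrier LB \<Longrightarrow> x \<in> carrier ML \<Longrightarrow> y \<in> carrier NL \<Longrightarrow>
      hL (p \<odot>\<^bsub>ML\<^esub> x) y = p \<odot>\<^bsub>laurent R H\<^esub> hL x y"
    and compat: "\<And>x y. x \<in> carrier M \<Longrightarrow> y \<in> carrier N \<Longrightarrow> hL (lmono M 0 x) (lmono N 0 y) = lmono H 0 (h x y)"
    and sub: "carrier Ht \<subseteq> carrier (laurent R H)" "add Ht = add (laurent R H)" "abelian_group Ht"
    and g: "\<And>x y. x \<in> carrier Mt \<Longrightarrow> y \<in> carrier Nt \<Longrightarrow> g x y = hL x y \<and> hL x y \<in> carrier Ht"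
    and \<Phi>: "\<Phi> \<in> add_maps ML (laurent R H)"
    and \<Phi>_lmono: "\<And>n b. b \<in> carrier M \<Longrightarrow> \<Phi> (lmono M n b) = lmono H n (tensor_lift H h (\<rho> b))"
    and f: "f \<in> carrier Mt"
  shows "tensor_lift Ht g (rhot f) = \<Phi> f"
proof -
  interpret H: laurent_alg R H by fact
  have "tensor_lift Ht g (rhot f) = tensor_lift H.LC hL (rhoL f)"
    using lift_incl(1)[OF H.abelian_group_L hL sub g rhot_closed[OF f]] by (simp add: incl_rhot f)
  also have "\<dots> = \<Phi> f"
  proof (rule X.add_maps_eqI[OF add_maps_comp[OF rhoL_add_maps TL.tensor_lift_add_maps[OF H.abelian_group_L hL]] \<Phi>])
    show "f \<in> carrier ML" using f X.Ct_subset by auto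
    fix n b assume b: "b \<in> carrier M"
    have "hL (lmono M 0 x) (lmono N 0 y) = lmono R 0 \<one>\<^bsub>R\<^esub> \<odot>\<^bsub>H.LC\<^esub> lmono H 0 (h x y)"
      if "x \<in> carrier M" "y \<in> carrier N" for x y
      using that T.balanced_closed[OF h that] by (simp add: compat H.lmono_smult)
    from lift_rhoL_lmono[OF H h hL hL_smult this b, of n] b
    show "tensor_lift H.LC hL (rhoL (lmono M n b)) = \<Phi> (lmono M n b)" by (simp add: \<Phi>_lmono)
  qed
  finally show ?thesis .
qed

end

section \<open>Counit and antipode on the contraction algebra\<close>

locale aug_alg = inv_alg R C \<sigma> for R :: "('k, 'm) ring_scheme" and C :: "('k, 'c, 'p) module_scheme" and \<sigma> +
  fixes \<epsilon> :: "'c \<Rightarrow> 'k"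
  assumes eps: "\<epsilon> \<in> alg_maps R C (self_alg R)" and eps_sigma: "\<And>a. a \<in> carrier C \<Longrightarrow> \<epsilon> (\<sigma> a) = \<epsilon> a"
begin

lemma eps_lin: "\<epsilon> \<in> semilin (\<lambda>r. r) R C (self_alg R)"
  and eps_mult: "a \<in> carrier C \<Longrightarrow> b \<in> carrier C \<Longrightarrow> \<epsilon> (a \<otimes>\<^bsub>C\<^esub> b) = \<epsilon> a \<otimes>\<^bsub>R\<^esub> \<epsilon> b"
  and eps_one: "\<epsilon> \<one>\<^bsub>C\<^esub> = \<one>\<^bsub>R\<^esub>"
  using eps by (auto simp: alg_maps_def lin_maps_semilin ring_hom_def)

lemma eps_closed [simp]: "a \<in> carrier C \<Longrightarrow> \<epsilon> a \<in> carrier R"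
  using semilin_closed[OF eps_lin] by simp

lemma laurent_map_base:
  assumes \<psi>: "\<psi> \<in> semilin (\<lambda>r. r) R C (self_alg R)"
  shows "laurent_map \<psi> \<in> semilin (\<lambda>r. r) LB LC LB"
    and "laurent_map \<psi> (lmono C n a) = lmono R n (\<psi> a)"
  using laurent_map_semilin(2)[OF laurent_alg_axioms LR.laurent_alg_axioms \<psi>]
    laurent_map_lmono[OF laurent_alg_axioms LR.laurent_alg_axioms \<psi>] by simp_all

lemma smult_LB: "smult LB = mult LB"
  by (simp add: laurent_def fun_eq_iff)

abbreviation "epsL \<equiv> laurent_map \<epsilon>"

lemmas epsL_lin = laurent_map_base(1)[OF eps_lin] and epsL_lmono = laurent_map_base(2)[OF eps_lin]
lemmas epsL_closed = semilin_closed[OF epsL_lin] and epsL_add = semilin_add[OF epsL_lin]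

lemma epsL_smult: "p \<in> carrier LB \<Longrightarrow> f \<in> carrier LC \<Longrightarrow> epsL (p \<odot>\<^bsub>LC\<^esub> f) = p \<otimes>\<^bsub>LB\<^esub> epsL f"
  using semilin_smult[OF epsL_lin] by (simp add: smult_LB)

lemma epsL_one: "epsL \<one>\<^bsub>LC\<^esub> = \<one>\<^bsub>LB\<^esub>"
  by (simp add: laurent_simps(4) epsL_lmono eps_one)

lemma epsL_mult: "f \<in> carrier LC \<Longrightarrow> g \<in> carrier LC \<Longrightarrow> epsL (f \<otimes>\<^bsub>LC\<^esub> g) = epsL f \<otimes>\<^bsub>LB\<^esub> epsL g"
  by (rule laurent_map_mult[OF laurent_alg_axioms LR.laurent_alg_axioms eps_lin]) (simp_all add: eps_mult)

lemma double_zero: assumes r: "r \<in> carrier R" and eq: "r = \<ominus>\<^bsub>R\<^esub> r" shows "r = \<zero>\<^bsub>R\<^esub>"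
proof -
  have "r \<oplus>\<^bsub>R\<^esub> r = \<zero>\<^bsub>R\<^esub>" using R.r_neg[OF r] eq by simp
  then have "half R \<otimes>\<^bsub>R\<^esub> r \<oplus>\<^bsub>R\<^esub> half R \<otimes>\<^bsub>R\<^esub> r = \<zero>\<^bsub>R\<^esub>" using r by (simp add: R.r_distr[symmetric])
  then show ?thesis using r by (simp add: R.l_distr[symmetric] half_two)
qed

text \<open>Invariance of \<epsilon> under \<sigma> gives \<epsilon> a = - \<epsilon> a, and 2 is a
  unit. Hence the generators s^(-1) a contribute no negative power of s, and the counit takes values
  in R[t].\<close>

lemma eps_odd: "a \<in> eig (-1) \<Longrightarrow> \<epsilon> a = \<zero>\<^bsub>R\<^esub>"
proof -
  assume a: "a \<in> eig (-1)"
  then have aC: "a \<in> carrier C" and s: "\<sigma> a = \<ominus>\<^bsub>C\<^esub> a" by (auto simp: eig_def eig_minus_def)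
  have "\<epsilon> (\<ominus>\<^bsub>C\<^esub> a) = \<ominus>\<^bsub>self_alg R\<^esub> \<epsilon> a"
    by (rule add_maps_minus[OF semilin_add_maps[OF eps_lin] M.abelian_group_axioms LR.M.abelian_group_axioms aC])
  moreover have "\<ominus>\<^bsub>self_alg R\<^esub> \<epsilon> a = \<ominus>\<^bsub>R\<^esub> \<epsilon> a"
    by (rule LR.M.minus_equality) (use aC in \<open>simp_all add: R.l_neg\<close>)
  ultimately show ?thesis using eps_sigma[OF aC] aC s by (intro double_zero) simp_all
qed

lemma P_closed:
  "p \<in> carrier P \<Longrightarrow> q \<in> carrier P \<Longrightarrow> p \<otimes>\<^bsub>LB\<^esub> q \<in> carrier P"
  "p \<in> carrier P \<Longrightarrow> q \<in> carrier P \<Longrightarrow> p \<oplus>\<^bsub>LB\<^esub> q \<in> carrier P"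
  "\<one>\<^bsub>LB\<^esub> \<in> carrier P" "\<zero>\<^bsub>LB\<^esub> \<in> carrier P" "p \<in> carrier P \<Longrightarrow> \<ominus>\<^bsub>LB\<^esub> p \<in> carrier P"
proof -
  interpret P: cring P by (rule cring_poly_t)
  show "p \<in> carrier P \<Longrightarrow> q \<in> carrier P \<Longrightarrow> p \<otimes>\<^bsub>LB\<^esub> q \<in> carrier P" using P.m_closed[of p q] by (simp only: poly_t_simps(2-))
  show "p \<in> carrier P \<Longrightarrow> q \<in> carrier P \<Longrightarrow> p \<oplus>\<^bsub>LB\<^esub> q \<in> carrier P" using P.a_closed[of p q] by (simp only: poly_t_simps(2-))
  show "\<one>\<^bsub>LB\<^esub> \<in> carrier P" using P.one_closed by (simp only: poly_t_simps(2-))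
  show "\<zero>\<^bsub>LB\<^esub> \<in> carrier P" using P.zero_closed by (simp only: poly_t_simps(2-))
  show "\<ominus>\<^bsub>LB\<^esub> p \<in> carrier P" if p: "p \<in> carrier P"
  proof -
    have "p \<in> carrier LB" using p poly_t_subset by auto
    moreover have "\<ominus>\<^bsub>P\<^esub> p \<in> carrier LB" by (rule subsetD[OF poly_t_subset P.a_inv_closed[OF p]])
    ultimately have "\<ominus>\<^bsub>LB\<^esub> p = \<ominus>\<^bsub>P\<^esub> p"
      using P.l_neg[OF p] by (intro LR.L.minus_equality) (simp_all only: poly_t_simps(2-))
    then show ?thesis using P.a_inv_closed[OF p] by simp
  qed
qed

lemma epsL_P: "f \<in> carrier Ct \<Longrightarrow> epsL f \<in> carrier P"
proof (induction f rule: Ct_gen_induct)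
  case one
  show ?case by (simp only: epsL_one P_closed)
next
  case (scalar p)
  then have "p \<in> carrier LB" "\<one>\<^bsub>LC\<^esub> \<in> carrier LC" using poly_t_subset Ct_closed(4) Ct_subset by auto
  then show ?case using scalar P_closed(1,3) by (simp add: epsL_smult epsL_one)
next
  case (even a)
  then have "a \<in> carrier C" using eig_subset by auto
  then show ?case by (simp add: epsL_lmono lmono_poly_t)
next
  case (odd a)
  then show ?case using P_closed(4) LR.lmono_zero[of "-1"] by (simp add: epsL_lmono eps_odd)
next
  case (minus f)
  then have "f \<in> carrier LC" using Ct_subset by auto
  then show ?case
    using minus P_closed(5) by (simp add: add_maps_minus[OF semilin_add_maps[OF epsL_lin] L.abelian_group_axioms LR.L.abelian_group_axioms])
next
  case (add f g)
  then have "f \<in> carrier LC" "g \<in> carrier LC" using Ct_subset by auto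
  then show ?case using add P_closed(2) by (simp add: epsL_add)
next
  case (mult f g)
  then have "f \<in> carrier LC" "g \<in> carrier LC" using Ct_subset by auto
  then show ?case using mult P_closed(1) by (simp add: epsL_mult)
qed

lemma epsL_alg_maps: "epsL \<in> alg_maps P Ct (self_alg P)"
proof -
  have sub: "f \<in> carrier LC" if "f \<in> carrier Ct" for f using that Ct_subset by auto
  have subP: "p \<in> carrier LB" if "p \<in> carrier P" for p using that poly_t_subset by auto
  have "epsL \<in> ring_hom Ct (self_alg P)"
    by (rule ring_hom_memI)
      (simp_all add: epsL_P sub contraction_simps(2-) poly_t_simps(2-) epsL_mult epsL_add epsL_one)
  moreover have "epsL \<in> semilin (\<lambda>r. r) P Ct (self_alg P)"
    by (intro semilinI add_mapsI)
      (simp_all add: epsL_P sub subP contraction_simps(2-) poly_t_simps(2-) epsL_smult epsL_add)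
  ultimately show ?thesis by (simp add: alg_maps_def lin_maps_semilin)
qed

end

context inv_alg
begin

text \<open>A map commuting with \<sigma> preserves both eigenspaces, hence the generators of the
  contraction. Applied to the antipode.\<close>

lemma laurent_map_contraction:
  assumes S: "S \<in> alg_maps R C C" and S_sigma: "\<And>a. a \<in> carrier C \<Longrightarrow> S (\<sigma> a) = \<sigma> (S a)"
  shows "laurent_map S \<in> alg_maps P Ct Ct"
proof -
  have lin: "S \<in> semilin (\<lambda>r. r) R C C" and Sm: "\<And>a b. a \<in> carrier C \<Longrightarrow> b \<in> carrier C \<Longrightarrow> S (a \<otimes>\<^bsub>C\<^esub> b) = S a \<otimes>\<^bsub>C\<^esub> S b"
    and S1: "S \<one>\<^bsub>C\<^esub> = \<one>\<^bsub>C\<^esub>"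
    using S by (auto simp: alg_maps_def lin_maps_semilin ring_hom_def)
  note l = laurent_map_semilin(2)[OF laurent_alg_axioms laurent_alg_axioms lin]
    and lm = laurent_map_lmono[OF laurent_alg_axioms laurent_alg_axioms lin]
    and mu = laurent_map_mult[OF laurent_alg_axioms laurent_alg_axioms lin Sm]
  have one: "laurent_map S \<one>\<^bsub>LC\<^esub> = \<one>\<^bsub>LC\<^esub>" by (simp add: laurent_simps(4) lm S1)
  have sub: "f \<in> carrier LC" if "f \<in> carrier Ct" for f using that Ct_subset by auto
  have subP: "p \<in> carrier LB" if "p \<in> carrier P" for p using that poly_t_subset by auto
  have eig: "S a \<in> eig n" if "a \<in> eig n" for a n
    using that S_sigma[of a] semilin_closed[OF lin, of a]
      add_maps_minus[OF semilin_add_maps[OF lin] M.abelian_group_axioms M.abelian_group_axioms, of a]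
    by (auto simp: eig_def eig_plus_def eig_minus_def split: if_splits)
  have cl: "laurent_map S f \<in> carrier Ct" if "f \<in> carrier Ct" for f
    using that
  proof (induction f rule: Ct_gen_induct)
    case one
    then show ?case using Ct_closed(4) by (simp add: \<open>laurent_map S \<one>\<^bsub>LC\<^esub> = \<one>\<^bsub>LC\<^esub>\<close>)
  next
    case (scalar p)
    then show ?case using semilin_smult[OF l subP[OF scalar] sub[OF Ct_closed(4)]] Ct_smult[OF scalar Ct_closed(4)]
      by (simp add: \<open>laurent_map S \<one>\<^bsub>LC\<^esub> = \<one>\<^bsub>LC\<^esub>\<close>)
  next
    case (minus f)
    then show ?case
      using subringE(5)[OF subring_Ct]
      by (simp add: add_maps_minus[OF semilin_add_maps[OF l] L.abelian_group_axioms L.abelian_group_axioms] sub)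
  qed (simp_all add: lm Ct_gens eig Ct_closed semilin_add[OF l] sub mu)
  have "laurent_map S \<in> ring_hom Ct Ct"
    by (rule ring_hom_memI) (simp_all add: cl sub contraction_simps(2-) mu semilin_add[OF l] one)
  moreover have "laurent_map S \<in> semilin (\<lambda>r. r) P Ct Ct"
    by (intro semilinI add_mapsI) (simp_all add: cl sub subP contraction_simps(2-) semilin_add[OF l] semilin_smult[OF l])
  ultimately show ?thesis by (simp add: alg_maps_def lin_maps_semilin)
qed

end

section \<open>Restricting Hopf algebra structures\<close>

text \<open>Coassociativity and multiplicativity are already available. The counit law is the
  pairing with the functional \<epsilon> with exponent 0, so the computation for the differential
  action proves it too.\<close>

lemma coaction_contraction:
  assumes "coassoc_comod R M \<mu> N \<nu> \<rho> \<Delta>" and "aug_alg R N \<nu> \<epsilon>"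
    and counit: "\<And>b. b \<in> carrier M \<Longrightarrow> tensor_lift M (\<lambda>y a. \<epsilon> a \<odot>\<^bsub>M\<^esub> y) (\<rho> b) = b"
  shows "coaction (poly_t R) (contraction R N \<nu>) (contraction_comap R N N \<nu> N \<nu> \<Delta>) (laurent_map \<epsilon>)
    (contraction R M \<mu>) (contraction_comap R M M \<mu> N \<nu> \<rho>)"
proof -
  interpret coassoc_comod R M \<mu> N \<nu> \<rho> \<Delta> by fact
  interpret aug: aug_alg R N \<nu> \<epsilon> by fact
  have "tensor_lift Mt (\<lambda>y a. laurent_map \<epsilon> a \<odot>\<^bsub>Mt\<^esub> y) (E.rhot f) = f" if f: "f \<in> carrier Mt" for f
  proof -
    have "laurent_map \<epsilon> a = lmono R 0 \<one>\<^bsub>R\<^esub> \<otimes>\<^bsub>LB\<^esub> laurent_map \<epsilon> a \<and> laurent_map \<epsilon> a \<in> carrier P" if a: "a \<in> carrier Nt" for a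
    proof -
      have "laurent_map \<epsilon> a \<in> carrier LB" using aug.epsL_P[OF a] poly_t_subset by auto
      then show ?thesis using E.X.LR.L_one[of "laurent_map \<epsilon> a"] aug.epsL_P[OF a] by (simp add: laurent_simps(4))
    qed
    then have "tensor_lift Mt (\<lambda>y a. laurent_map \<epsilon> a \<odot>\<^bsub>Mt\<^esub> y) (E.rhot f) =
      tensor_lift ML (\<lambda>y a. (lmono R 0 \<one>\<^bsub>R\<^esub> \<otimes>\<^bsub>LB\<^esub> laurent_map \<epsilon> a) \<odot>\<^bsub>ML\<^esub> y) (E.rhoL f)"
      by (rule E.diff_rhot[OF aug.eps_lin f])
    also have "\<dots> = f"
    proof (rule E.X.add_maps_eqI[OF add_maps_comp[OF E.rhoL_add_maps
            E.TL.tensor_lift_add_maps[OF E.X.abelian_group_L E.balanced_diffL[OF aug.eps_lin]]] add_maps_id])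
      show "f \<in> carrier ML" using f E.X.Ct_subset by auto
      fix n b assume b: "b \<in> carrier M"
      show "tensor_lift ML (\<lambda>y a. (lmono R 0 \<one>\<^bsub>R\<^esub> \<otimes>\<^bsub>LB\<^esub> laurent_map \<epsilon> a) \<odot>\<^bsub>ML\<^esub> y) (E.rhoL (lmono M n b)) = lmono M n b"
        using E.lift_diffL[OF aug.eps_lin b, of 0 n] counit[OF b] by (simp add: diff_action_def)
    qed
    finally show ?thesis .
  qed
  then show ?thesis
    unfolding coaction_def using E.X.algebra_Ct E.rhot_alg_maps coassoct by auto
qed

lemma hopf_contraction:
  assumes hopf: "hopf_algebra R A \<Delta> \<epsilon> S" and "aug_alg R A \<theta> \<epsilon>" and "coassoc_comod R A \<theta> A \<theta> \<Delta> \<Delta>"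
    and S_theta: "\<And>a. a \<in> carrier A \<Longrightarrow> S (\<theta> a) = \<theta> (S a)"
  shows "hopf_algebra (poly_t R) (contraction R A \<theta>) (contraction_comap R A A \<theta> A \<theta> \<Delta>) (laurent_map \<epsilon>) (laurent_map S)"
proof -
  interpret aug: aug_alg R A \<theta> \<epsilon> by fact
  interpret co: coassoc_comod R A \<theta> A \<theta> \<Delta> \<Delta> by fact
  let ?P = "poly_t R" and ?At = "contraction R A \<theta>" and ?AL = "laurent R A" and ?LB = "laurent_base R"
  have S: "S \<in> alg_maps R A A" using hopf by (simp add: hopf_algebra_def)
  then have S_lin: "S \<in> semilin (\<lambda>r. r) R A A" by (auto simp: alg_maps_def lin_maps_semilin)
  note SL = laurent_map_semilin(2)[OF aug.laurent_alg_axioms aug.laurent_alg_axioms S_lin]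
    and SL_lmono = laurent_map_lmono[OF aug.laurent_alg_axioms aug.laurent_alg_axioms S_lin]
  have St: "laurent_map S \<in> alg_maps ?P ?At ?At" by (rule aug.laurent_map_contraction[OF S S_theta])
  then have St_closed: "laurent_map S f \<in> carrier ?At" if "f \<in> carrier ?At" for f
    using that by (auto simp: alg_maps_def ring_hom_def)
  \<comment> \<open>The comultiplication is a coaction of the algebra on itself; this disposes of
    coassociativity and of one counit law. The other counit law and the antipode laws follow by
    \<open>lift_rhot\<close>.\<close>
  have coact: "coaction ?P ?At co.E.rhot (laurent_map \<epsilon>) ?At co.E.rhot"
    by (rule coaction_contraction[OF assms(3,2)]) (use hopf in \<open>auto simp: hopf_algebra_def\<close>)
  note sub = aug.Ct_subset aug.contraction_simps(2) co.E.abelian_group_Mt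
  note distr = aug.smult_l_distr aug.smult_r_distr aug.LA.smult_l_distr aug.LA.smult_r_distr aug.L_distr aug.l_distr aug.r_distr
  note lins = semilin_add[OF SL] semilin_add[OF S_lin] aug.epsL_add semilin_add[OF aug.eps_lin, simplified]
    semilin_smult[OF S_lin] semilin_smult[OF SL] semilin_smult[OF aug.eps_lin, simplified] aug.epsL_smult
  note cls = semilin_closed[OF SL] semilin_closed[OF S_lin] aug.epsL_closed aug.eps_closed aug.L_mult_closed aug.L_smult_closed
  have oneL: "\<one>\<^bsub>?AL\<^esub> \<in> carrier ?AL" using aug.Ct_closed(4) aug.Ct_subset by auto
  have left: "tensor_lift ?At (\<lambda>x y. laurent_map \<epsilon> x \<odot>\<^bsub>?At\<^esub> y) (co.E.rhot f) = f" if f: "f \<in> carrier ?At" for f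
  proof (rule co.E.lift_rhot[OF aug.laurent_alg_axioms _ _ _ _ sub _ add_maps_id _ f,
        where h = "\<lambda>x y. \<epsilon> x \<odot>\<^bsub>A\<^esub> y" and hL = "\<lambda>x y. laurent_map \<epsilon> x \<odot>\<^bsub>?AL\<^esub> y"])
    show "balanced R A A A (\<lambda>x y. \<epsilon> x \<odot>\<^bsub>A\<^esub> y)"
      by (intro balancedI add_mapsI) (simp_all add: lins cls distr aug.smult_assoc1[symmetric] aug.R.m_comm)
    show "balanced ?LB ?AL ?AL ?AL (\<lambda>x y. laurent_map \<epsilon> x \<odot>\<^bsub>?AL\<^esub> y)"
      by (intro balancedI add_mapsI) (simp_all add: lins cls distr aug.LA.smult_assoc1[symmetric] aug.LR.L_comm)
  qed (use hopf in \<open>simp_all add: lins cls aug.LA.smult_assoc1 aug.epsL_lmono aug.lmono_smult aug.Ct_smult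
      aug.epsL_P aug.contraction_simps(4) hopf_algebra_def\<close>)
  \<comment> \<open>The common right-hand side of both antipode laws, as an additive map on the
    whole Laurent algebra, so that it can play the part of \<open>\<Phi>\<close>.\<close>
  let ?e = "\<lambda>f. laurent_map \<epsilon> f \<odot>\<^bsub>?AL\<^esub> \<one>\<^bsub>?AL\<^esub>"
  have e: "?e \<in> add_maps ?AL ?AL"
    by (rule add_mapsI) (simp_all add: cls oneL lins distr)
  have e_lmono: "?e (lmono A n b) = lmono A n (\<epsilon> b \<odot>\<^bsub>A\<^esub> \<one>\<^bsub>A\<^esub>)" if "b \<in> carrier A" for n b
    using that by (simp add: aug.epsL_lmono laurent_simps(4) aug.lmono_smult)
  have antl: "tensor_lift ?At (\<lambda>x y. laurent_map S x \<otimes>\<^bsub>?At\<^esub> y) (co.E.rhot f) = ?e f" if f: "f \<in> carrier ?At" for f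
  proof (rule co.E.lift_rhot[OF aug.laurent_alg_axioms _ _ _ _ sub _ e _ f,
        where h = "\<lambda>x y. S x \<otimes>\<^bsub>A\<^esub> y" and hL = "\<lambda>x y. laurent_map S x \<otimes>\<^bsub>?AL\<^esub> y"])
    show "balanced R A A A (\<lambda>x y. S x \<otimes>\<^bsub>A\<^esub> y)"
      by (intro balancedI add_mapsI) (simp_all add: lins cls distr aug.smult_assoc2 aug.smult_mult_r)
    show "balanced ?LB ?AL ?AL ?AL (\<lambda>x y. laurent_map S x \<otimes>\<^bsub>?AL\<^esub> y)"
      by (intro balancedI add_mapsI) (simp_all add: lins cls distr aug.LA.smult_assoc2 aug.LA.smult_mult_r)
  qed (use hopf in \<open>simp_all add: lins cls aug.LA.smult_assoc2 SL_lmono aug.lmono_mult aug.Ct_closed(2) St_closed e_lmono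
      aug.contraction_simps(3) hopf_algebra_def\<close>)
  have antr: "tensor_lift ?At (\<lambda>x y. x \<otimes>\<^bsub>?At\<^esub> laurent_map S y) (co.E.rhot f) = ?e f" if f: "f \<in> carrier ?At" for f
  proof (rule co.E.lift_rhot[OF aug.laurent_alg_axioms _ _ _ _ sub _ e _ f,
        where h = "\<lambda>x y. x \<otimes>\<^bsub>A\<^esub> S y" and hL = "\<lambda>x y. x \<otimes>\<^bsub>?AL\<^esub> laurent_map S y"])
    show "balanced R A A A (\<lambda>x y. x \<otimes>\<^bsub>A\<^esub> S y)"
      by (intro balancedI add_mapsI) (simp_all add: lins cls distr aug.smult_assoc2 aug.smult_mult_r)
    show "balanced ?LB ?AL ?AL ?AL (\<lambda>x y. x \<otimes>\<^bsub>?AL\<^esub> laurent_map S y)"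
      by (intro balancedI add_mapsI) (simp_all add: lins cls distr aug.LA.smult_assoc2 aug.LA.smult_mult_r)
  qed (use hopf in \<open>simp_all add: lins cls aug.LA.smult_assoc2 SL_lmono aug.lmono_mult aug.Ct_closed(2) St_closed e_lmono
      aug.contraction_simps(3) hopf_algebra_def\<close>)
  show ?thesis
    unfolding hopf_algebra_def
    using coact left antl antr St aug.epsL_alg_maps
    by (auto simp: coaction_def aug.contraction_simps(4,6))
qed

section \<open>Derivations\<close>

lemma der_simps:
  "carrier (der R A \<epsilon>) = {x \<in> semilin (\<lambda>r. r) R A (self_alg R) \<inter> extensional (carrier A).
       \<forall>a\<in>carrier A. \<forall>b\<in>carrier A. x (a \<otimes>\<^bsub>A\<^esub> b) = \<epsilon> a \<otimes>\<^bsub>R\<^esub> x b \<oplus>\<^bsub>R\<^esub> \<epsilon> b \<otimes>\<^bsub>R\<^esub> x a}"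
  "\<zero>\<^bsub>der R A \<epsilon>\<^esub> = (\<lambda>a\<in>carrier A. \<zero>\<^bsub>R\<^esub>)"
  "x \<oplus>\<^bsub>der R A \<epsilon>\<^esub> y = (\<lambda>a\<in>carrier A. x a \<oplus>\<^bsub>R\<^esub> y a)"
  "r \<odot>\<^bsub>der R A \<epsilon>\<^esub> x = (\<lambda>a\<in>carrier A. r \<otimes>\<^bsub>R\<^esub> x a)"
  by (simp_all add: der_def lin_maps_semilin)

lemma der_semilin: "x \<in> carrier (der R A \<epsilon>) \<Longrightarrow> x \<in> semilin (\<lambda>r. r) R A (self_alg R)"
  by (simp add: der_simps)

lemma der_closed: "x \<in> carrier (der R A \<epsilon>) \<Longrightarrow> a \<in> carrier A \<Longrightarrow> x a \<in> carrier R"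
  using semilin_closed[OF der_semilin] by fastforce

lemma der_add: "x \<in> carrier (der R A \<epsilon>) \<Longrightarrow> a \<in> carrier A \<Longrightarrow> b \<in> carrier A \<Longrightarrow> x (a \<oplus>\<^bsub>A\<^esub> b) = x a \<oplus>\<^bsub>R\<^esub> x b"
  using semilin_add[OF der_semilin] by fastforce

lemma der_smult: "x \<in> carrier (der R A \<epsilon>) \<Longrightarrow> r \<in> carrier R \<Longrightarrow> a \<in> carrier A \<Longrightarrow> x (r \<odot>\<^bsub>A\<^esub> a) = r \<otimes>\<^bsub>R\<^esub> x a"
  using semilin_smult[OF der_semilin] by fastforce

lemma der_mult: "x \<in> carrier (der R A \<epsilon>) \<Longrightarrow> a \<in> carrier A \<Longrightarrow> b \<in> carrier A \<Longrightarrow>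
    x (a \<otimes>\<^bsub>A\<^esub> b) = \<epsilon> a \<otimes>\<^bsub>R\<^esub> x b \<oplus>\<^bsub>R\<^esub> \<epsilon> b \<otimes>\<^bsub>R\<^esub> x a"
  by (simp add: der_simps)

lemma derI:
  assumes "x \<in> extensional (carrier A)" "\<And>a. a \<in> carrier A \<Longrightarrow> x a \<in> carrier R"
    and "\<And>a b. a \<in> carrier A \<Longrightarrow> b \<in> carrier A \<Longrightarrow> x (a \<oplus>\<^bsub>A\<^esub> b) = x a \<oplus>\<^bsub>R\<^esub> x b"
    and "\<And>r a. r \<in> carrier R \<Longrightarrow> a \<in> carrier A \<Longrightarrow> x (r \<odot>\<^bsub>A\<^esub> a) = r \<otimes>\<^bsub>R\<^esub> x a"
    and "\<And>a b. a \<in> carrier A \<Longrightarrow> b \<in> carrier A \<Longrightarrow> x (a \<otimes>\<^bsub>A\<^esub> b) = \<epsilon> a \<otimes>\<^bsub>R\<^esub> x b \<oplus>\<^bsub>R\<^esub> \<epsilon> b \<otimes>\<^bsub>R\<^esub> x a"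
  shows "x \<in> carrier (der R A \<epsilon>)"
  using assms by (auto simp: der_simps intro!: semilinI add_mapsI)

lemma module_der:
  assumes "algebra R A" and eps: "\<And>a. a \<in> carrier A \<Longrightarrow> \<epsilon> a \<in> carrier R"
  shows "module R (der R A \<epsilon>)"
proof -
  interpret A: algebra R A by fact
  have smult: "r \<odot>\<^bsub>der R A \<epsilon>\<^esub> x \<in> carrier (der R A \<epsilon>)" if "r \<in> carrier R" "x \<in> carrier (der R A \<epsilon>)" for r x
    using that by (intro derI)
      (simp_all add: der_simps(4) der_closed der_add der_smult der_mult eps A.R.r_distr A.R.m_ac A.m_closed A.a_closed)
  have ext: "x = y" if "x \<in> carrier (der R A \<epsilon>)" "y \<in> carrier (der R A \<epsilon>)" "\<And>a. a \<in> carrier A \<Longrightarrow> x a = y a" for x y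
    using that by (auto simp: der_simps intro: extensionalityI)
  show ?thesis
  proof (rule moduleI)
    show "cring R" by (rule A.R.is_cring)
    show "abelian_group (der R A \<epsilon>)"
    proof (rule abelian_groupI)
      fix x y assume xy: "x \<in> carrier (der R A \<epsilon>)" "y \<in> carrier (der R A \<epsilon>)"
      then show "x \<oplus>\<^bsub>der R A \<epsilon>\<^esub> y \<in> carrier (der R A \<epsilon>)"
        by (intro derI)
          (simp_all add: der_simps(3) der_closed der_add der_smult der_mult eps A.R.r_distr A.R.a_ac A.m_closed A.a_closed)
      show "x \<oplus>\<^bsub>der R A \<epsilon>\<^esub> y = y \<oplus>\<^bsub>der R A \<epsilon>\<^esub> x"
        using xy by (auto simp: der_simps(3) der_closed A.R.a_comm intro!: restrict_ext)
    next
      fix x y z assume "x \<in> carrier (der R A \<epsilon>)" "y \<in> carrier (der R A \<epsilon>)" "z \<in> carrier (der R A \<epsilon>)"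
      then show "x \<oplus>\<^bsub>der R A \<epsilon>\<^esub> y \<oplus>\<^bsub>der R A \<epsilon>\<^esub> z = x \<oplus>\<^bsub>der R A \<epsilon>\<^esub> (y \<oplus>\<^bsub>der R A \<epsilon>\<^esub> z)"
        by (auto simp: der_simps(3) der_closed A.R.a_assoc intro!: restrict_ext)
    next
      show "\<zero>\<^bsub>der R A \<epsilon>\<^esub> \<in> carrier (der R A \<epsilon>)"
        by (intro derI) (simp_all add: der_simps(2) eps A.m_closed A.a_closed)
    next
      fix x assume x: "x \<in> carrier (der R A \<epsilon>)"
      show "\<zero>\<^bsub>der R A \<epsilon>\<^esub> \<oplus>\<^bsub>der R A \<epsilon>\<^esub> x = x"
        using x by (intro extensionalityI[of _ "carrier A"]) (auto simp: der_simps(1-3) dest: der_closed[OF x])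
      \<comment> \<open>The negative is obtained as the multiple by -1, since closure under scalars
        is already established.\<close>
      show "\<exists>y\<in>carrier (der R A \<epsilon>). y \<oplus>\<^bsub>der R A \<epsilon>\<^esub> x = \<zero>\<^bsub>der R A \<epsilon>\<^esub>"
        by (rule bexI[OF _ smult[OF A.R.a_inv_closed[OF A.R.one_closed] x]])
          (auto simp: der_simps(2-4) der_closed[OF x] A.R.l_minus A.R.l_neg intro!: restrict_ext)
    qed
  next
    fix x assume x: "x \<in> carrier (der R A \<epsilon>)"
    show "\<one>\<^bsub>R\<^esub> \<odot>\<^bsub>der R A \<epsilon>\<^esub> x = x"
      by (rule ext[OF smult[OF A.R.one_closed x] x]) (simp add: der_simps(4) der_closed[OF x])
  qed (auto simp: smult, auto simp: der_simps(3,4) der_closed A.R.l_distr A.R.r_distr A.R.m_assoc intro!: restrict_ext)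
qed

context aug_alg
begin

abbreviation "\<gg> \<equiv> der R C \<epsilon>"
abbreviation "\<gg>t \<equiv> der P Ct epsL"

definition "der_even x a = half R \<otimes>\<^bsub>R\<^esub> (x a \<oplus>\<^bsub>R\<^esub> x (\<sigma> a))"
definition "der_odd x a = half R \<otimes>\<^bsub>R\<^esub> (x a \<ominus>\<^bsub>R\<^esub> x (\<sigma> a))"

text \<open>The formula of \<open>der_contraction\<close> on the whole Laurent algebra, where
  linearity and the Leibniz rule can be checked on monomials before restricting.\<close>

definition "derL x f = laurent_map (der_even x) f \<oplus>\<^bsub>LB\<^esub> lmono R 1 \<one>\<^bsub>R\<^esub> \<otimes>\<^bsub>LB\<^esub> laurent_map (der_odd x) f"

lemma der_contraction_derL: "der_contraction R C \<sigma> x = (\<lambda>f\<in>carrier Ct. derL x f)"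
  by (simp add: der_contraction_def derL_def der_even_def[abs_def] der_odd_def[abs_def])

context
  fixes x assumes x: "x \<in> carrier \<gg>"
begin

lemma der_parts_semilin:
  "der_even x \<in> semilin (\<lambda>r. r) R C (self_alg R)" "der_odd x \<in> semilin (\<lambda>r. r) R C (self_alg R)"
  by (auto intro!: semilinI add_mapsI simp: der_even_def der_odd_def der_closed[OF x] der_add[OF x] der_smult[OF x]
      sigma_add sigma_smult R.minus_eq R.minus_add R.r_distr R.r_minus R.a_ac R.m_ac)

lemma der_parts_closed: "a \<in> carrier C \<Longrightarrow> der_even x a \<in> carrier R" "a \<in> carrier C \<Longrightarrow> der_odd x a \<in> carrier R"
  by (simp_all add: der_even_def der_odd_def der_closed[OF x])

text \<open>As \<epsilon> is invariant, the composite of x with \<sigma> is again a derivation along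
  \<epsilon>, and so are the two halves.\<close>

lemma der_parts_mult:
  assumes ab: "a \<in> carrier C" "b \<in> carrier C"
  shows "der_even x (a \<otimes>\<^bsub>C\<^esub> b) = \<epsilon> a \<otimes>\<^bsub>R\<^esub> der_even x b \<oplus>\<^bsub>R\<^esub> \<epsilon> b \<otimes>\<^bsub>R\<^esub> der_even x a"
    and "der_odd x (a \<otimes>\<^bsub>C\<^esub> b) = \<epsilon> a \<otimes>\<^bsub>R\<^esub> der_odd x b \<oplus>\<^bsub>R\<^esub> \<epsilon> b \<otimes>\<^bsub>R\<^esub> der_odd x a"
  using ab by (simp_all add: der_even_def der_odd_def der_mult[OF x] der_closed[OF x] sigma_ring_hom eps_sigma
      R.minus_eq R.minus_add R.r_distr R.r_minus R.a_ac R.m_ac)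

text \<open>The half of x carrying the factor s sees only the -1 eigenspace, the other half only the
  +1 eigenspace. On generators s^(-1) a the two powers of s cancel, so the values lie in
  R[t].\<close>

lemma der_parts_eig:
  "a \<in> eig 0 \<Longrightarrow> der_even x a = x a" "a \<in> eig 0 \<Longrightarrow> der_odd x a = \<zero>\<^bsub>R\<^esub>"
  "a \<in> eig (-1) \<Longrightarrow> der_even x a = \<zero>\<^bsub>R\<^esub>" "a \<in> eig (-1) \<Longrightarrow> der_odd x a = x a"
proof -
  have h: "half R \<otimes>\<^bsub>R\<^esub> (r \<oplus>\<^bsub>R\<^esub> r) = r" if "r \<in> carrier R" for r
    using that by (simp add: R.r_distr R.l_distr[symmetric] half_two)
  have m: "x (\<ominus>\<^bsub>C\<^esub> a) = \<ominus>\<^bsub>R\<^esub> x a" if "a \<in> carrier C" for a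
  proof -
    have "x (\<ominus>\<^bsub>C\<^esub> a) \<oplus>\<^bsub>R\<^esub> x a = x \<zero>\<^bsub>C\<^esub>" using that der_add[OF x, of "\<ominus>\<^bsub>C\<^esub> a" a] by (simp add: M.l_neg)
    also have "\<dots> = \<zero>\<^bsub>R\<^esub>" using der_smult[OF x, of "\<zero>\<^bsub>R\<^esub>" "\<zero>\<^bsub>C\<^esub>"] der_closed[OF x] by simp
    finally show ?thesis using that by (intro R.minus_equality[symmetric]) (simp_all add: der_closed[OF x])
  qed
  show "a \<in> eig 0 \<Longrightarrow> der_even x a = x a" "a \<in> eig 0 \<Longrightarrow> der_odd x a = \<zero>\<^bsub>R\<^esub>"
    "a \<in> eig (-1) \<Longrightarrow> der_even x a = \<zero>\<^bsub>R\<^esub>" "a \<in> eig (-1) \<Longrightarrow> der_odd x a = x a"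
    by (auto simp: der_even_def der_odd_def eig_def eig_plus_def eig_minus_def m h der_closed[OF x] R.minus_eq R.r_neg)
qed

lemma derL_lmono: "a \<in> carrier C \<Longrightarrow> derL x (lmono C n a) = lmono R n (der_even x a) \<oplus>\<^bsub>LB\<^esub> lmono R (n + 1) (der_odd x a)"
  by (simp add: derL_def laurent_map_base(2) der_parts_semilin lmono_base_mult der_parts_closed add.commute)

lemma derL_semilin: "derL x \<in> semilin (\<lambda>r. r) LB LC LB"
proof -
  note l = laurent_map_base(1)[OF der_parts_semilin(1)] laurent_map_base(1)[OF der_parts_semilin(2)]
  have e: "p \<otimes>\<^bsub>LB\<^esub> (lmono R 1 \<one>\<^bsub>R\<^esub> \<otimes>\<^bsub>LB\<^esub> q) = lmono R 1 \<one>\<^bsub>R\<^esub> \<otimes>\<^bsub>LB\<^esub> (p \<otimes>\<^bsub>LB\<^esub> q)"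
    if "p \<in> carrier LB" "q \<in> carrier LB" for p q
    using that LR.L_comm[OF that(1) lmono_base_one[of 1]] by (simp add: LR.L_assoc[symmetric] lmono_base_one)
  show ?thesis
    unfolding derL_def
    by (intro semilinI add_mapsI)
      (simp_all add: semilin_closed[OF l(1)] semilin_closed[OF l(2)] semilin_add[OF l(1)] semilin_add[OF l(2)]
        semilin_smult[OF l(1)] semilin_smult[OF l(2)] smult_LB LR.L_mult_closed lmono_base_one LR.L_distr LR.L.a_ac e)
qed

lemmas derL_closed = semilin_closed[OF derL_semilin] and derL_add = semilin_add[OF derL_semilin]

lemma derL_smult: "p \<in> carrier LB \<Longrightarrow> f \<in> carrier LC \<Longrightarrow> derL x (p \<odot>\<^bsub>LC\<^esub> f) = p \<otimes>\<^bsub>LB\<^esub> derL x f"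
  using semilin_smult[OF derL_semilin] by (simp add: smult_LB)

lemma derL_mult:
  assumes f: "f \<in> carrier LC" and g: "g \<in> carrier LC"
  shows "derL x (f \<otimes>\<^bsub>LC\<^esub> g) = epsL f \<otimes>\<^bsub>LB\<^esub> derL x g \<oplus>\<^bsub>LB\<^esub> epsL g \<otimes>\<^bsub>LB\<^esub> derL x f"
  using f
proof (induction f rule: L_induct)
  case (mono m a)
  note a = this
  show ?case using g
  proof (induction g rule: L_induct)
    case (mono n b)
    note ab = a mono
    have s: "lmono R k (r \<oplus>\<^bsub>R\<^esub> r') = lmono R k r \<oplus>\<^bsub>LB\<^esub> lmono R k r'" if "r \<in> carrier R" "r' \<in> carrier R" for k r r'
      using add_maps_add[OF LR.lmono_add_maps] that by simp
    show ?case using ab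
      by (simp add: lmono_mult derL_lmono epsL_lmono der_parts_mult der_parts_closed s LR.L_distr lmono_base_closed
          lmono_base_mult LR.L.a_ac add.commute add.left_commute)
  next
    case (add g h)
    then show ?case using a
      by (simp add: L_distr LR.L_distr derL_add derL_closed epsL_closed epsL_add L_mult_closed LR.L_mult_closed lmono_closed LR.L.a_ac)
  qed
next
  case (add f h)
  then show ?case using g
    by (simp add: L_distr LR.L_distr derL_add derL_closed epsL_closed epsL_add L_mult_closed LR.L_mult_closed LR.L.a_ac)
qed

text \<open>The Leibniz rule for 1 = 1 times 1 gives d + d = d for the value d.\<close>

lemma derL_one: "derL x \<one>\<^bsub>LC\<^esub> = \<zero>\<^bsub>LB\<^esub>"
proof -
  have "\<one>\<^bsub>LC\<^esub> \<in> carrier LC" using Ct_closed(4) Ct_subset by auto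
  then have d: "derL x \<one>\<^bsub>LC\<^esub> \<in> carrier LB" and "derL x \<one>\<^bsub>LC\<^esub> \<oplus>\<^bsub>LB\<^esub> derL x \<one>\<^bsub>LC\<^esub> = derL x \<one>\<^bsub>LC\<^esub>"
    using derL_mult[of "\<one>\<^bsub>LC\<^esub>" "\<one>\<^bsub>LC\<^esub>"] LR.L_one[of "derL x \<one>\<^bsub>LC\<^esub>"] by (simp_all add: derL_closed L_one epsL_one)
  then show ?thesis using LR.L.add.l_cancel_one by blast
qed

lemma derL_P: "f \<in> carrier Ct \<Longrightarrow> derL x f \<in> carrier P"
proof (induction f rule: Ct_gen_induct)
  case one
  show ?case using P_closed(4) by (simp add: derL_one)
next
  case (scalar p)
  then have "p \<in> carrier LB" "\<one>\<^bsub>LC\<^esub> \<in> carrier LC" using poly_t_subset Ct_closed(4) Ct_subset by auto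
  then show ?case using P_closed(1)[OF scalar P_closed(4)] by (simp add: derL_smult derL_one)
next
  case (even a)
  then have "a \<in> carrier C" using eig_subset by auto
  then show ?case using even LR.lmono_zero[of 1] der_parts_closed(1)[of a]
    by (simp add: derL_lmono der_parts_eig lmono_poly_t der_closed[OF x] lmono_base_closed)
next
  case (odd a)
  then have "a \<in> carrier C" using eig_subset by auto
  then show ?case using odd LR.lmono_zero[of "-1"]
    by (simp add: derL_lmono der_parts_eig lmono_poly_t der_closed[OF x] lmono_base_closed)
next
  case (minus f)
  then have "f \<in> carrier LC" using Ct_subset by auto
  then show ?case
    using minus P_closed(5) by (simp add: add_maps_minus[OF semilin_add_maps[OF derL_semilin] L.abelian_group_axioms LR.L.abelian_group_axioms])
next
  case (add f g)
  then have "f \<in> carrier LC" "g \<in> carrier LC" using Ct_subset by auto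
  then show ?case using add P_closed(2) by (simp add: derL_add)
next
  case (mult f g)
  then have "f \<in> carrier LC" "g \<in> carrier LC" using Ct_subset by auto
  then show ?case using mult P_closed(1,2) epsL_P by (simp add: derL_mult)
qed

lemma der_contraction_closed: "der_contraction R C \<sigma> x \<in> carrier \<gg>t"
proof (rule derI)
  have sub: "f \<in> carrier LC" if "f \<in> carrier Ct" for f using that Ct_subset by auto
  have subP: "p \<in> carrier LB" if "p \<in> carrier P" for p using that poly_t_subset by auto
  note [simp] = der_contraction_derL contraction_simps(2-4) poly_t_simps(2-) Ct_closed Ct_smult derL_P sub subP
    derL_add derL_smult derL_mult
  show "der_contraction R C \<sigma> x \<in> extensional (carrier Ct)" by simp
  fix f assume f: "f \<in> carrier Ct"
  show "der_contraction R C \<sigma> x f \<in> carrier P" using f by simp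
  show "der_contraction R C \<sigma> x (p \<odot>\<^bsub>Ct\<^esub> f) = p \<otimes>\<^bsub>P\<^esub> der_contraction R C \<sigma> x f" if "p \<in> carrier P" for p
    using f that by simp
  fix g assume g: "g \<in> carrier Ct"
  show "der_contraction R C \<sigma> x (f \<oplus>\<^bsub>Ct\<^esub> g) = der_contraction R C \<sigma> x f \<oplus>\<^bsub>P\<^esub> der_contraction R C \<sigma> x g"
    using f g by simp
  show "der_contraction R C \<sigma> x (f \<otimes>\<^bsub>Ct\<^esub> g) =
    epsL f \<otimes>\<^bsub>P\<^esub> der_contraction R C \<sigma> x g \<oplus>\<^bsub>P\<^esub> epsL g \<otimes>\<^bsub>P\<^esub> der_contraction R C \<sigma> x f"
    using f g by simp
qed

end

lemma module_g: "module R \<gg>"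
  by (rule module_der[OF algebra_axioms]) simp

lemma module_gt: "module P \<gg>t"
  by (rule module_der[OF algebra_Ct]) (simp add: epsL_P)

lemma derL_linear:
  assumes x: "x \<in> carrier \<gg>" and f: "f \<in> carrier LC"
  shows "y \<in> carrier \<gg> \<Longrightarrow> derL (x \<oplus>\<^bsub>\<gg>\<^esub> y) f = derL x f \<oplus>\<^bsub>LB\<^esub> derL y f"
    and "r \<in> carrier R \<Longrightarrow> derL (r \<odot>\<^bsub>\<gg>\<^esub> x) f = lmono R 0 r \<otimes>\<^bsub>LB\<^esub> derL x f"
proof -
  interpret g: module R \<gg> by (rule module_g)
  note d = semilin_add_maps[OF derL_semilin]
  have s: "lmono R k (r \<oplus>\<^bsub>R\<^esub> r') = lmono R k r \<oplus>\<^bsub>LB\<^esub> lmono R k r'" if "r \<in> carrier R" "r' \<in> carrier R" for k r r'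
    using add_maps_add[OF LR.lmono_add_maps] that by simp
  show "derL (x \<oplus>\<^bsub>\<gg>\<^esub> y) f = derL x f \<oplus>\<^bsub>LB\<^esub> derL y f" if y: "y \<in> carrier \<gg>"
  proof (rule add_maps_eqI[OF d add_maps_sum[OF d d LR.L.abelian_group_axioms] _ f])
    fix n a assume a: "a \<in> carrier C"
    have "der_even (x \<oplus>\<^bsub>\<gg>\<^esub> y) a = der_even x a \<oplus>\<^bsub>R\<^esub> der_even y a" "der_odd (x \<oplus>\<^bsub>\<gg>\<^esub> y) a = der_odd x a \<oplus>\<^bsub>R\<^esub> der_odd y a"
      using a by (simp_all add: der_even_def der_odd_def der_simps(3) der_closed[OF x] der_closed[OF y]
          R.minus_eq R.minus_add R.r_distr R.r_minus R.a_ac)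
    then show "derL (x \<oplus>\<^bsub>\<gg>\<^esub> y) (lmono C n a) = derL x (lmono C n a) \<oplus>\<^bsub>LB\<^esub> derL y (lmono C n a)"
      using a x y by (simp add: derL_lmono s der_parts_closed lmono_base_closed LR.L.a_ac)
  qed (use x y in simp_all)
  show "derL (r \<odot>\<^bsub>\<gg>\<^esub> x) f = lmono R 0 r \<otimes>\<^bsub>LB\<^esub> derL x f" if r: "r \<in> carrier R"
  proof (rule add_maps_eqI[OF d add_maps_comp[OF d] _ f])
    show "(\<lambda>p. lmono R 0 r \<otimes>\<^bsub>LB\<^esub> p) \<in> add_maps LB LB"
      by (rule add_mapsI) (simp_all add: r lmono_base_closed LR.L_mult_closed LR.L_distr)
    fix n a assume a: "a \<in> carrier C"
    have "der_even (r \<odot>\<^bsub>\<gg>\<^esub> x) a = r \<otimes>\<^bsub>R\<^esub> der_even x a" "der_odd (r \<odot>\<^bsub>\<gg>\<^esub> x) a = r \<otimes>\<^bsub>R\<^esub> der_odd x a"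
      using a r by (simp_all add: der_even_def der_odd_def der_simps(4) der_closed[OF x]
          R.minus_eq R.r_distr R.r_minus R.m_ac)
    then show "derL (r \<odot>\<^bsub>\<gg>\<^esub> x) (lmono C n a) = lmono R 0 r \<otimes>\<^bsub>LB\<^esub> derL x (lmono C n a)"
      using a x r by (simp add: derL_lmono der_parts_closed lmono_base_closed LR.L_distr lmono_base_mult)
  qed (use x r in simp_all)
qed

section \<open>The Lie algebra of the contraction\<close>

lemma poly_t_alg_simps:
  "carrier (poly_t_alg R) = carrier P" "add (poly_t_alg R) = add P" "\<zero>\<^bsub>poly_t_alg R\<^esub> = \<zero>\<^bsub>P\<^esub>"
  "\<one>\<^bsub>poly_t_alg R\<^esub> = \<one>\<^bsub>P\<^esub>"
  by (simp_all add: poly_t_alg_def Let_def)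

lemma poly_t_alg_smult:
  assumes r: "r \<in> carrier R" and p: "p \<in> carrier P"
  shows "r \<odot>\<^bsub>poly_t_alg R\<^esub> p = lmono R 0 r \<otimes>\<^bsub>LB\<^esub> p"
proof -
  have pL: "p \<in> carrier LB" using p poly_t_subset by auto
  have "lmono R 0 r \<otimes>\<^bsub>LB\<^esub> p = (\<lambda>n. r \<otimes>\<^bsub>R\<^esub> p n)"
    using LR.mul.conv_lmono_left[of r p 0] r pL by (simp add: LR.mult_conv)
  then show ?thesis by (simp add: poly_t_alg_def Let_def)
qed

lemma module_poly_t_alg: "module R (poly_t_alg R)"
proof -
  interpret P: cring P by (rule cring_poly_t)
  have subP: "p \<in> carrier LB" if "p \<in> carrier P" for p using that poly_t_subset by auto
  have ag: "abelian_group (poly_t_alg R)"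
    using abelian_groupE[OF P.abelian_group_axioms] by (intro abelian_groupI) (simp_all add: poly_t_alg_simps)
  have s: "lmono R k (r \<oplus>\<^bsub>R\<^esub> r') = lmono R k r \<oplus>\<^bsub>LB\<^esub> lmono R k r'" if "r \<in> carrier R" "r' \<in> carrier R" for k r r'
    using add_maps_add[OF LR.lmono_add_maps] that by simp
  have m: "lmono R 0 (r \<otimes>\<^bsub>R\<^esub> r') = lmono R 0 r \<otimes>\<^bsub>LB\<^esub> lmono R 0 r'" if "r \<in> carrier R" "r' \<in> carrier R" for r r'
    using that by (simp add: lmono_base_mult)
  have one: "lmono R 0 \<one>\<^bsub>R\<^esub> \<otimes>\<^bsub>LB\<^esub> p = p" if "p \<in> carrier P" for p
    using LR.L_one[OF subP[OF that]] by (simp add: laurent_simps(4))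
  show ?thesis
    by (rule moduleI[OF R.is_cring ag])
      (simp_all add: poly_t_alg_simps poly_t_alg_smult poly_t_simps(2-) P_closed lmono_poly_t s m one LR.L_distr
        lmono_base_closed subP LR.L_assoc)
qed

text \<open>The well-definedness of \<open>lie_ident\<close>: a constant from R may be applied to
  the derivation or to the polynomial.\<close>

lemma balanced_lie_ident:
  "balanced R \<gg> (poly_t_alg R) \<gg>t (\<lambda>x p. p \<odot>\<^bsub>\<gg>t\<^esub> der_contraction R C \<sigma> x)"
proof -
  interpret g: module R \<gg> by (rule module_g)
  interpret gt: module P \<gg>t by (rule module_gt)
  have sub: "f \<in> carrier LC" if "f \<in> carrier Ct" for f using that Ct_subset by auto
  have subP: "p \<in> carrier LB" if "p \<in> carrier P" for p using that poly_t_subset by auto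
  note dc = der_contraction_closed
  have add: "der_contraction R C \<sigma> (x \<oplus>\<^bsub>\<gg>\<^esub> y) = der_contraction R C \<sigma> x \<oplus>\<^bsub>\<gg>t\<^esub> der_contraction R C \<sigma> y"
    if "x \<in> carrier \<gg>" "y \<in> carrier \<gg>" for x y
    using that by (auto simp: der_contraction_derL der_simps(3)[of P] derL_linear(1) sub poly_t_simps(2) intro!: restrict_ext)
  show ?thesis
  proof (intro balancedI add_mapsI)
    fix r x p assume r: "r \<in> carrier R" and x: "x \<in> carrier \<gg>" and "p \<in> carrier (poly_t_alg R)"
    then have p: "p \<in> carrier P" by (simp add: poly_t_alg_simps)
    have "p \<otimes>\<^bsub>LB\<^esub> (lmono R 0 r \<otimes>\<^bsub>LB\<^esub> q) = (lmono R 0 r \<otimes>\<^bsub>LB\<^esub> p) \<otimes>\<^bsub>LB\<^esub> q" if "q \<in> carrier LB" for q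
      using that r subP[OF p] LR.L_comm[OF subP[OF p] lmono_base_closed[OF r]]
      by (simp add: LR.L_assoc[symmetric] lmono_base_closed)
    then show "p \<odot>\<^bsub>\<gg>t\<^esub> der_contraction R C \<sigma> (r \<odot>\<^bsub>\<gg>\<^esub> x) =
      (r \<odot>\<^bsub>poly_t_alg R\<^esub> p) \<odot>\<^bsub>\<gg>t\<^esub> der_contraction R C \<sigma> x"
      using r x p by (auto simp: poly_t_alg_smult der_contraction_derL der_simps(4)[of P] derL_linear(2) derL_closed sub
          poly_t_simps(3) intro!: restrict_ext)
  qed (simp_all add: poly_t_alg_simps dc add gt.smult_r_distr gt.smult_l_distr)
qed

interpretation lie: tensor_pair R \<gg> "poly_t_alg R"
  by (rule tensor_pair.intro[OF module_g module_poly_t_alg])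

lemma lie_ident_closed:
  assumes "X \<in> carrier (lie_poly R C \<epsilon>)" shows "lie_ident R C \<epsilon> \<sigma> X \<in> carrier \<gg>t"
  using add_maps_closed[OF lie.tensor_lift_add_maps[OF module.axioms(2)[OF module_gt] balanced_lie_ident]] assms
  by (simp add: lie_ident_def lie_poly_def Let_def)

lemma lie_ident_const:
  assumes x: "x \<in> carrier \<gg>" shows "lie_ident R C \<epsilon> \<sigma> (lie_const R C \<epsilon> x) = der_contraction R C \<sigma> x"
proof -
  interpret gt: module P \<gg>t by (rule module_gt)
  show ?thesis
    using lie.tensor_lift_pure[OF gt.abelian_group_axioms balanced_lie_ident x, of "\<one>\<^bsub>P\<^esub>"]
    by (simp add: lie_ident_def lie_const_def Let_def poly_t_alg_simps der_contraction_closed[OF x])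
qed

text \<open>Brings the derivation into the shape that \<open>diff_rhot\<close> expects, with
  exponent 0: the half carrying the factor s vanishes.\<close>

lemma der_contraction_plus:
  assumes x: "x \<in> der_plus R C \<epsilon> \<sigma>" and f: "f \<in> carrier Ct"
  shows "der_contraction R C \<sigma> x f = lmono R 0 \<one>\<^bsub>R\<^esub> \<otimes>\<^bsub>LB\<^esub> laurent_map x f \<and> der_contraction R C \<sigma> x f \<in> carrier P"
proof -
  have xg: "x \<in> carrier \<gg>" and xs: "\<And>a. a \<in> carrier C \<Longrightarrow> x (\<sigma> a) = x a" using x by (auto simp: der_plus_def)
  have fL: "f \<in> carrier LC" using f Ct_subset by auto
  note l = laurent_map_base[OF der_semilin[OF xg]]
  have "derL x f = laurent_map x f"
  proof (rule add_maps_eqI[OF semilin_add_maps[OF derL_semilin[OF xg]] semilin_add_maps[OF l(1)] _ fL])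
    fix n a assume a: "a \<in> carrier C"
    have "der_even x a = x a" "der_odd x a = \<zero>\<^bsub>R\<^esub>"
      using a by (simp_all add: der_even_def der_odd_def xs der_closed[OF xg] R.r_distr R.l_distr[symmetric] half_two
          R.minus_eq R.r_neg)
    then show "derL x (lmono C n a) = laurent_map x (lmono C n a)"
      using a LR.lmono_zero[of "n + 1"] by (simp add: derL_lmono[OF xg] l(2) lmono_base_closed der_closed[OF xg])
  qed
  moreover have "laurent_map x f \<in> carrier LB" by (rule semilin_closed[OF l(1) fL])
  ultimately show ?thesis
    using f derL_P[OF xg f] LR.L_one[of "laurent_map x f"] by (simp add: der_contraction_derL laurent_simps(4))
qed

text \<open>The counterpart with exponent 1: only the half carrying the factor s survives.\<close>

lemma der_contraction_minus:
  assumes x: "x \<in> der_minus R C \<epsilon> \<sigma>" and f: "f \<in> carrier Ct"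
  shows "der_contraction R C \<sigma> x f = lmono R 1 \<one>\<^bsub>R\<^esub> \<otimes>\<^bsub>LB\<^esub> laurent_map x f \<and> der_contraction R C \<sigma> x f \<in> carrier P"
proof -
  have xg: "x \<in> carrier \<gg>" and xs: "\<And>a. a \<in> carrier C \<Longrightarrow> x (\<sigma> a) = \<ominus>\<^bsub>R\<^esub> x a" using x by (auto simp: der_minus_def)
  have fL: "f \<in> carrier LC" using f Ct_subset by auto
  note l = laurent_map_base[OF der_semilin[OF xg]]
  have s: "(\<lambda>p. lmono R 1 \<one>\<^bsub>R\<^esub> \<otimes>\<^bsub>LB\<^esub> p) \<in> add_maps LB LB"
    by (rule add_mapsI) (simp_all add: lmono_base_one LR.L_mult_closed LR.L_distr)
  have "derL x f = lmono R 1 \<one>\<^bsub>R\<^esub> \<otimes>\<^bsub>LB\<^esub> laurent_map x f"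
  proof (rule add_maps_eqI[OF semilin_add_maps[OF derL_semilin[OF xg]] add_maps_comp[OF semilin_add_maps[OF l(1)] s] _ fL])
    fix n a assume a: "a \<in> carrier C"
    have "der_odd x a = x a" "der_even x a = \<zero>\<^bsub>R\<^esub>"
      using a by (simp_all add: der_even_def der_odd_def xs der_closed[OF xg] R.r_distr R.l_distr[symmetric] half_two
          R.minus_eq R.r_neg)
    then show "derL x (lmono C n a) = lmono R 1 \<one>\<^bsub>R\<^esub> \<otimes>\<^bsub>LB\<^esub> laurent_map x (lmono C n a)"
      using a LR.lmono_zero[of n]
      by (simp add: derL_lmono[OF xg] l(2) lmono_base_closed der_closed[OF xg] lmono_base_mult add.commute)
  qed
  then show ?thesis using f derL_P[OF xg f] by (simp add: der_contraction_derL)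
qed

end

section \<open>The action of the contraction\<close>

text \<open>The second claim uses the first: the comparison map of the double tensor product is the
  injective map that is tensored with the flat contraction. Both levels of modules must be coded in
  the type over which flatness quantifies.\<close>

lemma (in inv_alg_pair)
  fixes i :: "'x \<Rightarrow> 'w" and j :: "'y \<Rightarrow> 'w" and u v :: 'w
  assumes flat: "flat_module TYPE((int \<Rightarrow> 'w) set) P Nt" and code: "inj i" "inj j" "u \<noteq> v"
  shows incl_inj: "inj_on incl (carrier Tt.T)"
    and incl_left_inj: "inj_on (tensor_map LB TL.T NL incl (\<lambda>x. x)) (carrier (tensor P Tt.T Nt))"
proof -
  \<comment> \<open>A Laurent polynomial is coded through the basis element that it forms with a
    fixed dummy partner, a tensor through a representative; one coding of formal sums thus serves
    both.\<close>
  let ?e = "\<lambda>x. graph_code i j u v (frag_of (x, undefined))"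
    and ?e3 = "\<lambda>X. graph_code i j u v (SOME c. c \<in> X)"
  have e: "inj ?e"
    using inj_compose[OF inj_graph_code[OF code] inj_frag_pair] by (simp add: comp_def)
  have e3: "inj_on ?e3 (carrier (tensor R' M' N'))" if "module R' M'" "module R' N'"
    for R' :: "('l, 'i) ring_scheme" and M' :: "('l, int \<Rightarrow> 'x, 'f) module_scheme" and N' :: "('l, int \<Rightarrow> 'y, 'g) module_scheme"
    using comp_inj_on[OF inj_on_some_rep[OF that] inj_on_subset[OF inj_graph_code[OF code]]] by (simp add: comp_def)
  show "inj_on incl (carrier Tt.T)"
    unfolding contraction_tensor_incl_def
    by (rule Y.contraction_tensor_inj[OF X.module_LC flat X.module_Ct X.Ct_incl[OF X.module_LC] _
          inj_on_subset[OF e] inj_on_subset[OF e]]) auto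
  then show "inj_on (tensor_map LB TL.T NL incl (\<lambda>x. x)) (carrier (tensor P Tt.T Nt))"
    by (rule Y.contraction_tensor_inj[OF TL.module_T flat Tt.module_T incl_semilin _
          e3[OF X.module_Ct Y.module_Ct] e3[OF X.module_LC Y.module_LC]])
qed

text \<open>The two \<open>comap_restricts\<close> clauses guarantee that the restricted structure
  maps exist and are unique. The clause on \<open>lie_ident\<close> ensures that each
  \<open>bold x\<close> is a derivation on the contraction, so that its differential action makes
  sense.\<close>

theorem corollary3p9:
  fixes R :: "'k ring" and A :: "('k, 'a) module" and B :: "('k, 'b) module"
    and \<Delta> :: "'a \<Rightarrow> ('a \<times> 'a \<Rightarrow>\<^sub>0 int) set" and \<epsilon> :: "'a \<Rightarrow> 'k" and S \<theta> :: "'a \<Rightarrow> 'a"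
    and \<rho> :: "'b \<Rightarrow> ('b \<times> 'a \<Rightarrow>\<^sub>0 int) set" and \<eta> :: "'b \<Rightarrow> 'b"
  defines "At \<equiv> contraction R A \<theta>"
    and "Bt \<equiv> contraction R B \<eta>"
    and "\<Delta>t \<equiv> contraction_comap R A A \<theta> A \<theta> \<Delta>"
    and "\<rho>t \<equiv> contraction_comap R B B \<eta> A \<theta> \<rho>"
    and "bold \<equiv> \<lambda>x. lie_ident R A \<epsilon> \<theta> (lie_const R A \<epsilon> x)"
  assumes "cring R"
    and "\<one>\<^bsub>R\<^esub> \<oplus>\<^bsub>R\<^esub> \<one>\<^bsub>R\<^esub> \<in> Units R"
    and "hopf_algebra R A \<Delta> \<epsilon> S"
    and "hopf_involution R A \<Delta> \<epsilon> S \<theta>"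
    and "algebra R B"
    and "coaction R A \<Delta> \<epsilon> B \<rho>"
    and "alg_involution R B \<eta>"
    and "\<forall>b\<in>carrier B. \<rho> (\<eta> b) = tensor_map R B A \<eta> \<theta> (\<rho> b)"
    and "flat_module TYPE((int \<Rightarrow> 'k + 'a + 'b) set) (poly_t R) At"
  shows "comap_restricts R A \<theta> A \<theta> A \<theta> \<Delta> \<and>
    hopf_algebra (poly_t R) At \<Delta>t (laurent_map \<epsilon>) (laurent_map S) \<and>
    comap_restricts R B \<eta> B \<eta> A \<theta> \<rho> \<and>
    coaction (poly_t R) At \<Delta>t (laurent_map \<epsilon>) Bt \<rho>t \<and>
    (\<forall>X\<in>carrier (lie_poly R A \<epsilon>).
       lie_ident R A \<epsilon> \<theta> X \<in> carrier (der (poly_t R) At (laurent_map \<epsilon>))) \<and>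
    (\<forall>x\<in>der_plus R A \<epsilon> \<theta>. \<forall>b\<in>eig_plus B \<eta>.
       diff_action Bt \<rho>t (bold x) (lmono B 0 b) = lmono B 0 (diff_action B \<rho> x b)) \<and>
    (\<forall>x\<in>der_minus R A \<epsilon> \<theta>. \<forall>b\<in>eig_plus B \<eta>.
       diff_action Bt \<rho>t (bold x) (lmono B 0 b) = lmono B 1 (diff_action B \<rho> x b)) \<and>
    (\<forall>x\<in>der_plus R A \<epsilon> \<theta>. \<forall>b\<in>eig_minus B \<eta>.
       diff_action Bt \<rho>t (bold x) (lmono B (-1) b) = lmono B (-1) (diff_action B \<rho> x b)) \<and>
    (\<forall>x\<in>der_minus R A \<epsilon> \<theta>. \<forall>b\<in>eig_minus B \<eta>.
       diff_action Bt \<rho>t (bold x) (lmono B (-1) b) = lmono B 0 (diff_action B \<rho> x b))"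
proof -
  note two = assms(7) and hopf = assms(8) and invol = assms(9) and flat = assms(14)[unfolded At_def]
  have algA: "algebra R A" using hopf by (simp add: hopf_algebra_def)
  have A: "inv_alg R A \<theta>"
    using algA two invol by (simp add: inv_alg_def inv_alg_axioms_def laurent_alg_def hopf_involution_def)
  have B: "inv_alg R B \<eta>"
    using assms(10,12) two by (simp add: inv_alg_def inv_alg_axioms_def laurent_alg_def)
  have aug: "aug_alg R A \<theta> \<epsilon>"
    using A hopf invol by (simp add: aug_alg_def aug_alg_axioms_def hopf_algebra_def hopf_involution_def)
  interpret aug: aug_alg R A \<theta> \<epsilon> by (rule aug)
  have AA: "inv_alg_pair R A \<theta> A \<theta>" and BA: "inv_alg_pair R B \<eta> A \<theta>"
    using A B by (simp_all add: inv_alg_pair_def)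
  \<comment> \<open>The sum type contains both coefficient types, and its first summand yields a
    mark \<open>?u\<close> certainly different from \<open>?v\<close>.\<close>
  let ?ia = "(\<lambda>a. Inr (Inl a)) :: 'a \<Rightarrow> 'k + 'a + 'b" and ?ib = "(\<lambda>b. Inr (Inr b)) :: 'b \<Rightarrow> 'k + 'a + 'b"
    and ?u = "Inl undefined :: 'k + 'a + 'b" and ?v = "Inr undefined :: 'k + 'a + 'b"
  have code: "inj ?ia" "inj ?ib" "?u \<noteq> ?v" by (auto simp: inj_def)
  have coA: "comod_inj R A \<theta> A \<theta> \<Delta>"
    using AA hopf invol inv_alg_pair.incl_inj[OF AA flat code(1,1,3)]
    by (simp add: comod_inj_def comod_inj_axioms_def comod_def comod_axioms_def hopf_algebra_def hopf_involution_def)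
  have coB: "comod_inj R B \<eta> A \<theta> \<rho>"
    using BA assms(11,13) inv_alg_pair.incl_inj[OF BA flat code(2,1,3)]
    by (simp add: comod_inj_def comod_inj_axioms_def comod_def comod_axioms_def coaction_def)
  have assocA: "coassoc_comod R A \<theta> A \<theta> \<Delta> \<Delta>"
    using coA hopf inv_alg_pair.incl_left_inj[OF AA flat code(1,1,3)]
    by (simp add: coassoc_comod_def coassoc_comod_axioms_def hopf_algebra_def)
  have assocB: "coassoc_comod R B \<eta> A \<theta> \<rho> \<Delta>"
    using coA coB assms(11) inv_alg_pair.incl_left_inj[OF BA flat code(2,1,3)]
    by (simp add: coassoc_comod_def coassoc_comod_axioms_def coaction_def)
  interpret coA: comod_inj R A \<theta> A \<theta> \<Delta> by (rule coA)
  interpret coB: comod_inj R B \<eta> A \<theta> \<rho> by (rule coB)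
  have H: "hopf_algebra (poly_t R) At \<Delta>t (laurent_map \<epsilon>) (laurent_map S)"
    unfolding At_def \<Delta>t_def
    by (rule hopf_contraction[OF hopf aug assocA]) (use invol in \<open>simp add: hopf_involution_def\<close>)
  have C: "coaction (poly_t R) At \<Delta>t (laurent_map \<epsilon>) Bt \<rho>t"
    unfolding At_def \<Delta>t_def Bt_def \<rho>t_def
    by (rule coaction_contraction[OF assocB aug]) (use assms(11) in \<open>simp add: coaction_def\<close>)
  have L: "lie_ident R A \<epsilon> \<theta> X \<in> carrier (der (poly_t R) At (laurent_map \<epsilon>))" if "X \<in> carrier (lie_poly R A \<epsilon>)" for X
    unfolding At_def by (rule aug.lie_ident_closed[OF that])
  \<comment> \<open>One formula covers the four cases: \<open>n\<close> is 0 or -1 according to the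
    eigenspace of \<open>b\<close>, \<open>k\<close> is 0 or 1 according to that of
    \<open>x\<close>, and the exponents add.\<close>
  have diff: "diff_action Bt \<rho>t (bold x) (lmono B n b) = lmono B (n + k) (diff_action B \<rho> x b)"
    if x: "x \<in> carrier (der R A \<epsilon>)" and f: "lmono B n b \<in> carrier (contraction R B \<eta>)" and b: "b \<in> carrier B"
      and k: "\<And>a. a \<in> carrier (contraction R A \<theta>) \<Longrightarrow> der_contraction R A \<theta> x a =
        lmono R k \<one>\<^bsub>R\<^esub> \<otimes>\<^bsub>laurent_base R\<^esub> laurent_map x a \<and> der_contraction R A \<theta> x a \<in> carrier (poly_t R)"
    for x n b k
    using coB.diff_rhot[OF der_semilin[OF x] f k] coB.lift_diffL[OF der_semilin[OF x] b, of k n]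
    by (simp add: bold_def aug.lie_ident_const[OF x] Bt_def \<rho>t_def diff_action_def)
  have plus: "x \<in> carrier (der R A \<epsilon>)" if "x \<in> der_plus R A \<epsilon> \<theta>" for x using that by (simp add: der_plus_def)
  have minus: "x \<in> carrier (der R A \<epsilon>)" if "x \<in> der_minus R A \<epsilon> \<theta>" for x using that by (simp add: der_minus_def)
  have even: "lmono B 0 b \<in> carrier (contraction R B \<eta>) \<and> b \<in> carrier B" if "b \<in> eig_plus B \<eta>" for b
    using that coB.X.Ct_gens(2)[of b] by (simp add: coB.X.eig_def eig_plus_def)
  have odd: "lmono B (-1) b \<in> carrier (contraction R B \<eta>) \<and> b \<in> carrier B" if "b \<in> eig_minus B \<eta>" for b
    using that coB.X.Ct_gens(3)[of b] by (simp add: coB.X.eig_def eig_minus_def)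
  show ?thesis
    using H C L coA.comap_restricts coB.comap_restricts
      diff[OF plus _ _ aug.der_contraction_plus] diff[OF minus _ _ aug.der_contraction_minus] even odd
    by auto
qed

end
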